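(* The discrete-time impulse control problem with delay, with payoff $J(\delta)=\mathbb E\big[\sum_{k\ge 0}e^{-\theta k}g(X^\delta_k)-\sum_{\ell\ge 0}e^{-\theta(\tau_\ell+\Delta)}\Psi(\zeta_\ell)\big]$ for $\delta=(\tau_p,\zeta_p)_{p\ge 0}\in\mathcal A$, admits an optimal strategy $\delta^*=(\tau_n^*,\xi_n^* )_{n\ge 0}\in\mathcal A$, i.e. $J(\delta^* )=\sup_{\delta\in\mathcal A}J(\delta)$. Moreover, $$Y_0(0,0)=\sup_{\delta\in\mathcal A}J(\delta)=J(\delta^* ),$$ where $Y_0(0,0)$ is the value at $k=0$ and $(\nu,\xi)=(0,0)$ of the limit process $Y_k(\nu,\xi)=\lim_{n\to\infty}Y^n_k(\nu,\xi)$, $k\ge\nu$.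
   Context: Setting: $(\Omega,\mathcal F,\mathbb P)$ is a probability space with a filtration $\mathbb F=(\mathcal F_n)_{n\ge 0}$, and $\mathcal F_\infty$ is the $\sigma$-algebra generated by all $\mathcal F_n$. $\Delta$ is a positive integer (the delay), $\theta>0$ is a constant, $\mathbb U$ is a finite subset of $\mathbb R^d$, $(X_n)_{n\ge 0}$ is an $\mathbb F$-adapted $\mathbb R^d$-valued process, and $g$ (on $\mathbb R^d$) and $\Psi$ (on $\mathbb U$) are bounded real-valued measurable functions, with no sign imposed. Stopping times are $\mathbb F$-stopping times with values in $\{0,1,2,\dots\}\cup\{+\infty\}$. Conventions: $e^{-\theta\cdot\infty}=0$, and sums over $\ell$ or $k$ run over finite nonnegative integers. Admissible strategies: $\mathcal A$ is the set of sequences $\delta=(\tau_p,\zeta_p)_{p\ge 0}$ such that each $\tau_p$ is a stopping time, $\tau_{p+1}-\tau_p\ge\Delta$ $\mathbb P$-a.s., and $\zeta_p$ is a $\mathbb U$-valued $\mathcal F_{\tau_p}$-measurable random variable. The controlled process is $$X^\delta_k=X_k1_{\{k<\tau_0+\Delta\}}+\sum_{\ell\ge 0}(X_k+\zeta_0+\cdots+\zeta_\ell)1_{\{\tau_\ell+\Delta\le k<\tau_{\ell+1}+\Delta\}},\quad k\ge 0.$$ Iterative scheme: for a stopping time $\nu$ and a $\mathbb U$-valued $\mathcal F_\nu$-measurable random variable $\xi$ (the same formulas being used when the second argument is $0$ or a sum such as $\xi+\beta$ with $\beta\in\mathbb U$), define for finite $k\ge 0$ $$Y^0_k(\nu,\xi)=\mathbb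 E\Big[\sum_{\ell\ge k}e^{-\theta\ell}g(X_\ell+\xi)1_{\{\ell\ge\nu\}}\Big|\mathcal F_k\Big],\qquad Y^0_\infty(\nu,\xi)=0,$$ and for $n\ge 1$, $\mathcal O^n_\infty(\nu,\xi)=0$, $Y^n_\infty(\nu,\xi)=0$ and, for finite $k\ge 0$, $$\mathcal O^n_k(\nu,\xi)=\mathbb E\Big[\sum_{k+1\le\ell<k+\Delta}e^{-\theta\ell}g(X_\ell+\xi)1_{\{\ell\ge\nu\}}\Big|\mathcal F_k\Big]+\max_{\beta\in\mathbb U}\mathbb E\big[-e^{-\theta(k+\Delta)}\Psi(\beta)+Y^{n-1}_{k+\Delta}(\nu,\xi+\beta)\big|\mathcal F_k\big],$$ $$Y^n_k(\nu,\xi)=\operatorname*{ess\,sup}_{\tau\ge k}\mathbb E\Big[\sum_{k\le\ell\le\tau}e^{-\theta\ell}g(X_\ell+\xi)1_{\{\ell\ge\nu\}}+\mathcal O^n_\tau(\nu,\xi)\Big|\mathcal F_k\Big],$$ the essential supremum being over stopping times $\tau\ge k$. For $k\ge\nu$ the sequence $Y^n_k(\nu,\xi)$ is $\mathbb P$-a.s. nondecreasing in $n$ and bounded, so the limit $Y_k(\nu,\xi)$ exists.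
   Formalization: Y_0(0,0) is an F_0-measurable random variable and need not be constant, so the identity is stated as E[Y_0(0,0)] = sup J = J(δ* ) in general, and as Y_0(0,0) = sup J almost surely when F_0 is trivial; U is taken nonempty. *)

theory Defs
  imports "HOL-Probability.Probability"
begin

(* The filtration (F n) extended to the index infinity by the sigma-algebra generated by all F n.
   Stopping times with values in {0,1,2,...} and infinity are then the library's stopping times
   over the index type enat; the condition at the index infinity is vacuous for stopping_time,
   and for pre_sigma it says that the events of the stopped sigma-algebra lie in F_infinity. *)
definition filt_ext :: "(nat \<Rightarrow> 'a measure) \<Rightarrow> enat \<Rightarrow> 'a measure" where
  "filt_ext F t =
     (case t of enat n \<Rightarrow> F n | \<infinity> \<Rightarrow> sigma (space (F 0)) (\<Union>n. sets (F n)))"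

definition discount :: "real \<Rightarrow> enat \<Rightarrow> real" where
  "discount \<theta> t = (case t of enat n \<Rightarrow> exp (- \<theta> * real n) | \<infinity> \<Rightarrow> 0)"

(* Essential supremum of a family of random variables (the library's esssup is the essential
   supremum of one function). It is determined up to a null set only; the choice operator picks
   an arbitrary version, just as real_cond_exp does for conditional expectations. *)
definition is_ess_sup :: "'a measure \<Rightarrow> ('a \<Rightarrow> real) set \<Rightarrow> ('a \<Rightarrow> real) \<Rightarrow> bool" where
  "is_ess_sup M \<Phi> S \<longleftrightarrow>
     S \<in> borel_measurable M \<and>
     (\<forall>f\<in>\<Phi>. AE \<omega> in M. f \<omega> \<le> S \<omega>) \<and>
     (\<forall>Z\<in>borel_measurable M. (\<forall>f\<in>\<Phi>. AE \<omega> in M. f \<omega> \<le> Z \<omega>) \<longrightarrow> (AE \<omega> in M. S \<omega> \<le> Z \<omega>))"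

definition ess_sup_family :: "'a measure \<Rightarrow> ('a \<Rightarrow> real) set \<Rightarrow> 'a \<Rightarrow> real" where
  "ess_sup_family M \<Phi> = (SOME S. is_ess_sup M \<Phi> S)"


subsection \<open>Admissible strategies and payoff\<close>

(* A strategy is a pair (tau, zeta) of sequences. The requirement tau (p+1) - tau p >= Delta is
   written additively, so that tau p = infinity forces tau (p+1) = infinity. *)
definition strategies ::
  "'a measure \<Rightarrow> (nat \<Rightarrow> 'a measure) \<Rightarrow> nat \<Rightarrow> 'b::euclidean_space set \<Rightarrow>
     ((nat \<Rightarrow> 'a \<Rightarrow> enat) \<times> (nat \<Rightarrow> 'a \<Rightarrow> 'b)) set" where
  "strategies M F \<Delta> U = {(\<tau>, \<zeta>). \<forall>p.
     stopping_time (filt_ext F) (\<tau> p) \<and>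
     (AE \<omega> in M. \<tau> p \<omega> + enat \<Delta> \<le> \<tau> (Suc p) \<omega>) \<and>
     \<zeta> p \<in> borel_measurable (filtration.pre_sigma (space M) (filt_ext F) (\<tau> p)) \<and>
     (\<forall>\<omega>\<in>space M. \<zeta> p \<omega> \<in> U)}"

definition controlled ::
  "nat \<Rightarrow> (nat \<Rightarrow> 'a \<Rightarrow> 'b::euclidean_space) \<Rightarrow>
     (nat \<Rightarrow> 'a \<Rightarrow> enat) \<times> (nat \<Rightarrow> 'a \<Rightarrow> 'b) \<Rightarrow> nat \<Rightarrow> 'a \<Rightarrow> 'b" where
  "controlled \<Delta> X = (\<lambda>(\<tau>, \<zeta>) k \<omega>.
     of_bool (enat k < \<tau> 0 \<omega> + enat \<Delta>) *\<^sub>R X k \<omega> +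
     (\<Sum>l. of_bool (\<tau> l \<omega> + enat \<Delta> \<le> enat k \<and> enat k < \<tau> (Suc l) \<omega> + enat \<Delta>) *\<^sub>R
            (X k \<omega> + (\<Sum>j\<le>l. \<zeta> j \<omega>))))"

definition payoff ::
  "'a measure \<Rightarrow> nat \<Rightarrow> real \<Rightarrow> (nat \<Rightarrow> 'a \<Rightarrow> 'b::euclidean_space) \<Rightarrow>
     ('b \<Rightarrow> real) \<Rightarrow> ('b \<Rightarrow> real) \<Rightarrow>
     (nat \<Rightarrow> 'a \<Rightarrow> enat) \<times> (nat \<Rightarrow> 'a \<Rightarrow> 'b) \<Rightarrow> real" where
  "payoff M \<Delta> \<theta> X g \<Psi> \<delta> =
     (LINT \<omega>|M. (\<Sum>k. exp (- \<theta> * real k) * g (controlled \<Delta> X \<delta> k \<omega>))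
              - (\<Sum>l. discount \<theta> (fst \<delta> l \<omega> + enat \<Delta>) * \<Psi> (snd \<delta> l \<omega>)))"


subsection \<open>The iterative scheme\<close>

(* Discounted gain over the finite times l with a <= l <= b, restricted to l >= nu. *)
definition gain ::
  "real \<Rightarrow> (nat \<Rightarrow> 'a \<Rightarrow> 'b::euclidean_space) \<Rightarrow> ('b \<Rightarrow> real) \<Rightarrow>
     ('a \<Rightarrow> enat) \<Rightarrow> ('a \<Rightarrow> 'b) \<Rightarrow> nat \<Rightarrow> enat \<Rightarrow> 'a \<Rightarrow> real" where
  "gain \<theta> X g \<nu> \<xi> a b \<omega> =
     (\<Sum>l. exp (- \<theta> * real l) * g (X l \<omega> + \<xi> \<omega>) *
           of_bool (a \<le> l \<and> enat l \<le> b \<and> \<nu> \<omega> \<le> enat l))"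

(* One step of the scheme: the process O^n built from Y = Y^(n-1). *)
definition obstacle_step ::
  "'a measure \<Rightarrow> (nat \<Rightarrow> 'a measure) \<Rightarrow> nat \<Rightarrow> real \<Rightarrow> 'b::euclidean_space set \<Rightarrow>
     (nat \<Rightarrow> 'a \<Rightarrow> 'b) \<Rightarrow> ('b \<Rightarrow> real) \<Rightarrow> ('b \<Rightarrow> real) \<Rightarrow>
     (('a \<Rightarrow> enat) \<Rightarrow> ('a \<Rightarrow> 'b) \<Rightarrow> enat \<Rightarrow> 'a \<Rightarrow> real) \<Rightarrow>
     ('a \<Rightarrow> enat) \<Rightarrow> ('a \<Rightarrow> 'b) \<Rightarrow> enat \<Rightarrow> 'a \<Rightarrow> real" where
  "obstacle_step M F \<Delta> \<theta> U X g \<Psi> Y \<nu> \<xi> t \<omega> = (case t of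
     \<infinity> \<Rightarrow> 0
   | enat k \<Rightarrow>
       real_cond_exp M (F k)
         (\<lambda>\<omega>'. \<Sum>l\<in>{k+1..<k+\<Delta>}.
            exp (- \<theta> * real l) * g (X l \<omega>' + \<xi> \<omega>') * of_bool (\<nu> \<omega>' \<le> enat l)) \<omega>
       + Max ((\<lambda>\<beta>. real_cond_exp M (F k)
                (\<lambda>\<omega>'. - exp (- \<theta> * real (k + \<Delta>)) * \<Psi> \<beta>
                       + Y \<nu> (\<lambda>\<omega>''. \<xi> \<omega>'' + \<beta>) (enat (k + \<Delta>)) \<omega>') \<omega>) ` U))"

primrec Y_iter ::
  "'a measure \<Rightarrow> (nat \<Rightarrow> 'a measure) \<Rightarrow> nat \<Rightarrow> real \<Rightarrow> 'b::euclidean_space set \<Rightarrow>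
     (nat \<Rightarrow> 'a \<Rightarrow> 'b) \<Rightarrow> ('b \<Rightarrow> real) \<Rightarrow> ('b \<Rightarrow> real) \<Rightarrow> nat \<Rightarrow>
     ('a \<Rightarrow> enat) \<Rightarrow> ('a \<Rightarrow> 'b) \<Rightarrow> enat \<Rightarrow> 'a \<Rightarrow> real" where
  "Y_iter M F \<Delta> \<theta> U X g \<Psi> 0 = (\<lambda>\<nu> \<xi> t. case t of
     \<infinity> \<Rightarrow> (\<lambda>\<omega>. 0)
   | enat k \<Rightarrow> real_cond_exp M (F k) (gain \<theta> X g \<nu> \<xi> k \<infinity>))"
| "Y_iter M F \<Delta> \<theta> U X g \<Psi> (Suc n) = (\<lambda>\<nu> \<xi> t. case t of
     \<infinity> \<Rightarrow> (\<lambda>\<omega>. 0)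
   | enat k \<Rightarrow> ess_sup_family M
       {real_cond_exp M (F k)
          (\<lambda>\<omega>. gain \<theta> X g \<nu> \<xi> k (\<tau> \<omega>) \<omega>
               + obstacle_step M F \<Delta> \<theta> U X g \<Psi> (Y_iter M F \<Delta> \<theta> U X g \<Psi> n) \<nu> \<xi> (\<tau> \<omega>) \<omega>)
        | \<tau>. stopping_time (filt_ext F) \<tau> \<and> (\<forall>\<omega>\<in>space M. enat k \<le> \<tau> \<omega>)})"

definition Y_lim ::
  "'a measure \<Rightarrow> (nat \<Rightarrow> 'a measure) \<Rightarrow> nat \<Rightarrow> real \<Rightarrow> 'b::euclidean_space set \<Rightarrow>
     (nat \<Rightarrow> 'a \<Rightarrow> 'b) \<Rightarrow> ('b \<Rightarrow> real) \<Rightarrow> ('b \<Rightarrow> real) \<Rightarrow>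
     ('a \<Rightarrow> enat) \<Rightarrow> ('a \<Rightarrow> 'b) \<Rightarrow> enat \<Rightarrow> 'a \<Rightarrow> real" where
  "Y_lim M F \<Delta> \<theta> U X g \<Psi> \<nu> \<xi> t \<omega> = lim (\<lambda>n. Y_iter M F \<Delta> \<theta> U X g \<Psi> n \<nu> \<xi> t \<omega>)"

end

theory Submission
  imports Defs
begin

text \<open>
  Since the problem starts from \<open>(\<nu>, \<xi>) = (0, 0)\<close>, the second argument of the scheme only takes
  constant values \<open>c\<close>, and everything can be read off the one-step dynamic programming equation
  \<open>V k c = G k c + max (obstacle V k c) (E k (V (k + 1) c))\<close>.
  Because of the discounting its right-hand side is a contraction for the norms
  \<open>|V k c| / exp (- \<theta> k)\<close>, so it has a solution \<open>V\<close>. Each \<open>Y\<^sup>n\<close> is the Snell envelope of the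
  previous obstacle and solves the same kind of equation; one iteration gains a factor
  \<open>exp (- \<theta>)\<close>, whence \<open>Y\<^sup>n \<longlongrightarrow> V\<close> almost surely.
  For the verification, a strategy is encoded by the impulses ordered at each time, driving a
  state with finitely many values at each time. The value of the state plus the rewards collected
  so far is then a supermartingale in mean, and a martingale in mean for the feedback strategy that
  orders a maximizing impulse as soon as the obstacle exceeds the continuation value.
\<close>

text \<open>No sign is imposed on \<open>g\<close> and \<open>\<Psi>\<close>, so the limit of the
  iterates is not reached by monotone convergence; geometric bounds take its place and supply
  integrability throughout. Null sets are the recurring obstacle. \<open>V k c\<close> is determined
  only almost surely for each fixed pair, and \<open>c\<close> ranges over an uncountable space, so
  no single null set is available for all \<open>c\<close>. Hence closeness of two families is
  always measured for fixed \<open>k\<close> and \<open>c\<close>, and along a control the state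
  stays in a finite set at each time, so that finitely many null sets are discarded there.
  Finiteness of \<open>U\<close> thus serves the maximum, the state space and the measurable choice
  of an impulse. A further obstacle is the choice of versions: \<open>Y\<^sup>n\<close> comes out of
  a choice operator and is known only to be \<open>M\<close>-measurable, so it is followed through
  an adapted process that agrees with it almost surely.\<close>

section \<open>Geometric bounds, essential suprema and series\<close>

lemma geometric_steps_limit:
  fixes x :: "nat \<Rightarrow> real"
  assumes step: "\<And>m. \<bar>x (Suc m) - x m\<bar> \<le> B * q ^ m" and q: "0 < q" "q < 1"
  shows "\<bar>lim x - x m\<bar> \<le> B / (1 - q) * q ^ m" and "x \<longlonglongrightarrow> lim x"
proof -
  have B: "0 \<le> B" using step[of 0] by simp
  \<comment> \<open>The factor \<open>1 - q ^ n\<close> closes the induction exactly, since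
    \<open>B * q ^ (m + n)\<close> equals \<open>B / (1 - q) * q ^ m * (q ^ n - q ^ Suc n)\<close>.
    It is dropped right afterwards, leaving a bound uniform in \<open>n\<close>.\<close>
  have *: "\<bar>x (m + n) - x m\<bar> \<le> B / (1 - q) * q ^ m * (1 - q ^ n)" for m n
  proof (induction n)
    case (Suc n)
    have "\<bar>x (m + Suc n) - x m\<bar> \<le> B * q ^ (m + n) + B / (1 - q) * q ^ m * (1 - q ^ n)"
      using Suc step[of "m + n"] by simp
    also have "\<dots> = B / (1 - q) * q ^ m * (1 - q ^ Suc n)"
      using q by (simp add: field_simps power_add)
    finally show ?case .
  qed simp
  have **: "\<bar>x (m + n) - x m\<bar> \<le> B / (1 - q) * q ^ m" for m n
  proof -
    have "B / (1 - q) * q ^ m * (1 - q ^ n) \<le> B / (1 - q) * q ^ m * 1"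
      using q B by (intro mult_left_mono) auto
    then show ?thesis using *[of m n] by simp
  qed
  have lim0: "(\<lambda>m. B / (1 - q) * q ^ m) \<longlonglongrightarrow> 0"
    using q by (intro tendsto_mult_right_zero LIMSEQ_power_zero) auto
  have "Cauchy x"
  proof (rule CauchyI')
    fix e :: real assume "0 < e"
    from order_tendstoD(2)[OF lim0 this] obtain N where N: "\<And>m. m \<ge> N \<Longrightarrow> B / (1 - q) * q ^ m < e"
      by (auto simp: eventually_sequentially)
    have "dist (x m) (x n) < e" if "m \<ge> N" "n > m" for m n
      using **[of m "n - m"] N[OF that(1)] that by (auto simp: dist_real_def abs_minus_commute)
    then show "\<exists>N. \<forall>m\<ge>N. \<forall>n>m. dist (x m) (x n) < e" by blast
  qed
  then have "convergent x" by (rule Cauchy_convergent)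
  then show L: "x \<longlonglongrightarrow> lim x" by (simp add: convergent_LIMSEQ_iff)
  have "(\<lambda>n. \<bar>x (n + m) - x m\<bar>) \<longlonglongrightarrow> \<bar>lim x - x m\<bar>"
    by (intro tendsto_intros LIMSEQ_ignore_initial_segment L)
  then show "\<bar>lim x - x m\<bar> \<le> B / (1 - q) * q ^ m"
    by (rule LIMSEQ_le_const2) (use **[of m] in \<open>auto simp: add.commute\<close>)
qed

lemma summable_abs_le_geometric:
  fixes a :: "nat \<Rightarrow> real"
  assumes "\<And>l. \<bar>a l\<bar> \<le> B * q ^ l" and "0 < q" "q < 1"
  shows "summable a"
  by (rule summable_comparison_test'[of "\<lambda>l. B * q ^ l" 0])
    (use assms in \<open>auto intro!: summable_mult\<close>)

lemma geometric_tail: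
  fixes a :: "nat \<Rightarrow> real"
  assumes a: "\<And>l. \<bar>a l\<bar> \<le> B * q ^ l" and q: "0 < q" "q < 1"
  shows "\<bar>(\<Sum>l. a l) - (\<Sum>l<N. a l)\<bar> \<le> B / (1 - q) * q ^ N"
proof -
  have "(\<lambda>n. \<Sum>l<n. a l) \<longlonglongrightarrow> (\<Sum>l. a l)"
    using summable_abs_le_geometric[OF a q] by (rule summable_LIMSEQ)
  moreover have "\<bar>(\<Sum>l<Suc m. a l) - (\<Sum>l<m. a l)\<bar> \<le> B * q ^ m" for m
    using a[of m] by simp
  ultimately show ?thesis
    using geometric_steps_limit(1)[of "\<lambda>n. \<Sum>l<n. a l", OF _ q] limI by metis
qed

lemma is_ess_sup_unique:
  assumes "is_ess_sup M \<Phi> S" "is_ess_sup M \<Phi> S'"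
  shows "AE \<omega> in M. S \<omega> = S' \<omega>"
proof -
  have "AE \<omega> in M. S \<omega> \<le> S' \<omega>" "AE \<omega> in M. S' \<omega> \<le> S \<omega>"
    using assms by (simp_all add: is_ess_sup_def)
  then show ?thesis by eventually_elim simp
qed

text \<open>Any witness that an essential supremum exists makes the chosen version one as well. The
  witness will be a Snell envelope, so no general existence theorem enters.\<close>

lemma is_ess_sup_ess_sup_family: "is_ess_sup M \<Phi> S \<Longrightarrow> is_ess_sup M \<Phi> (ess_sup_family M \<Phi>)"
  unfolding ess_sup_family_def by (rule someI[of "is_ess_sup M \<Phi>"])

text \<open>A maximum over a finite set is nonexpansive for the sup norm; this keeps the obstacle
  operator a contraction.\<close>

lemma abs_Max_diff_le:
  fixes f h :: "'b \<Rightarrow> real"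
  assumes "finite U" "U \<noteq> {}" "\<And>\<beta>. \<beta> \<in> U \<Longrightarrow> \<bar>f \<beta> - h \<beta>\<bar> \<le> C"
  shows "\<bar>Max (f ` U) - Max (h ` U)\<bar> \<le> C"
proof -
  have "Max (f ` U) \<le> Max (h ` U) + C" if "\<And>\<beta>. \<beta> \<in> U \<Longrightarrow> \<bar>f \<beta> - h \<beta>\<bar> \<le> C" for f h
  proof (rule Max.boundedI)
    fix y assume "y \<in> f ` U"
    then obtain \<beta> where "\<beta> \<in> U" "y = f \<beta>" by blast
    moreover have "h \<beta> \<le> Max (h ` U)" using \<open>\<beta> \<in> U\<close> assms(1) by simp
    moreover have "f \<beta> \<le> h \<beta> + C" using that[OF \<open>\<beta> \<in> U\<close>] by linarith
    ultimately show "y \<le> Max (h ` U) + C" by linarith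
  qed (use assms in auto)
  from this[of f h] this[of h f] assms(3) show ?thesis by (simp add: abs_le_iff abs_minus_commute)
qed

lemma abs_max_diff_le:
  fixes a b c d :: real
  shows "\<bar>max a b - max c d\<bar> \<le> max \<bar>a - c\<bar> \<bar>b - d\<bar>"
  by (simp add: max_def abs_if)

lemma suminf_reindex_partial:
  fixes f h :: "nat \<Rightarrow> real"
  assumes inj: "inj_on T B" and eq: "\<And>l. l \<in> B \<Longrightarrow> f (T l) = h l"
    and f0: "\<And>k. k \<notin> T ` B \<Longrightarrow> f k = 0" and h0: "\<And>l. l \<notin> B \<Longrightarrow> h l = 0"
    and f: "summable (\<lambda>k. \<bar>f k\<bar>)" and h: "summable (\<lambda>l. \<bar>h l\<bar>)"
  shows "(\<Sum>k. f k) = (\<Sum>l. h l)"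
proof -
  have "(f has_sum (\<Sum>k. f k)) UNIV"
    using f by (intro norm_summable_imp_has_sum) (auto intro: summable_sums summable_rabs_cancel)
  then have "(f has_sum (\<Sum>k. f k)) (T ` B)"
    by (rule has_sum_cong_neutral[THEN iffD1, rotated -1]) (auto intro: f0)
  then have "((f \<circ> T) has_sum (\<Sum>k. f k)) B"
    by (simp add: has_sum_reindex[OF inj])
  then have "(h has_sum (\<Sum>k. f k)) UNIV"
    by (rule has_sum_cong_neutral[THEN iffD1, rotated -1]) (auto intro: h0 simp: eq)
  moreover have "(h has_sum (\<Sum>l. h l)) UNIV"
    using h by (intro norm_summable_imp_has_sum) (auto intro: summable_sums summable_rabs_cancel)
  ultimately show ?thesis by (rule has_sum_unique)
qed

lemma Inf_enat_in: "Inf A = enat k \<Longrightarrow> enat k \<in> A"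
  by (metis Inf_enat_def LeastI_ex all_not_in_conv enat.distinct(1))

section \<open>Fixed points and Snell envelopes\<close>

locale discounted_filtration = prob_space M + filtration "space M" F
  for M :: "'a measure" and F :: "nat \<Rightarrow> 'a measure" +
  fixes q :: real
  assumes subalg: "subalgebra M (F n)" and q: "0 < q" "q < 1"
begin

abbreviation E :: "nat \<Rightarrow> ('a \<Rightarrow> real) \<Rightarrow> 'a \<Rightarrow> real" where
  "E k \<equiv> real_cond_exp M (F k)"

lemma sigma_finite_subalg: "sigma_finite_subalgebra M (F k)"
proof -
  interpret finite_measure_subalgebra M "F k"
    by unfold_locales (rule subalg)
  show ?thesis by unfold_locales
qed

lemma measurable_F_mono: "f \<in> borel_measurable (F i) \<Longrightarrow> i \<le> j \<Longrightarrow> f \<in> borel_measurable (F j)"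
  using sets_F_mono[of i j] space_F[of i] space_F[of j] by (auto simp: measurable_def)

lemma sets_F_M: "A \<in> sets (F i) \<Longrightarrow> A \<in> sets M"
  using subalg[of i] by (auto simp: subalgebra_def)

lemma measurable_F_M: "f \<in> borel_measurable (F i) \<Longrightarrow> f \<in> borel_measurable M"
  using subalg measurable_from_subalg by blast

lemma subalg_F: "i \<le> j \<Longrightarrow> subalgebra (F j) (F i)"
  using sets_F_mono[of i j] by (auto simp: subalgebra_def space_F)

lemma integrable_bounded:
  fixes f :: "'a \<Rightarrow> real"
  assumes "f \<in> borel_measurable M" "AE \<omega> in M. \<bar>f \<omega>\<bar> \<le> C"
  shows "integrable M f"
  using assms by (intro integrable_const_bound[where B=C]) auto

text \<open>Conditional expectation is nonexpansive for the essential sup norm. The form with a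
  difference is the one that feeds the contraction estimates.\<close>

lemma cond_exp_close:
  assumes "integrable M f" "integrable M h" "AE \<omega> in M. \<bar>f \<omega> - h \<omega>\<bar> \<le> C"
  shows "AE \<omega> in M. \<bar>E k f \<omega> - E k h \<omega>\<bar> \<le> C"
proof -
  interpret k: sigma_finite_subalgebra M "F k" by (rule sigma_finite_subalg)
  have "AE \<omega> in M. E k (\<lambda>\<omega>. f \<omega> - h \<omega>) \<omega> \<le> C"
    by (rule k.real_cond_exp_le_c) (use assms in auto)
  moreover have "AE \<omega> in M. - C \<le> E k (\<lambda>\<omega>. f \<omega> - h \<omega>) \<omega>"
    by (rule k.real_cond_exp_ge_c) (use assms in auto)
  ultimately show ?thesis
    using k.real_cond_exp_diff[OF assms(1,2)] by eventually_elim auto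
qed

lemma cond_exp_bound:
  assumes "f \<in> borel_measurable M" "AE \<omega> in M. \<bar>f \<omega>\<bar> \<le> C"
  shows "AE \<omega> in M. \<bar>E k f \<omega>\<bar> \<le> C"
proof -
  interpret k: sigma_finite_subalgebra M "F k" by (rule sigma_finite_subalg)
  have "AE \<omega> in M. E k (\<lambda>\<omega>. 0) \<omega> = 0" by (rule k.real_cond_exp_F_meas) auto
  moreover have "AE \<omega> in M. \<bar>E k f \<omega> - E k (\<lambda>\<omega>. 0) \<omega>\<bar> \<le> C"
    by (rule cond_exp_close) (use integrable_bounded[OF assms] assms in auto)
  ultimately show ?thesis by eventually_elim auto
qed

text \<open>Adapted processes whose bound decays like the discount factor: the weighted sup norm for which
  the dynamic programming operators are contractions.\<close>

definition decaying :: "(nat \<Rightarrow> 'i \<Rightarrow> 'a \<Rightarrow> real) \<Rightarrow> bool" where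
  "decaying Z \<longleftrightarrow> (\<forall>k c. Z k c \<in> borel_measurable (F k)) \<and>
     (\<exists>C. \<forall>k c. AE \<omega> in M. \<bar>Z k c \<omega>\<bar> \<le> C * q ^ k)"

lemma decaying_adapted: "decaying Z \<Longrightarrow> Z k c \<in> borel_measurable (F k)"
  by (simp add: decaying_def)

lemma decaying_measurable: "decaying Z \<Longrightarrow> Z k c \<in> borel_measurable M"
  by (rule measurable_F_M) (rule decaying_adapted)

lemma decaying_bound:
  assumes "decaying Z"
  obtains C where "0 \<le> C" "\<And>k c. AE \<omega> in M. \<bar>Z k c \<omega>\<bar> \<le> C * q ^ k"
proof -
  obtain C where C: "\<And>k c. AE \<omega> in M. \<bar>Z k c \<omega>\<bar> \<le> C * q ^ k"
    using assms by (auto simp: decaying_def)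
  have "AE \<omega> in M. \<bar>Z k c \<omega>\<bar> \<le> \<bar>C\<bar> * q ^ k" for k c
    using C[of k c]
  proof eventually_elim
    case (elim \<omega>)
    have "C * q ^ k \<le> \<bar>C\<bar> * q ^ k" using q by (intro mult_right_mono) auto
    with elim show ?case by simp
  qed
  then show ?thesis using that[of "\<bar>C\<bar>"] by auto
qed

lemma decayingI:
  assumes "\<And>k c. Z k c \<in> borel_measurable (F k)"
    and "\<And>k c. AE \<omega> in M. \<bar>Z k c \<omega>\<bar> \<le> C * q ^ k"
  shows "decaying Z"
  using assms by (auto simp: decaying_def)

lemma decaying_integrable:
  assumes "decaying Z"
  shows "integrable M (Z k c)"
  by (rule decaying_bound[OF assms], rule integrable_bounded[OF decaying_measurable[OF assms]])

text \<open>Picard iteration from zero, carried out pointwise. Elements of the weighted space matter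
  only up to null sets, so the limit is formed by \<open>lim\<close> at each \<omega>, and
  convergence and the fixed point equation are recovered outside a null set that may depend on
  \<open>k\<close> and \<open>c\<close>.\<close>

lemma contraction_fixed_point:
  fixes T :: "(nat \<Rightarrow> 'i \<Rightarrow> 'a \<Rightarrow> real) \<Rightarrow> nat \<Rightarrow> 'i \<Rightarrow> 'a \<Rightarrow> real"
  assumes T: "\<And>Z. decaying Z \<Longrightarrow> decaying (T Z)"
    and contr: "\<And>Z Z' D k c. decaying Z \<Longrightarrow> decaying Z' \<Longrightarrow> 0 \<le> D \<Longrightarrow>
      (\<And>k c. AE \<omega> in M. \<bar>Z k c \<omega> - Z' k c \<omega>\<bar> \<le> D * q ^ k) \<Longrightarrow>
      AE \<omega> in M. \<bar>T Z k c \<omega> - T Z' k c \<omega>\<bar> \<le> D * q * q ^ k"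
  shows "\<exists>V. decaying V \<and> (\<forall>k c. AE \<omega> in M. V k c \<omega> = T V k c \<omega>)"
proof -
  define A where "A m = (T ^^ m) (\<lambda>_ _ _. 0)" for m
  have A: "decaying (A m)" for m
    by (induction m) (auto simp: A_def T intro: decayingI[where C=0])
  obtain C where C: "0 \<le> C" "\<And>k c. AE \<omega> in M. \<bar>A 1 k c \<omega>\<bar> \<le> C * q ^ k"
    by (rule decaying_bound[OF A[of 1]]) auto
  have step: "AE \<omega> in M. \<bar>A (Suc m) k c \<omega> - A m k c \<omega>\<bar> \<le> (C * q ^ m) * q ^ k" for m k c
  proof (induction m arbitrary: k c)
    case 0
    then show ?case using C(2)[of k c] by (simp add: A_def)
  next
    case (Suc m)
    have "AE \<omega> in M. \<bar>T (A (Suc m)) k c \<omega> - T (A m) k c \<omega>\<bar> \<le> C * q ^ m * q * q ^ k"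
      by (rule contr[OF A A]) (use C q Suc in auto)
    then show ?case by (simp add: A_def mult_ac)
  qed
  define V where "V k c \<omega> = lim (\<lambda>m. A m k c \<omega>)" for k c \<omega>
  define C' where "C' = C / (1 - q)"
  have C': "0 \<le> C'" using C q by (simp add: C'_def)
  have close: "AE \<omega> in M. \<bar>V k c \<omega> - A m k c \<omega>\<bar> \<le> C' * q ^ m * q ^ k" for m k c
  proof -
    have "AE \<omega> in M. \<forall>m. \<bar>A (Suc m) k c \<omega> - A m k c \<omega>\<bar> \<le> (C * q ^ m) * q ^ k"
      using step by (simp add: AE_all_countable)
    then show ?thesis
    proof eventually_elim
      case (elim \<omega>)
      show ?case
        using geometric_steps_limit(1)[of "\<lambda>m. A m k c \<omega>" "C * q ^ k" q m] elim q
        by (simp add: V_def C'_def mult_ac)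
    qed
  qed
  \<comment> \<open>\<open>lim\<close> of measurable functions is measurable on the whole space,
    also where the sequence diverges, so \<open>V\<close> is adapted without changing it on a null
    set.\<close>
  have "V k c \<in> borel_measurable (F k)" for k c
    unfolding V_def[abs_def] using decaying_adapted[OF A] by measurable
  moreover have "AE \<omega> in M. \<bar>V k c \<omega>\<bar> \<le> C' * q ^ k" for k c
    using close[of k c 0] by (simp add: A_def)
  ultimately have V: "decaying V" by (rule decayingI)
  have "AE \<omega> in M. V k c \<omega> = T V k c \<omega>" for k c
  proof -
    have "AE \<omega> in M. \<bar>T V k c \<omega> - T (A m) k c \<omega>\<bar> \<le> C' * q ^ m * q * q ^ k" for m
      by (rule contr[OF V A]) (use C' q close in auto)
    then have "AE \<omega> in M. \<forall>m. \<bar>T V k c \<omega> - A (Suc m) k c \<omega>\<bar> \<le> C' * q ^ m * q * q ^ k"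
      by (simp add: AE_all_countable A_def)
    moreover have "AE \<omega> in M. \<forall>m. \<bar>V k c \<omega> - A (Suc m) k c \<omega>\<bar> \<le> C' * q ^ Suc m * q ^ k"
      using close[of k c "Suc _"] by (simp add: AE_all_countable)
    ultimately show ?thesis
    proof eventually_elim
      case (elim \<omega>)
      \<comment> \<open>The constant \<open>2 * C'\<close> adds the distances of \<open>V\<close>
        and of \<open>T V\<close> from the common iterate \<open>A (Suc m) = T (A m)\<close>, each
        at most \<open>C' * q ^ Suc m * q ^ k\<close>.\<close>
      have "(\<lambda>m. 2 * C' * q * q ^ k * q ^ m) \<longlonglongrightarrow> 0"
        using q by (intro tendsto_mult_right_zero LIMSEQ_power_zero) auto
      moreover have "\<bar>V k c \<omega> - T V k c \<omega>\<bar> \<le> 2 * C' * q * q ^ k * q ^ m" for m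
        using elim(1)[rule_format, of m] elim(2)[rule_format, of m] by (simp add: mult_ac)
      ultimately have "\<bar>V k c \<omega> - T V k c \<omega>\<bar> \<le> 0"
        by (intro LIMSEQ_le_const) auto
      then show ?case by simp
    qed
  qed
  with V show ?thesis by blast
qed

section \<open>Stopping times over the extended index set\<close>

lemma filtration_filt_ext: "filtration (space M) (filt_ext F)"
proof
  show "space (filt_ext F i) = space M" for i
    using space_F by (cases i) (auto simp: filt_ext_def space_measure_of_conv)
  have *: "(\<Union>n. sets (F n)) \<subseteq> Pow (space (F 0))"
    using sets.sets_into_space[of _ "F _"] by (auto simp: space_F)
  show "sets (filt_ext F i) \<subseteq> sets (filt_ext F j)" if "i \<le> j" for i j
  proof (cases j)
    case (enat n)
    with that obtain m where "i = enat m" "m \<le> n" by (cases i) auto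
    with enat sets_F_mono[of m n] show ?thesis by (simp add: filt_ext_def)
  next
    case infinity
    then have "sets (filt_ext F j) = sigma_sets (space (F 0)) (\<Union>n. sets (F n))"
      using * by (simp add: filt_ext_def)
    with infinity show ?thesis
      by (cases i) (auto simp: filt_ext_def)
  qed
qed

lemma filt_ext_enat [simp]: "filt_ext F (enat n) = F n"
  by (simp add: filt_ext_def)

lemma sets_filt_ext_M: "A \<in> sets (filt_ext F t) \<Longrightarrow> A \<in> sets M"
proof (cases t)
  case infinity
  have *: "(\<Union>n. sets (F n)) \<subseteq> Pow (space (F 0))"
    using sets.sets_into_space[of _ "F _"] by (auto simp: space_F)
  have "sigma_sets (space M) (\<Union>n. sets (F n)) \<subseteq> sets M"
    using sets_F_M by (intro sets.sigma_sets_subset) auto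
  moreover assume "A \<in> sets (filt_ext F t)"
  ultimately show ?thesis using * infinity by (auto simp: filt_ext_def space_F)
qed (auto simp: sets_F_M)

text \<open>Brings the finite events of a stopping time over \<open>enat\<close> back into the
  original \<open>F n\<close>; the strict event is rewritten as \<open>\<le>\<close> at the
  preceding integer.\<close>

lemma stopping_time_events:
  assumes "stopping_time (filt_ext F) \<tau>" and "l \<le> n"
  shows "Measurable.pred (F n) (\<lambda>\<omega>. \<tau> \<omega> \<le> enat l)"
    and "Measurable.pred (F n) (\<lambda>\<omega>. \<tau> \<omega> = enat l)"
    and "Measurable.pred (F n) (\<lambda>\<omega>. enat l \<le> \<tau> \<omega>)"
proof -
  interpret ext: filtration "space M" "filt_ext F" by (rule filtration_filt_ext)
  have le: "Measurable.pred (F n) (\<lambda>\<omega>. \<tau> \<omega> \<le> enat j)" if "j \<le> n" for j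
    using ext.stopping_time_le_const[OF assms(1), of "enat j" "enat n"] that by simp
  then show "Measurable.pred (F n) (\<lambda>\<omega>. \<tau> \<omega> \<le> enat l)" using assms(2) .
  have less: "Measurable.pred (F n) (\<lambda>\<omega>. \<tau> \<omega> < enat l)"
  proof (cases l)
    case (Suc j)
    then have "(\<lambda>\<omega>. \<tau> \<omega> < enat l) = (\<lambda>\<omega>. \<tau> \<omega> \<le> enat j)"
      by (auto simp: eSuc_enat[symmetric] iless_Suc_eq intro!: ext)
         (metis Suc_ile_eq eSuc_enat enat_ord_code(4) iless_Suc_eq linorder_not_le order.strict_iff_not)+
    then show ?thesis using le[of j] Suc assms(2) by simp
  qed (simp add: enat_0)
  then have "Measurable.pred (F n) (\<lambda>\<omega>. \<not> \<tau> \<omega> < enat l)" by measurable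
  then show ge: "Measurable.pred (F n) (\<lambda>\<omega>. enat l \<le> \<tau> \<omega>)" by (simp add: not_less)
  have "Measurable.pred (F n) (\<lambda>\<omega>. enat l \<le> \<tau> \<omega> \<and> \<tau> \<omega> \<le> enat l)"
    using ge le[OF assms(2)] by measurable
  then show "Measurable.pred (F n) (\<lambda>\<omega>. \<tau> \<omega> = enat l)"
    by (simp add: order_eq_iff conj_commute)
qed

text \<open>The gain stopped at \<open>\<tau>\<close>, continued by \<open>S\<close> before \<open>\<tau>\<close>, is a supermartingale, and a martingale if
  \<open>\<tau>\<close> stops where stopping is optimal.\<close>

lemma snell_stopped:
  fixes G Ob S :: "nat \<Rightarrow> 'i \<Rightarrow> 'a \<Rightarrow> real" and c :: 'i and k :: nat
  assumes dec: "decaying G" "decaying Ob" "decaying S"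
    and rec: "\<And>k c. AE \<omega> in M. S k c \<omega> = G k c \<omega> + max (Ob k c \<omega>) (E k (S (Suc k) c) \<omega>)"
    and \<tau>: "stopping_time (filt_ext F) \<tau>" "\<And>\<omega>. \<omega> \<in> space M \<Longrightarrow> enat k \<le> \<tau> \<omega>"
  defines "J \<equiv> \<lambda>\<omega>. (\<Sum>l. G l c \<omega> * of_bool (k \<le> l \<and> enat l \<le> \<tau> \<omega>)) +
    (case \<tau> \<omega> of enat j \<Rightarrow> Ob j c \<omega> | \<infinity> \<Rightarrow> 0)"
  shows "integrable M J"
    and "AE \<omega> in M. E k J \<omega> \<le> S k c \<omega>"
    and "\<lbrakk>\<And>N \<omega>. \<omega> \<in> space M \<Longrightarrow> \<tau> \<omega> = enat N \<Longrightarrow> E N (S (Suc N) c) \<omega> \<le> Ob N c \<omega>;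
      \<And>N \<omega>. \<omega> \<in> space M \<Longrightarrow> k \<le> N \<Longrightarrow> enat N < \<tau> \<omega> \<Longrightarrow> Ob N c \<omega> \<le> E N (S (Suc N) c) \<omega>\<rbrakk>
      \<Longrightarrow> AE \<omega> in M. E k J \<omega> = S k c \<omega>"
proof -
  \<comment> \<open>\<open>a l\<close> is what is received at time \<open>l\<close>: the running
    gain up to and including \<tau>, and the obstacle if \<tau> equals \<open>l\<close>.
    \<open>W N\<close> adds the value of going on when stopping has not occurred before
    \<open>N\<close>. Thus \<open>W k\<close> is \<open>S k c\<close>, and \<open>W N\<close> tends
    to \<open>J\<close>.\<close>
  define a where "a l \<omega> = G l c \<omega> * of_bool (k \<le> l \<and> enat l \<le> \<tau> \<omega>) + Ob l c \<omega> * of_bool (\<tau> \<omega> = enat l)" for l \<omega>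
  define W where "W N \<omega> = (\<Sum>l<N. a l \<omega>) + of_bool (enat N \<le> \<tau> \<omega>) * S N c \<omega>" for N \<omega>
  obtain CG where CG: "\<And>k c. AE \<omega> in M. \<bar>G k c \<omega>\<bar> \<le> CG * q ^ k" "0 \<le> CG"
    by (rule decaying_bound[OF dec(1)]) auto
  obtain CO where CO: "\<And>k c. AE \<omega> in M. \<bar>Ob k c \<omega>\<bar> \<le> CO * q ^ k" "0 \<le> CO"
    by (rule decaying_bound[OF dec(2)]) auto
  obtain CS where CS: "\<And>k c. AE \<omega> in M. \<bar>S k c \<omega>\<bar> \<le> CS * q ^ k" "0 \<le> CS"
    by (rule decaying_bound[OF dec(3)]) auto
  have a_F: "a l \<in> borel_measurable (F n)" if "l \<le> n" for l n
  proof -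
    note [measurable] = stopping_time_events[OF \<tau>(1) that]
      measurable_F_mono[OF decaying_adapted[OF dec(1)] that]
      measurable_F_mono[OF decaying_adapted[OF dec(2)] that]
    show ?thesis unfolding a_def[abs_def] by measurable
  qed
  note a_M [measurable] = measurable_F_M[OF a_F[OF order_refl]]
  have Jeq: "J \<omega> = (\<Sum>l. G l c \<omega> * of_bool (k \<le> l \<and> enat l \<le> \<tau> \<omega>)) + (\<Sum>l. Ob l c \<omega> * of_bool (\<tau> \<omega> = enat l))" for \<omega>
  proof (cases "\<tau> \<omega>")
    case (enat j)
    have "(\<Sum>l. Ob l c \<omega> * of_bool (\<tau> \<omega> = enat l)) = (\<Sum>l\<in>{j}. Ob l c \<omega> * of_bool (\<tau> \<omega> = enat l))"
      by (rule suminf_finite) (auto simp: enat)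
    with enat show ?thesis by (simp add: J_def)
  qed (simp add: J_def)
  have bounds: "AE \<omega> in M. \<forall>l. \<bar>G l c \<omega>\<bar> \<le> CG * q ^ l \<and> \<bar>Ob l c \<omega>\<bar> \<le> CO * q ^ l \<and> \<bar>S l c \<omega>\<bar> \<le> CS * q ^ l"
    using CG(1) CO(1) CS(1) by (auto simp: AE_all_countable)
  define B where "B = (CG + CO) / (1 - q) + CS"
  \<comment> \<open>The distance combines the tail of the series of \<open>a\<close> with the value
    term still contained in \<open>W N\<close>. The bound is deterministic, so it passes through
    \<open>E k\<close>.\<close>
  have JW: "AE \<omega> in M. \<forall>N. \<bar>J \<omega> - W N \<omega>\<bar> \<le> B * q ^ N"
    using bounds
  proof eventually_elim
    case (elim \<omega>)
    have g: "\<bar>G l c \<omega> * of_bool (k \<le> l \<and> enat l \<le> \<tau> \<omega>)\<bar> \<le> CG * q ^ l"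
      and o: "\<bar>Ob l c \<omega> * of_bool (\<tau> \<omega> = enat l)\<bar> \<le> CO * q ^ l" for l
      using elim[rule_format, of l] CG(2) CO(2) q by (auto simp del: abs_mult)
    have J: "J \<omega> = (\<Sum>l. a l \<omega>)"
      unfolding Jeq a_def
      by (rule suminf_add) (rule summable_abs_le_geometric[OF g q], rule summable_abs_le_geometric[OF o q])
    have "\<bar>a l \<omega>\<bar> \<le> (CG + CO) * q ^ l" for l
      using g[of l] o[of l] by (simp add: a_def algebra_simps)
    then have "\<bar>J \<omega> - (\<Sum>l<N. a l \<omega>)\<bar> \<le> (CG + CO) / (1 - q) * q ^ N" for N
      unfolding J by (rule geometric_tail) (rule q)+
    moreover have "\<bar>of_bool (enat N \<le> \<tau> \<omega>) * S N c \<omega>\<bar> \<le> CS * q ^ N" for N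
      using elim CS(2) q by auto
    ultimately have "\<bar>J \<omega> - W N \<omega>\<bar> \<le> (CG + CO) / (1 - q) * q ^ N + CS * q ^ N" for N
      unfolding W_def by (smt (verit))
    then show ?case by (simp add: B_def algebra_simps)
  qed
  have W_int: "integrable M (W N)" for N
  proof (rule integrable_bounded)
    note [measurable] = decaying_measurable[OF dec(3)]
       measurable_from_subalg[OF subalg stopping_time_events(3)[OF \<tau>(1) order_refl]]
    show "W N \<in> borel_measurable M" unfolding W_def[abs_def] by measurable
    show "AE \<omega> in M. \<bar>W N \<omega>\<bar> \<le> (\<Sum>l<N. (CG + CO) * q ^ l) + CS * q ^ N"
      using bounds
    proof eventually_elim
      case (elim \<omega>)
      have "\<bar>a l \<omega>\<bar> \<le> (CG + CO) * q ^ l" for l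
        unfolding a_def distrib_right
        by (rule order_trans[OF abs_triangle_ineq], rule add_mono)
           (use elim CG(2) CO(2) q in auto)
      then have "\<bar>\<Sum>l<N. a l \<omega>\<bar> \<le> (\<Sum>l<N. (CG + CO) * q ^ l)"
        by (intro order_trans[OF sum_abs] sum_mono)
      moreover have "\<bar>of_bool (enat N \<le> \<tau> \<omega>) * S N c \<omega>\<bar> \<le> CS * q ^ N"
        using elim CS(2) q by auto
      ultimately show ?case unfolding W_def by linarith
    qed
  qed
  have J_M: "J \<in> borel_measurable M"
  proof -
    note [measurable] = decaying_measurable[OF dec(1)] decaying_measurable[OF dec(2)]
      measurable_from_subalg[OF subalg stopping_time_events(3)[OF \<tau>(1) order_refl]]
      measurable_from_subalg[OF subalg stopping_time_events(2)[OF \<tau>(1) order_refl]]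
    show ?thesis unfolding Jeq[abs_def] by measurable
  qed
  show J_int: "integrable M J"
  proof (rule integrable_bounded[OF J_M])
    show "AE \<omega> in M. \<bar>J \<omega>\<bar> \<le> B + CS"
      using JW bounds
    proof eventually_elim
      case (elim \<omega>)
      have "\<bar>W 0 \<omega>\<bar> \<le> CS" using elim(2)[rule_format, of 0] CS(2) by (simp add: W_def)
      with elim(1)[rule_format, of 0] show ?case by simp
    qed
  qed
  have EW: "AE \<omega> in M. E N (W (Suc N)) \<omega> = (\<Sum>l<Suc N. a l \<omega>) +
      of_bool (enat (Suc N) \<le> \<tau> \<omega>) * E N (S (Suc N) c) \<omega>" for N
  proof -
    interpret N: sigma_finite_subalgebra M "F N" by (rule sigma_finite_subalg)
    \<comment> \<open>Going on beyond \<open>N\<close> is the complement of having stopped by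
      \<open>N\<close>, hence known at time \<open>N\<close>; so the indicator in front of
      \<open>S (Suc N) c\<close> leaves the conditional expectation.\<close>
    have eq: "enat (Suc N) \<le> \<tau> \<omega> \<longleftrightarrow> \<not> \<tau> \<omega> \<le> enat N" for \<omega>
      by (simp add: Suc_ile_eq not_le)
    note [measurable] = stopping_time_events(1)[OF \<tau>(1) order_refl, of N] decaying_measurable[OF dec(3)]
    have ind[measurable]: "(\<lambda>\<omega>. of_bool (enat (Suc N) \<le> \<tau> \<omega>) :: real) \<in> borel_measurable (F N)"
      unfolding eq by measurable
    have sum: "(\<lambda>\<omega>. \<Sum>l<Suc N. a l \<omega>) \<in> borel_measurable (F N)"
      by (intro borel_measurable_sum a_F) auto
    have i1: "integrable M (\<lambda>\<omega>. of_bool (enat (Suc N) \<le> \<tau> \<omega>) * S (Suc N) c \<omega>)"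
      by (rule Bochner_Integration.integrable_bound[OF decaying_integrable[OF dec(3), of "Suc N" c]])
        (use measurable_F_M[OF ind] in \<open>auto\<close>)
    have i2: "integrable M (\<lambda>\<omega>. \<Sum>l<Suc N. a l \<omega>)"
      using Bochner_Integration.integrable_diff[OF W_int[of "Suc N"] i1] by (simp add: W_def)
    show ?thesis
      using N.real_cond_exp_add[OF i2 i1] N.real_cond_exp_F_meas[OF i2 sum]
        N.real_cond_exp_mult[OF ind decaying_measurable[OF dec(3)] i1]
      unfolding W_def[abs_def] by eventually_elim simp
  qed
  have step: "AE \<omega> in M. E k (W (Suc N)) \<omega> = E k (E N (W (Suc N))) \<omega>" if "k \<le> N" for N
  proof -
    interpret k: sigma_finite_subalgebra M "F k" by (rule sigma_finite_subalg)
    show ?thesis using k.real_cond_exp_nested_subalg[OF subalg subalg_F[OF that] W_int[of "Suc N"]] by eventually_elim simp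
  qed
  have Wk: "AE \<omega> in M. E k (W k) \<omega> = S k c \<omega>"
  proof -
    interpret k: sigma_finite_subalgebra M "F k" by (rule sigma_finite_subalg)
    have "W k \<omega> = S k c \<omega>" if "\<omega> \<in> space M" for \<omega>
    proof -
      have "a l \<omega> = 0" if "l < k" for l
        using \<tau>(2)[OF \<open>\<omega> \<in> space M\<close>] that by (auto simp: a_def)
      with \<tau>(2)[OF that] show ?thesis by (simp add: W_def)
    qed
    then have "AE \<omega> in M. E k (W k) \<omega> = E k (S k c) \<omega>"
      by (intro k.real_cond_exp_cong) (use W_int decaying_measurable[OF dec(3)] in auto)
    with k.real_cond_exp_F_meas[OF decaying_integrable[OF dec(3)] decaying_adapted[OF dec(3)], of c]
    show ?thesis by eventually_elim simp
  qed
  have lim: "(\<lambda>N. s + B * q ^ (N + k)) \<longlonglongrightarrow> s" for s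
    using q by (auto intro!: tendsto_eq_intros LIMSEQ_ignore_initial_segment[of "\<lambda>n. q ^ n"] LIMSEQ_power_zero)
  have close: "AE \<omega> in M. \<forall>N. \<bar>E k J \<omega> - E k (W (N + k)) \<omega>\<bar> \<le> B * q ^ (N + k)"
    unfolding AE_all_countable
  proof
    fix N
    have "AE \<omega> in M. \<bar>J \<omega> - W (N + k) \<omega>\<bar> \<le> B * q ^ (N + k)" using JW by eventually_elim blast
    then show "AE \<omega> in M. \<bar>E k J \<omega> - E k (W (N + k)) \<omega>\<bar> \<le> B * q ^ (N + k)"
      by (rule cond_exp_close[OF J_int W_int])
  qed
  have cases: "\<tau> \<omega> < enat N \<or> \<tau> \<omega> = enat N \<or> enat (Suc N) \<le> \<tau> \<omega>" for \<omega> N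
    by (auto simp: Suc_ile_eq)
  have "AE \<omega> in M. \<forall>N. E k (W (N + k)) \<omega> \<le> S k c \<omega>"
    unfolding AE_all_countable
  proof
    fix N
    show "AE \<omega> in M. E k (W (N + k)) \<omega> \<le> S k c \<omega>"
    proof (induction N)
      case 0
      then show ?case using Wk by auto
    next
      case (Suc N)
      interpret k: sigma_finite_subalgebra M "F k" by (rule sigma_finite_subalg)
      interpret N: sigma_finite_subalgebra M "F (N + k)" by (rule sigma_finite_subalg)
      \<comment> \<open>After \<tau> nothing changes; at \<tau> the obstacle, and before \<tau> the
        continuation value, is bounded by the maximum in \<open>rec\<close>.\<close>
      have "AE \<omega> in M. E (N + k) (W (Suc (N + k))) \<omega> \<le> W (N + k) \<omega>"
        using EW[of "N + k"] rec[of "N + k" c]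
      proof eventually_elim
        case (elim \<omega>)
        then show ?case
          using cases[of \<omega> "N + k"] by (auto simp: W_def a_def Suc_ile_eq)
      qed
      then have "AE \<omega> in M. E k (E (N + k) (W (Suc (N + k)))) \<omega> \<le> E k (W (N + k)) \<omega>"
        by (rule k.real_cond_exp_mono) (rule N.real_cond_exp_int(1) W_int)+
      with Suc.IH step[of "N + k"] show ?case by auto
    qed
  qed
  with close show "AE \<omega> in M. E k J \<omega> \<le> S k c \<omega>"
  proof eventually_elim
    case (elim \<omega>)
    have "E k J \<omega> \<le> S k c \<omega> + B * q ^ (N + k)" for N
      using elim(1)[rule_format, of N] elim(2)[rule_format, of N] by linarith
    then show ?case by (intro LIMSEQ_le_const[OF lim]) blast
  qed
  assume opt: "\<And>N \<omega>. \<omega> \<in> space M \<Longrightarrow> \<tau> \<omega> = enat N \<Longrightarrow> E N (S (Suc N) c) \<omega> \<le> Ob N c \<omega>"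
      "\<And>N \<omega>. \<omega> \<in> space M \<Longrightarrow> k \<le> N \<Longrightarrow> enat N < \<tau> \<omega> \<Longrightarrow> Ob N c \<omega> \<le> E N (S (Suc N) c) \<omega>"
  have "AE \<omega> in M. \<forall>N. E k (W (N + k)) \<omega> = S k c \<omega>"
    unfolding AE_all_countable
  proof
    fix N
    show "AE \<omega> in M. E k (W (N + k)) \<omega> = S k c \<omega>"
    proof (induction N)
      case 0
      then show ?case using Wk by auto
    next
      case (Suc N)
      interpret k: sigma_finite_subalgebra M "F k" by (rule sigma_finite_subalg)
      interpret N: sigma_finite_subalgebra M "F (N + k)" by (rule sigma_finite_subalg)
      have "AE \<omega> in M. E (N + k) (W (Suc (N + k))) \<omega> = W (N + k) \<omega>"
        using EW[of "N + k"] rec[of "N + k" c] AE_space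
      proof eventually_elim
        case (elim \<omega>)
        consider "\<tau> \<omega> < enat (N + k)" | "\<tau> \<omega> = enat (N + k)" | "enat (Suc (N + k)) \<le> \<tau> \<omega>"
          using cases by blast
        then show ?case
        proof cases
          case 1
          then have "a (N + k) \<omega> = 0" "\<not> enat (N + k) \<le> \<tau> \<omega>" "\<not> enat (Suc (N + k)) \<le> \<tau> \<omega>"
            by (auto simp: a_def Suc_ile_eq)
          with elim(1) show ?thesis by (simp add: W_def)
        next
          case 2
          with elim(1,2) opt(1)[OF elim(3) 2] show ?thesis by (simp add: W_def a_def max_def)
        next
          case 3
          then have less: "enat (N + k) < \<tau> \<omega>" by (simp add: Suc_ile_eq)
          then have "\<tau> \<omega> \<noteq> enat (N + k)" by simp
          with elim(1,2) opt(2)[OF elim(3) _ less] less 3 show ?thesis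
            by (simp add: W_def a_def max_def order_less_imp_le)
        qed
      qed
      then have "AE \<omega> in M. E k (E (N + k) (W (Suc (N + k)))) \<omega> = E k (W (N + k)) \<omega>"
        by (rule k.real_cond_exp_cong) (rule borel_measurable_cond_exp2 borel_measurable_integrable[OF W_int])+
      with Suc.IH step[of "N + k"] show ?case by auto
    qed
  qed
  with close show "AE \<omega> in M. E k J \<omega> = S k c \<omega>"
  proof eventually_elim
    case (elim \<omega>)
    have le: "\<bar>E k J \<omega> - S k c \<omega>\<bar> \<le> 0 + B * q ^ (N + k)" for N
      using elim(1)[rule_format, of N] elim(2)[rule_format, of N] by simp
    then have "\<bar>E k J \<omega> - S k c \<omega>\<bar> \<le> 0" by (intro LIMSEQ_le_const[OF lim]) blast
    then show ?case by simp
  qed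
qed

section \<open>Bellman equations in the weighted norm\<close>

lemma decaying_cond_exp:
  assumes "decaying Z"
  shows "decaying (\<lambda>k c. E k (Z (Suc k) c))"
proof (rule decaying_bound[OF assms])
  fix C assume C: "0 \<le> C" "\<And>k c. AE \<omega> in M. \<bar>Z k c \<omega>\<bar> \<le> C * q ^ k"
  show ?thesis
  proof (rule decayingI)
    show "E k (Z (Suc k) c) \<in> borel_measurable (F k)" for k c by simp
    have "C * q ^ Suc k \<le> C * q ^ k" for k
      using C q by (intro mult_left_mono power_decreasing) auto
    then have "AE \<omega> in M. \<bar>Z (Suc k) c \<omega>\<bar> \<le> C * q ^ k" for k c
      using C(2)[of "Suc k" c] by (auto elim!: eventually_mono order_trans)
    then show "AE \<omega> in M. \<bar>E k (Z (Suc k) c) \<omega>\<bar> \<le> C * q ^ k" for k c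
      by (rule cond_exp_bound[OF decaying_measurable[OF assms]])
  qed
qed

lemma decaying_add:
  assumes "decaying Z" "decaying Z'"
  shows "decaying (\<lambda>k c \<omega>. Z k c \<omega> + Z' k c \<omega>)"
proof (rule decaying_bound[OF assms(1)], rule decaying_bound[OF assms(2)])
  fix C C'
  assume C: "\<And>k c. AE \<omega> in M. \<bar>Z k c \<omega>\<bar> \<le> C * q ^ k" and C': "\<And>k c. AE \<omega> in M. \<bar>Z' k c \<omega>\<bar> \<le> C' * q ^ k"
  show ?thesis
  proof (rule decayingI[where C="C + C'"])
    note [measurable] = decaying_adapted[OF assms(1)] decaying_adapted[OF assms(2)]
    show "(\<lambda>\<omega>. Z k c \<omega> + Z' k c \<omega>) \<in> borel_measurable (F k)" for k c by measurable
    show "AE \<omega> in M. \<bar>Z k c \<omega> + Z' k c \<omega>\<bar> \<le> (C + C') * q ^ k" for k c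
      using C[of k c] C'[of k c] by eventually_elim (simp add: algebra_simps)
  qed
qed

lemma decaying_max:
  assumes "decaying Z" "decaying Z'"
  shows "decaying (\<lambda>k c \<omega>. max (Z k c \<omega>) (Z' k c \<omega>))"
proof (rule decaying_bound[OF assms(1)], rule decaying_bound[OF assms(2)])
  fix C C'
  assume C: "\<And>k c. AE \<omega> in M. \<bar>Z k c \<omega>\<bar> \<le> C * q ^ k" and C': "\<And>k c. AE \<omega> in M. \<bar>Z' k c \<omega>\<bar> \<le> C' * q ^ k"
    and pos: "0 \<le> C" "0 \<le> C'"
  show ?thesis
  proof (rule decayingI[where C="C + C'"])
    note [measurable] = decaying_adapted[OF assms(1)] decaying_adapted[OF assms(2)]
    show "(\<lambda>\<omega>. max (Z k c \<omega>) (Z' k c \<omega>)) \<in> borel_measurable (F k)" for k c by measurable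
    have nonneg: "0 \<le> C * q ^ k" "0 \<le> C' * q ^ k" for k using pos q by auto
    show "AE \<omega> in M. \<bar>max (Z k c \<omega>) (Z' k c \<omega>)\<bar> \<le> (C + C') * q ^ k" for k c
      using C[of k c] C'[of k c]
    proof eventually_elim
      case (elim \<omega>)
      with nonneg[of k] show ?case unfolding distrib_right by linarith
    qed
  qed
qed

text \<open>\<open>H\<close> covers two cases: a constant operator, whose fixed point is a Snell
  envelope, and the obstacle operator, whose fixed point is the value. In the continuation term the
  factor \<open>q\<close> comes from the shift to \<open>Suc k\<close>; \<open>G\<close>
  cancels.\<close>

lemma bellman_fixed_point:
  fixes H :: "(nat \<Rightarrow> 'i \<Rightarrow> 'a \<Rightarrow> real) \<Rightarrow> nat \<Rightarrow> 'i \<Rightarrow> 'a \<Rightarrow> real"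
  assumes G: "decaying G" and H: "\<And>Z. decaying Z \<Longrightarrow> decaying (H Z)"
    and contr: "\<And>Z Z' D k c. decaying Z \<Longrightarrow> decaying Z' \<Longrightarrow> 0 \<le> D \<Longrightarrow>
      (\<And>k c. AE \<omega> in M. \<bar>Z k c \<omega> - Z' k c \<omega>\<bar> \<le> D * q ^ k) \<Longrightarrow>
      AE \<omega> in M. \<bar>H Z k c \<omega> - H Z' k c \<omega>\<bar> \<le> D * q * q ^ k"
  shows "\<exists>V. decaying V \<and>
    (\<forall>k c. AE \<omega> in M. V k c \<omega> = G k c \<omega> + max (H V k c \<omega>) (E k (V (Suc k) c) \<omega>))"
proof (rule contraction_fixed_point)
  show "decaying (\<lambda>k c \<omega>. G k c \<omega> + max (H Z k c \<omega>) (E k (Z (Suc k) c) \<omega>))" if "decaying Z" for Z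
    using that by (intro decaying_add decaying_max decaying_cond_exp G H)
  fix Z Z' :: "nat \<Rightarrow> 'i \<Rightarrow> 'a \<Rightarrow> real" and D k c
  assume Z: "decaying Z" "decaying Z'" and D: "0 \<le> D"
    and close: "\<And>k c. AE \<omega> in M. \<bar>Z k c \<omega> - Z' k c \<omega>\<bar> \<le> D * q ^ k"
  have "AE \<omega> in M. \<bar>E k (Z (Suc k) c) \<omega> - E k (Z' (Suc k) c) \<omega>\<bar> \<le> D * q ^ Suc k"
    by (rule cond_exp_close[OF decaying_integrable[OF Z(1)] decaying_integrable[OF Z(2)] close])
  with contr[OF Z D close, of k c]
  show "AE \<omega> in M. \<bar>G k c \<omega> + max (H Z k c \<omega>) (E k (Z (Suc k) c) \<omega>) -
      (G k c \<omega> + max (H Z' k c \<omega>) (E k (Z' (Suc k) c) \<omega>))\<bar> \<le> D * q * q ^ k"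
  proof eventually_elim
    case (elim \<omega>)
    have "D * q ^ Suc k = D * q * q ^ k" by simp
    with elim have "max \<bar>H Z k c \<omega> - H Z' k c \<omega>\<bar> \<bar>E k (Z (Suc k) c) \<omega> - E k (Z' (Suc k) c) \<omega>\<bar> \<le> D * q * q ^ k"
      by (simp only: max.bounded_iff)
    then show ?case
      by (simp only: add_diff_cancel_left)
  qed
qed

text \<open>The difference of the solutions is at most the larger of the obstacle difference and the
  conditional expectation of the next difference, and passing to \<open>Suc k\<close> gains a factor
  \<open>q\<close>. Iterating from the a priori bound gives \<open>max e ((C + C') * q ^ m)\<close>.
  As \<open>e\<close> is positive, finitely many rounds push the second entry below
  \<open>e\<close>.\<close>

lemma bellman_compare:
  fixes G Ob Ob' S S' :: "nat \<Rightarrow> 'i \<Rightarrow> 'a \<Rightarrow> real"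
  assumes S: "decaying S" "\<And>k c. AE \<omega> in M. S k c \<omega> = G k c \<omega> + max (Ob k c \<omega>) (E k (S (Suc k) c) \<omega>)"
    and S': "decaying S'" "\<And>k c. AE \<omega> in M. S' k c \<omega> = G k c \<omega> + max (Ob' k c \<omega>) (E k (S' (Suc k) c) \<omega>)"
    and Ob: "\<And>k c. AE \<omega> in M. \<bar>Ob k c \<omega> - Ob' k c \<omega>\<bar> \<le> e * q ^ k" and "0 < e"
  shows "AE \<omega> in M. \<bar>S k c \<omega> - S' k c \<omega>\<bar> \<le> e * q ^ k"
proof -
  obtain C where C: "\<And>k c. AE \<omega> in M. \<bar>S k c \<omega>\<bar> \<le> C * q ^ k"
    by (rule decaying_bound[OF S(1)]) auto
  obtain C' where C': "\<And>k c. AE \<omega> in M. \<bar>S' k c \<omega>\<bar> \<le> C' * q ^ k"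
    by (rule decaying_bound[OF S'(1)]) auto
  have *: "AE \<omega> in M. \<bar>S k c \<omega> - S' k c \<omega>\<bar> \<le> max e ((C + C') * q ^ m) * q ^ k" for m k c
  proof (induction m arbitrary: k c)
    case 0
    show ?case using C[of k c] C'[of k c]
    proof eventually_elim
      case (elim \<omega>)
      then have "\<bar>S k c \<omega> - S' k c \<omega>\<bar> \<le> (C + C') * q ^ 0 * q ^ k" by (simp add: algebra_simps)
      also have "\<dots> \<le> max e ((C + C') * q ^ 0) * q ^ k" using q by (intro mult_right_mono) auto
      finally show ?case .
    qed
  next
    case (Suc m)
    let ?b = "max e ((C + C') * q ^ m) * q ^ Suc k"
    have "AE \<omega> in M. \<bar>E k (S (Suc k) c) \<omega> - E k (S' (Suc k) c) \<omega>\<bar> \<le> ?b"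
      by (rule cond_exp_close[OF decaying_integrable[OF S(1)] decaying_integrable[OF S'(1)] Suc.IH])
    with Ob[of k c] S(2)[of k c] S'(2)[of k c] show ?case
    proof eventually_elim
      case (elim \<omega>)
      have "e * q \<le> e" using q \<open>0 < e\<close> by (simp add: mult_le_cancel_left1)
      moreover have "max e ((C + C') * q ^ m) * q = max (e * q) ((C + C') * q ^ m * q)"
        using q by (simp add: max_mult_distrib_right)
      moreover have "(C + C') * q ^ m * q = (C + C') * q ^ Suc m" by simp
      ultimately have "max e ((C + C') * q ^ m) * q \<le> max e ((C + C') * q ^ Suc m)" by simp
      then have "?b \<le> max e ((C + C') * q ^ Suc m) * q ^ k"
        using q mult_right_mono[of "max e ((C + C') * q ^ m) * q" "max e ((C + C') * q ^ Suc m)" "q ^ k"]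
        by (simp add: mult_ac)
      moreover have "e * q ^ k \<le> max e ((C + C') * q ^ Suc m) * q ^ k"
        using q by (intro mult_right_mono) auto
      moreover have "\<bar>S k c \<omega> - S' k c \<omega>\<bar> \<le>
          max \<bar>Ob k c \<omega> - Ob' k c \<omega>\<bar> \<bar>E k (S (Suc k) c) \<omega> - E k (S' (Suc k) c) \<omega>\<bar>"
        using elim(2,3) abs_max_diff_le[of "Ob k c \<omega>" "E k (S (Suc k) c) \<omega>"] by simp
      ultimately show ?case using elim(1,4) by linarith
    qed
  qed
  have "(\<lambda>m. (C + C') * q ^ m) \<longlonglongrightarrow> 0"
    using q by (intro tendsto_mult_right_zero LIMSEQ_power_zero) auto
  from order_tendstoD(2)[OF this \<open>0 < e\<close>] obtain m where "(C + C') * q ^ m < e"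
    by (auto simp: eventually_sequentially)
  with *[of k c m] show ?thesis by (simp add: max_def)
qed

text \<open>The essential supremum is attained: the first time at or after \<open>k\<close> when the
  obstacle is at least the continuation value is optimal. Any other upper bound then has to be
  compared with this one member only.\<close>

lemma snell_ess_sup:
  fixes G Ob :: "nat \<Rightarrow> 'i \<Rightarrow> 'a \<Rightarrow> real"
  assumes dec: "decaying G" "decaying Ob"
  obtains S where "decaying S"
    and "\<And>k c. AE \<omega> in M. S k c \<omega> = G k c \<omega> + max (Ob k c \<omega>) (E k (S (Suc k) c) \<omega>)"
    and "\<And>k c. is_ess_sup M
      {E k (\<lambda>\<omega>. (\<Sum>l. G l c \<omega> * of_bool (k \<le> l \<and> enat l \<le> \<tau> \<omega>)) +
         (case \<tau> \<omega> of enat j \<Rightarrow> Ob j c \<omega> | \<infinity> \<Rightarrow> 0)) | \<tau>.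
        stopping_time (filt_ext F) \<tau> \<and> (\<forall>\<omega>\<in>space M. enat k \<le> \<tau> \<omega>)} (S k c)"
proof -
  have "\<exists>S. decaying S \<and>
    (\<forall>k c. AE \<omega> in M. S k c \<omega> = G k c \<omega> + max (Ob k c \<omega>) (E k (S (Suc k) c) \<omega>))"
  proof (rule bellman_fixed_point[OF dec(1)])
    show "AE \<omega> in M. \<bar>Ob k c \<omega> - Ob k c \<omega>\<bar> \<le> D * q * q ^ k" if "0 \<le> D" for D k c
      using that q by simp
  qed (rule dec(2))
  then obtain S where S: "decaying S"
    "\<And>k c. AE \<omega> in M. S k c \<omega> = G k c \<omega> + max (Ob k c \<omega>) (E k (S (Suc k) c) \<omega>)"
    by blast
  let ?J = "\<lambda>k c \<tau> \<omega>. (\<Sum>l. G l c \<omega> * of_bool (k \<le> l \<and> enat l \<le> \<tau> \<omega>)) +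
         (case \<tau> \<omega> of enat j \<Rightarrow> Ob j c \<omega> | \<infinity> \<Rightarrow> 0)"
  have "is_ess_sup M {E k (?J k c \<tau>) | \<tau>.
        stopping_time (filt_ext F) \<tau> \<and> (\<forall>\<omega>\<in>space M. enat k \<le> \<tau> \<omega>)} (S k c)" (is "is_ess_sup M ?\<Phi> _") for k c
  proof -
    \<comment> \<open>The hitting condition is phrased over \<open>enat\<close> so that
      \<open>Inf\<close> of the hit times is a stopping time for the extended filtration. If nothing
      is hit, \<open>Inf\<close> of the empty set is \<infinity> and stopping never occurs.\<close>
    define P where "P i \<omega> \<longleftrightarrow> (\<exists>j\<ge>k. i = enat j \<and> E j (S (Suc j) c) \<omega> \<le> Ob j c \<omega>)" for i \<omega>
    define \<tau> where "\<tau> \<omega> = Inf {i. P i \<omega>}" for \<omega>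
    have le: "enat k \<le> \<tau> \<omega>" for \<omega>
      unfolding \<tau>_def by (rule Inf_greatest) (auto simp: P_def)
    have "Measurable.pred (filt_ext F i) (P i)" for i
    proof (cases i)
      case (enat j)
      note [measurable] = decaying_adapted[OF dec(2)]
      have "Measurable.pred (F j) (\<lambda>\<omega>. k \<le> j \<and> E j (S (Suc j) c) \<omega> \<le> Ob j c \<omega>)" by measurable
      moreover have "P i = (\<lambda>\<omega>. k \<le> j \<and> E j (S (Suc j) c) \<omega> \<le> Ob j c \<omega>)"
        using enat by (auto simp: P_def fun_eq_iff)
      ultimately show ?thesis using enat by simp
    next
      case infinity
      then have "P i = (\<lambda>\<omega>. False)" by (auto simp: P_def fun_eq_iff)
      then show ?thesis by simp
    qed
    then have stop: "stopping_time (filt_ext F) \<tau>"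
      unfolding \<tau>_def by (rule stopping_time_Inf_enat[OF filtration_filt_ext])
    have opt: "AE \<omega> in M. E k (?J k c \<tau>) \<omega> = S k c \<omega>"
    proof (rule snell_stopped(3)[OF dec S stop le])
      show "E N (S (Suc N) c) \<omega> \<le> Ob N c \<omega>" if "\<tau> \<omega> = enat N" for N \<omega>
      proof -
        have "{i. P i \<omega>} \<noteq> {}"
        proof
          assume "{i. P i \<omega>} = {}"
          with that show False by (simp add: \<tau>_def top_enat_def)
        qed
        then have "P (\<tau> \<omega>) \<omega>" unfolding \<tau>_def using wellorder_InfI[of _ "{i. P i \<omega>}"] by blast
        with that show ?thesis by (auto simp: P_def)
      qed
      show "Ob N c \<omega> \<le> E N (S (Suc N) c) \<omega>" if "k \<le> N" "enat N < \<tau> \<omega>" for N \<omega>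
      proof -
        have "\<not> P (enat N) \<omega>" using that(2) Inf_lower[of "enat N" "{i. P i \<omega>}"] by (auto simp: \<tau>_def)
        with that show ?thesis by (auto simp: P_def)
      qed
    qed
    show ?thesis
      unfolding is_ess_sup_def
    proof (intro conjI ballI impI)
      show "S k c \<in> borel_measurable M" by (rule decaying_measurable[OF S(1)])
      show "AE \<omega> in M. f \<omega> \<le> S k c \<omega>" if "f \<in> ?\<Phi>" for f
        using that snell_stopped(2)[OF dec S, where c=c] by blast
      fix Z assume "\<forall>f\<in>?\<Phi>. AE \<omega> in M. f \<omega> \<le> Z \<omega>"
      moreover have "E k (?J k c \<tau>) \<in> ?\<Phi>" using stop le by blast
      ultimately have "AE \<omega> in M. E k (?J k c \<tau>) \<omega> \<le> Z \<omega>" by blast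
      with opt show "AE \<omega> in M. S k c \<omega> \<le> Z \<omega>" by eventually_elim simp
    qed
  qed
  with S that show thesis by blast
qed

lemma integral_select:
  fixes f :: "'i \<Rightarrow> 'a \<Rightarrow> real"
  assumes I: "finite I" "\<And>\<omega>. \<omega> \<in> space M \<Longrightarrow> N \<omega> \<in> I"
    and N: "\<And>i. i \<in> I \<Longrightarrow> {\<omega>\<in>space M. N \<omega> = i} \<in> sets (F k)"
    and f: "\<And>i. i \<in> I \<Longrightarrow> integrable M (f i)"
  shows "integrable M (\<lambda>\<omega>. f (N \<omega>) \<omega>)"
    and "integrable M (\<lambda>\<omega>. E k (f (N \<omega>)) \<omega>)"
    and "(\<integral>\<omega>. E k (f (N \<omega>)) \<omega> \<partial>M) = (\<integral>\<omega>. f (N \<omega>) \<omega> \<partial>M)"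
proof -
  interpret k: sigma_finite_subalgebra M "F k" by (rule sigma_finite_subalg)
  let ?A = "\<lambda>i. {\<omega>\<in>space M. N \<omega> = i}"
  have split: "h (N \<omega>) \<omega> = (\<Sum>i\<in>I. indicator (?A i) \<omega> * h i \<omega>)" if "\<omega> \<in> space M" for h :: "'i \<Rightarrow> 'a \<Rightarrow> real" and \<omega>
  proof -
    have "(\<Sum>i\<in>I. indicator (?A i) \<omega> * h i \<omega>) = (\<Sum>i\<in>I. if i = N \<omega> then h i \<omega> else 0)"
      using that by (intro sum.cong) (auto simp: indicator_def)
    with I that show ?thesis by simp
  qed
  have int: "integrable M (\<lambda>\<omega>. indicator (?A i) \<omega> * f i \<omega>)" if "i \<in> I" for i
    using integrable_real_mult_indicator[OF sets_F_M[OF N[OF that]] f[OF that]] by (simp add: mult.commute)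
  have ind: "indicator (?A i) \<in> borel_measurable (F k)" if "i \<in> I" for i
    using N[OF that] by simp
  note E = k.real_cond_exp_intg[OF int ind borel_measurable_integrable[OF f]]
  have "integrable M (\<lambda>\<omega>. f (N \<omega>) \<omega>) \<longleftrightarrow> integrable M (\<lambda>\<omega>. \<Sum>i\<in>I. indicator (?A i) \<omega> * f i \<omega>)"
    by (intro Bochner_Integration.integrable_cong refl split)
  then show "integrable M (\<lambda>\<omega>. f (N \<omega>) \<omega>)" using int by simp
  have "integrable M (\<lambda>\<omega>. E k (f (N \<omega>)) \<omega>) \<longleftrightarrow> integrable M (\<lambda>\<omega>. \<Sum>i\<in>I. indicator (?A i) \<omega> * E k (f i) \<omega>)"
    using split[of _ "\<lambda>i. E k (f i)"] by (intro Bochner_Integration.integrable_cong refl)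
  then show "integrable M (\<lambda>\<omega>. E k (f (N \<omega>)) \<omega>)" using E(1) by simp
  have "(\<integral>\<omega>. E k (f (N \<omega>)) \<omega> \<partial>M) = (\<integral>\<omega>. (\<Sum>i\<in>I. indicator (?A i) \<omega> * E k (f i) \<omega>) \<partial>M)"
    using split[of _ "\<lambda>i. E k (f i)"] by (intro Bochner_Integration.integral_cong refl)
  also have "\<dots> = (\<Sum>i\<in>I. \<integral>\<omega>. indicator (?A i) \<omega> * f i \<omega> \<partial>M)"
    using E by (simp add: Bochner_Integration.integral_sum)
  also have "\<dots> = (\<integral>\<omega>. (\<Sum>i\<in>I. indicator (?A i) \<omega> * f i \<omega>) \<partial>M)"
    using int by (simp add: Bochner_Integration.integral_sum)
  also have "\<dots> = (\<integral>\<omega>. f (N \<omega>) \<omega> \<partial>M)"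
    using split by (intro Bochner_Integration.integral_cong refl) simp
  finally show "(\<integral>\<omega>. E k (f (N \<omega>)) \<omega> \<partial>M) = (\<integral>\<omega>. f (N \<omega>) \<omega> \<partial>M)" .
qed

end

section \<open>The value process and the iterative scheme\<close>

locale impulse_control = discounted_filtration M F q
  for M :: "'a measure" and F :: "nat \<Rightarrow> 'a measure" and q :: real +
  fixes \<Delta> :: nat and \<theta> :: real and U :: "'b::euclidean_space set" and X :: "nat \<Rightarrow> 'a \<Rightarrow> 'b"
    and g \<Psi> :: "'b \<Rightarrow> real" and K L :: real
  assumes q_exp: "q = exp (- \<theta>)" and \<Delta>: "0 < \<Delta>" and U: "finite U" "U \<noteq> {}"
    and X: "X n \<in> borel_measurable (F n)"
    and g: "g \<in> borel_measurable borel" "\<bar>g x\<bar> \<le> K"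
    and \<Psi>: "\<beta> \<in> U \<Longrightarrow> \<bar>\<Psi> \<beta>\<bar> \<le> L"
begin

lemma exp_discount: "exp (- \<theta> * real k) = q ^ k"
  using exp_of_nat_mult[of k "- \<theta>"] by (simp add: q_exp mult.commute)

definition G :: "nat \<Rightarrow> 'b \<Rightarrow> 'a \<Rightarrow> real" where
  "G k c \<omega> = q ^ k * g (X k \<omega> + c)"

text \<open>The obstacle of the scheme for \<nu> = 0 and constant \<xi> = \<open>c\<close>, with an
  arbitrary family in place of the previous iterate. The whole family over \<open>c\<close> is
  needed because an impulse moves the argument to \<open>c + \<beta>\<close>.\<close>

definition obstacle :: "(nat \<Rightarrow> 'b \<Rightarrow> 'a \<Rightarrow> real) \<Rightarrow> nat \<Rightarrow> 'b \<Rightarrow> 'a \<Rightarrow> real" where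
  "obstacle Z k c \<omega> = E k (\<lambda>\<omega>'. \<Sum>l\<in>{k+1..<k+\<Delta>}. G l c \<omega>') \<omega> +
     Max ((\<lambda>\<beta>. E k (\<lambda>\<omega>'. - (q ^ (k + \<Delta>)) * \<Psi> \<beta> + Z (k + \<Delta>) (c + \<beta>) \<omega>') \<omega>) ` U)"

definition Yn :: "nat \<Rightarrow> nat \<Rightarrow> 'b \<Rightarrow> 'a \<Rightarrow> real" where
  "Yn n k c = Y_iter M F \<Delta> \<theta> U X g \<Psi> n (\<lambda>_. 0) (\<lambda>_. c) (enat k)"

lemma K_nonneg: "0 \<le> K" using g(2)[of 0] by simp

lemma L_nonneg: "0 \<le> L" using U \<Psi> by fastforce

lemma G_bound: "\<bar>G k c \<omega>\<bar> \<le> K * q ^ k"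
  using g(2)[of "X k \<omega> + c"] q by (simp add: G_def abs_mult mult.commute mult_left_mono)

lemma G_adapted: "G k c \<in> borel_measurable (F k)"
proof -
  note [measurable] = X g(1)
  show ?thesis unfolding G_def[abs_def] by measurable
qed

lemma decaying_G: "decaying G"
  by (rule decayingI[OF G_adapted]) (use G_bound in auto)

lemma obstacle_integrands:
  assumes "decaying Z"
  shows "(\<lambda>\<omega>. \<Sum>l\<in>I. G l c \<omega>) \<in> borel_measurable M"
    and "integrable M (\<lambda>\<omega>. - (q ^ (k + \<Delta>)) * \<Psi> \<beta> + Z (k + \<Delta>) (c + \<beta>) \<omega>)"
  using decaying_measurable[OF decaying_G] decaying_integrable[OF assms] by auto

lemma obstacle_adapted: "obstacle Z k c \<in> borel_measurable (F k)"
  using U unfolding obstacle_def[abs_def] by measurable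

lemma decaying_obstacle:
  assumes "decaying Z"
  shows "decaying (obstacle Z)"
proof -
  obtain C where C: "0 \<le> C" "\<And>k c. AE \<omega> in M. \<bar>Z k c \<omega>\<bar> \<le> C * q ^ k"
    by (rule decaying_bound[OF assms]) auto
  show ?thesis
  proof (rule decayingI)
    show "obstacle Z k c \<in> borel_measurable (F k)" for k c by (rule obstacle_adapted)
    fix k c
    have 1: "AE \<omega> in M. \<bar>E k (\<lambda>\<omega>'. \<Sum>l\<in>{k+1..<k+\<Delta>}. G l c \<omega>') \<omega>\<bar> \<le> real \<Delta> * K * q ^ k"
    proof (rule cond_exp_bound[OF obstacle_integrands(1)[OF assms]], rule AE_I2)
      fix \<omega>
      have "\<bar>\<Sum>l\<in>{k+1..<k+\<Delta>}. G l c \<omega>\<bar> \<le> (\<Sum>l\<in>{k+1..<k+\<Delta>}. K * q ^ k)"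
        by (rule order_trans[OF sum_abs], rule sum_mono, rule order_trans[OF G_bound])
          (use q K_nonneg in \<open>auto intro!: mult_left_mono power_decreasing\<close>)
      also have "\<dots> \<le> real \<Delta> * (K * q ^ k)"
        using K_nonneg q by (simp add: mult_right_mono)
      finally show "\<bar>\<Sum>l\<in>{k+1..<k+\<Delta>}. G l c \<omega>\<bar> \<le> real \<Delta> * K * q ^ k" by (simp add: mult.assoc)
    qed
    have 2: "AE \<omega> in M. \<bar>E k (\<lambda>\<omega>'. - (q ^ (k + \<Delta>)) * \<Psi> \<beta> + Z (k + \<Delta>) (c + \<beta>) \<omega>') \<omega>\<bar> \<le> (L + C) * q ^ k"
      if "\<beta> \<in> U" for \<beta>
    proof (rule cond_exp_bound)
      show "(\<lambda>\<omega>'. - (q ^ (k + \<Delta>)) * \<Psi> \<beta> + Z (k + \<Delta>) (c + \<beta>) \<omega>') \<in> borel_measurable M"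
        by (rule borel_measurable_integrable[OF obstacle_integrands(2)[OF assms]])
      show "AE \<omega> in M. \<bar>- (q ^ (k + \<Delta>)) * \<Psi> \<beta> + Z (k + \<Delta>) (c + \<beta>) \<omega>\<bar> \<le> (L + C) * q ^ k"
        using C(2)[of "k + \<Delta>" "c + \<beta>"]
      proof eventually_elim
        case (elim \<omega>)
        have "\<bar>- (q ^ (k + \<Delta>)) * \<Psi> \<beta>\<bar> \<le> L * q ^ (k + \<Delta>)"
          using \<Psi>[OF that] q by (simp add: abs_mult mult.commute mult_left_mono)
        with elim have "\<bar>- (q ^ (k + \<Delta>)) * \<Psi> \<beta> + Z (k + \<Delta>) (c + \<beta>) \<omega>\<bar> \<le> (L + C) * q ^ (k + \<Delta>)"
          unfolding distrib_right by linarith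
        also have "\<dots> \<le> (L + C) * q ^ k"
          using q C(1) L_nonneg by (intro mult_left_mono power_decreasing) auto
        finally show ?case .
      qed
    qed
    have "AE \<omega> in M. \<forall>\<beta>\<in>U. \<bar>E k (\<lambda>\<omega>'. - (q ^ (k + \<Delta>)) * \<Psi> \<beta> + Z (k + \<Delta>) (c + \<beta>) \<omega>') \<omega>\<bar> \<le> (L + C) * q ^ k"
      using 2 U by (intro AE_finite_allI) auto
    with 1 show "AE \<omega> in M. \<bar>obstacle Z k c \<omega>\<bar> \<le> (real \<Delta> * K + (L + C)) * q ^ k"
    proof eventually_elim
      case (elim \<omega>)
      \<comment> \<open>The entries may be negative, so the absolute value is bounded by comparison
        with the maximum of the zero function.\<close>
      have "\<bar>Max ((\<lambda>\<beta>. E k (\<lambda>\<omega>'. - (q ^ (k + \<Delta>)) * \<Psi> \<beta> + Z (k + \<Delta>) (c + \<beta>) \<omega>') \<omega>) ` U) - Max ((\<lambda>\<beta>. 0) ` U)\<bar>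
          \<le> (L + C) * q ^ k"
        by (rule abs_Max_diff_le[OF U]) (use elim(2) in simp)
      moreover have "Max ((\<lambda>\<beta>. 0::real) ` U) = 0" using U by simp
      ultimately show ?case
        using elim(1) unfolding obstacle_def distrib_right by linarith
    qed
  qed
qed

text \<open>The running gain and the impulse cost are the same on both sides and cancel. The family
  is evaluated at \<open>k + \<Delta>\<close>, and a delay of at least one step gives
  \<open>q ^ (k + \<Delta>) \<le> q * q ^ k\<close>: the delay itself makes the obstacle
  contract.\<close>

lemma obstacle_contraction:
  assumes "decaying Z" "decaying Z'" "0 \<le> D" "\<And>k c. AE \<omega> in M. \<bar>Z k c \<omega> - Z' k c \<omega>\<bar> \<le> D * q ^ k"
  shows "AE \<omega> in M. \<bar>obstacle Z k c \<omega> - obstacle Z' k c \<omega>\<bar> \<le> D * q * q ^ k"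
proof -
  have "AE \<omega> in M. \<forall>\<beta>\<in>U. \<bar>E k (\<lambda>\<omega>'. - (q ^ (k + \<Delta>)) * \<Psi> \<beta> + Z (k + \<Delta>) (c + \<beta>) \<omega>') \<omega> -
      E k (\<lambda>\<omega>'. - (q ^ (k + \<Delta>)) * \<Psi> \<beta> + Z' (k + \<Delta>) (c + \<beta>) \<omega>') \<omega>\<bar> \<le> D * q ^ (k + \<Delta>)"
  proof (rule AE_finite_allI[OF U(1)], rule cond_exp_close)
    show "AE \<omega> in M. \<bar>- (q ^ (k + \<Delta>)) * \<Psi> \<beta> + Z (k + \<Delta>) (c + \<beta>) \<omega> -
        (- (q ^ (k + \<Delta>)) * \<Psi> \<beta> + Z' (k + \<Delta>) (c + \<beta>) \<omega>)\<bar> \<le> D * q ^ (k + \<Delta>)" for \<beta>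
      using assms(4)[of "k + \<Delta>" "c + \<beta>"] by eventually_elim simp
  qed (rule obstacle_integrands(2) assms)+
  then show ?thesis
  proof eventually_elim
    case (elim \<omega>)
    have "\<bar>obstacle Z k c \<omega> - obstacle Z' k c \<omega>\<bar> \<le> D * q ^ (k + \<Delta>)"
      unfolding obstacle_def add_diff_cancel_left
      by (rule abs_Max_diff_le[OF U]) (use elim in blast)
    also have "\<dots> \<le> D * q ^ Suc k"
      using assms(3) q \<Delta> by (intro mult_left_mono power_decreasing) auto
    finally show ?case by (simp add: mult_ac)
  qed
qed

lemma value_exists:
  obtains V where "decaying V"
    "\<And>k c. AE \<omega> in M. V k c \<omega> = G k c \<omega> + max (obstacle V k c \<omega>) (E k (V (Suc k) c) \<omega>)"
proof -
  have "\<exists>V. decaying V \<and>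
      (\<forall>k c. AE \<omega> in M. V k c \<omega> = G k c \<omega> + max (obstacle V k c \<omega>) (E k (V (Suc k) c) \<omega>))"
    by (rule bellman_fixed_point[OF decaying_G]) (rule decaying_obstacle obstacle_contraction; assumption)+
  then show thesis using that by blast
qed

lemma gain_eq:
  "gain \<theta> X g (\<lambda>_. 0) (\<lambda>_. c) k t \<omega> = (\<Sum>l. G l c \<omega> * of_bool (k \<le> l \<and> enat l \<le> t))"
  unfolding gain_def exp_discount G_def by simp

lemma obstacle_step_eq:
  "obstacle_step M F \<Delta> \<theta> U X g \<Psi> (Y_iter M F \<Delta> \<theta> U X g \<Psi> n) (\<lambda>_. 0) (\<lambda>_. c) t \<omega> =
    (case t of enat k \<Rightarrow> obstacle (Yn n) k c \<omega> | \<infinity> \<Rightarrow> 0)"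
  by (cases t) (simp_all only: obstacle_step_def obstacle_def Yn_def exp_discount G_def enat.case
    zero_le of_bool_eq mult_1_right)

lemma Yn_0: "Yn 0 k c = E k (\<lambda>\<omega>. \<Sum>l. G l c \<omega> * of_bool (k \<le> l))"
  by (simp add: Yn_def gain_eq[abs_def])

lemma Yn_Suc: "Yn (Suc n) k c = ess_sup_family M
   {E k (\<lambda>\<omega>. (\<Sum>l. G l c \<omega> * of_bool (k \<le> l \<and> enat l \<le> \<tau> \<omega>)) +
         (case \<tau> \<omega> of enat j \<Rightarrow> obstacle (Yn n) j c \<omega> | \<infinity> \<Rightarrow> 0)) | \<tau>.
        stopping_time (filt_ext F) \<tau> \<and> (\<forall>\<omega>\<in>space M. enat k \<le> \<tau> \<omega>)}"
  by (simp only: Yn_def Y_iter.simps enat.case gain_eq obstacle_step_eq)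

lemma decaying_Yn_0: "decaying (Yn 0)"
proof (rule decayingI)
  show "Yn 0 k c \<in> borel_measurable (F k)" for k c unfolding Yn_0 by simp
  show "AE \<omega> in M. \<bar>Yn 0 k c \<omega>\<bar> \<le> K / (1 - q) * q ^ k" for k c
    unfolding Yn_0
  proof (rule cond_exp_bound)
    note [measurable] = decaying_measurable[OF decaying_G]
    show "(\<lambda>\<omega>. \<Sum>l. G l c \<omega> * of_bool (k \<le> l)) \<in> borel_measurable M" by measurable
    have "\<bar>\<Sum>l. G l c \<omega> * of_bool (k \<le> l)\<bar> \<le> K / (1 - q) * q ^ k" for \<omega>
    proof -
      have "\<bar>G l c \<omega> * of_bool (k \<le> l)\<bar> \<le> K * q ^ l" for l
      using G_bound[of l c \<omega>] K_nonneg q by auto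
      from geometric_tail[OF this q, of k] show ?thesis by simp
    qed
    then show "AE \<omega> in M. \<bar>\<Sum>l. G l c \<omega> * of_bool (k \<le> l)\<bar> \<le> K / (1 - q) * q ^ k" by simp
  qed
qed

text \<open>Only \<open>M\<close>-measurability of \<open>Z\<close> is asked, since the iterates are
  arbitrary versions of essential suprema. The obstacle at one \<open>k\<close> and \<open>c\<close>
  sees \<open>Z\<close> at finitely many arguments, so finitely many null sets suffice.\<close>

lemma obstacle_cong_AE:
  assumes "decaying S" "\<And>k c. Z k c \<in> borel_measurable M" "\<And>k c. AE \<omega> in M. Z k c \<omega> = S k c \<omega>"
  shows "AE \<omega> in M. obstacle Z k c \<omega> = obstacle S k c \<omega>"
proof -
  interpret k: sigma_finite_subalgebra M "F k" by (rule sigma_finite_subalg)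
  have "AE \<omega> in M. \<forall>\<beta>\<in>U. E k (\<lambda>\<omega>'. - (q ^ (k + \<Delta>)) * \<Psi> \<beta> + Z (k + \<Delta>) (c + \<beta>) \<omega>') \<omega> =
      E k (\<lambda>\<omega>'. - (q ^ (k + \<Delta>)) * \<Psi> \<beta> + S (k + \<Delta>) (c + \<beta>) \<omega>') \<omega>"
  proof (rule AE_finite_allI[OF U(1)], rule k.real_cond_exp_cong)
    note [measurable] = assms(2) decaying_measurable[OF assms(1)]
    show "AE \<omega> in M. - (q ^ (k + \<Delta>)) * \<Psi> \<beta> + Z (k + \<Delta>) (c + \<beta>) \<omega> =
      - (q ^ (k + \<Delta>)) * \<Psi> \<beta> + S (k + \<Delta>) (c + \<beta>) \<omega>" for \<beta>
      using assms(3)[of "k + \<Delta>" "c + \<beta>"] by eventually_elim simp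
    show "(\<lambda>\<omega>. - (q ^ (k + \<Delta>)) * \<Psi> \<beta> + Z (k + \<Delta>) (c + \<beta>) \<omega>) \<in> borel_measurable M"
      "(\<lambda>\<omega>. - (q ^ (k + \<Delta>)) * \<Psi> \<beta> + S (k + \<Delta>) (c + \<beta>) \<omega>) \<in> borel_measurable M" for \<beta>
      by measurable
  qed
  then show ?thesis by eventually_elim (simp add: obstacle_def)
qed

text \<open>Applied to \<open>obstacle (Yn n)\<close>: conditional expectations restore adaptedness,
  and the decay is inherited from the process it equals almost surely.\<close>

lemma decaying_cong_AE:
  assumes "decaying S" "\<And>k c. Z k c \<in> borel_measurable (F k)" "\<And>k c. AE \<omega> in M. Z k c \<omega> = S k c \<omega>"
  shows "decaying Z"
proof (rule decaying_bound[OF assms(1)])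
  fix C assume C: "\<And>k c. AE \<omega> in M. \<bar>S k c \<omega>\<bar> \<le> C * q ^ k"
  show ?thesis
  proof (rule decayingI[OF assms(2)])
    show "AE \<omega> in M. \<bar>Z k c \<omega>\<bar> \<le> C * q ^ k" for k c
      using assms(3)[of k c] C[of k c] by eventually_elim simp
  qed
qed

section \<open>Geometric convergence of the iterates to the value\<close>

context
  fixes V :: "nat \<Rightarrow> 'b \<Rightarrow> 'a \<Rightarrow> real"
  assumes V: "decaying V"
    "\<And>k c. AE \<omega> in M. V k c \<omega> = G k c \<omega> + max (obstacle V k c \<omega>) (E k (V (Suc k) c) \<omega>)"
begin

text \<open>The induction carries a decaying process \<open>S\<close> that agrees almost surely with
  \<open>Yn n\<close>. For \<open>n > 0\<close> the iterate is a version picked by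
  \<open>ess_sup_family\<close>, whose adaptedness is not known, so it is \<open>S\<close> that
  enters the contraction estimate.\<close>

lemma Yn_close:
  obtains D where "0 < D"
    "\<And>n k c. Yn n k c \<in> borel_measurable M"
    "\<And>n k c. AE \<omega> in M. \<bar>Yn n k c \<omega> - V k c \<omega>\<bar> \<le> D * q ^ n * q ^ k"
proof -
  obtain C0 where C0: "0 \<le> C0" "\<And>k c. AE \<omega> in M. \<bar>Yn 0 k c \<omega>\<bar> \<le> C0 * q ^ k"
    by (rule decaying_bound[OF decaying_Yn_0]) auto
  obtain C where C: "0 \<le> C" "\<And>k c. AE \<omega> in M. \<bar>V k c \<omega>\<bar> \<le> C * q ^ k"
    by (rule decaying_bound[OF V(1)]) auto
  \<comment> \<open>\<open>C0 + C\<close> bounds the initial distance from \<open>V\<close>; the 1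
    makes \<open>D\<close> strictly positive, as the comparison of Bellman equations
    requires.\<close>
  define D where "D = C0 + C + 1"
  have D: "0 < D" using C0(1) C(1) by (simp add: D_def)
  have *: "(\<forall>k c. Yn n k c \<in> borel_measurable M) \<and> (\<exists>S. decaying S \<and> (\<forall>k c. AE \<omega> in M. Yn n k c \<omega> = S k c \<omega>) \<and>
    (\<forall>k c. AE \<omega> in M. \<bar>S k c \<omega> - V k c \<omega>\<bar> \<le> D * q ^ n * q ^ k))" for n
  proof (induction n)
    case 0
    have "AE \<omega> in M. \<bar>Yn 0 k c \<omega> - V k c \<omega>\<bar> \<le> D * q ^ 0 * q ^ k" for k c
      using C0(2)[of k c] C(2)[of k c]
    proof eventually_elim
      case (elim \<omega>)
      have "0 \<le> q ^ k" using q by simp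
      with elim show ?case unfolding D_def distrib_right by simp
    qed
    with decaying_Yn_0 decaying_measurable[OF decaying_Yn_0] show ?case by blast
  next
    case (Suc n)
    then obtain S where S: "decaying S" "\<And>k c. AE \<omega> in M. Yn n k c \<omega> = S k c \<omega>"
      "\<And>k c. AE \<omega> in M. \<bar>S k c \<omega> - V k c \<omega>\<bar> \<le> D * q ^ n * q ^ k"
      and Y: "\<And>k c. Yn n k c \<in> borel_measurable M" by blast
    have Ob: "AE \<omega> in M. obstacle (Yn n) k c \<omega> = obstacle S k c \<omega>" for k c
      by (rule obstacle_cong_AE[OF S(1) Y S(2)])
    have dec: "decaying (obstacle (Yn n))"
      by (rule decaying_cong_AE[OF decaying_obstacle[OF S(1)] obstacle_adapted Ob])
    obtain S' where S': "decaying S'"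
      "\<And>k c. AE \<omega> in M. S' k c \<omega> = G k c \<omega> + max (obstacle (Yn n) k c \<omega>) (E k (S' (Suc k) c) \<omega>)"
      "\<And>k c. is_ess_sup M
      {E k (\<lambda>\<omega>. (\<Sum>l. G l c \<omega> * of_bool (k \<le> l \<and> enat l \<le> \<tau> \<omega>)) +
         (case \<tau> \<omega> of enat j \<Rightarrow> obstacle (Yn n) j c \<omega> | \<infinity> \<Rightarrow> 0)) | \<tau>.
        stopping_time (filt_ext F) \<tau> \<and> (\<forall>\<omega>\<in>space M. enat k \<le> \<tau> \<omega>)} (S' k c)"
      by (rule snell_ess_sup[OF decaying_G dec]) blast
    note sup = is_ess_sup_ess_sup_family[OF S'(3), folded Yn_Suc]
    have "Yn (Suc n) k c \<in> borel_measurable M" for k c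
      using sup[of k c] by (simp add: is_ess_sup_def)
    moreover have "AE \<omega> in M. Yn (Suc n) k c \<omega> = S' k c \<omega>" for k c
      by (rule is_ess_sup_unique[OF sup S'(3)])
    \<comment> \<open>\<open>S'\<close> and \<open>V\<close> solve the same equation with different
      obstacles, so the factor \<open>q\<close> gained by the obstacles is inherited by the
      solutions.\<close>
    moreover have "AE \<omega> in M. \<bar>S' k c \<omega> - V k c \<omega>\<bar> \<le> D * q ^ n * q * q ^ k" for k c
    proof (rule bellman_compare[OF S'(1,2) V])
      show "0 < D * q ^ n * q" using D q by simp
      show "AE \<omega> in M. \<bar>obstacle (Yn n) k c \<omega> - obstacle V k c \<omega>\<bar> \<le> D * q ^ n * q * q ^ k" for k c
        using obstacle_contraction[OF S(1) V(1) _ S(3), of k c] Ob[of k c] D q by auto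
    qed
    ultimately show ?case using S'(1) by (auto simp: mult_ac)
  qed
  show thesis
  proof (rule that[OF D])
    show "Yn n k c \<in> borel_measurable M" for n k c using *[of n] by blast
    show "AE \<omega> in M. \<bar>Yn n k c \<omega> - V k c \<omega>\<bar> \<le> D * q ^ n * q ^ k" for n k c
    proof -
      from *[of n] obtain S where "AE \<omega> in M. Yn n k c \<omega> = S k c \<omega>"
        "AE \<omega> in M. \<bar>S k c \<omega> - V k c \<omega>\<bar> \<le> D * q ^ n * q ^ k" by blast
      then show ?thesis by eventually_elim simp
    qed
  qed
qed

lemma Y_lim_eq:
  shows "AE \<omega> in M. Y_lim M F \<Delta> \<theta> U X g \<Psi> (\<lambda>_. 0) (\<lambda>_. c) (enat k) \<omega> = V k c \<omega>"
    and "Y_lim M F \<Delta> \<theta> U X g \<Psi> (\<lambda>_. 0) (\<lambda>_. c) (enat k) \<in> borel_measurable M"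
proof -
  have eq: "Y_lim M F \<Delta> \<theta> U X g \<Psi> (\<lambda>_. 0) (\<lambda>_. c) (enat k) = (\<lambda>\<omega>. lim (\<lambda>n. Yn n k c \<omega>))"
    by (simp add: Y_lim_def[abs_def] Yn_def)
  obtain D where [measurable]: "\<And>n k c. Yn n k c \<in> borel_measurable M"
    and D: "\<And>n k c. AE \<omega> in M. \<bar>Yn n k c \<omega> - V k c \<omega>\<bar> \<le> D * q ^ n * q ^ k"
    by (rule Yn_close) blast
  show "Y_lim M F \<Delta> \<theta> U X g \<Psi> (\<lambda>_. 0) (\<lambda>_. c) (enat k) \<in> borel_measurable M"
    unfolding eq by measurable
  have "AE \<omega> in M. \<forall>n. \<bar>Yn n k c \<omega> - V k c \<omega>\<bar> \<le> D * q ^ n * q ^ k"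
    using D by (simp add: AE_all_countable)
  then show "AE \<omega> in M. Y_lim M F \<Delta> \<theta> U X g \<Psi> (\<lambda>_. 0) (\<lambda>_. c) (enat k) \<omega> = V k c \<omega>"
  proof eventually_elim
    case (elim \<omega>)
    have "(\<lambda>n. D * q ^ n * q ^ k) \<longlonglongrightarrow> 0"
      using q by (auto intro!: tendsto_mult_left_zero tendsto_mult_right_zero LIMSEQ_power_zero)
    then have "(\<lambda>n. Yn n k c \<omega> - V k c \<omega>) \<longlonglongrightarrow> 0"
      by (rule Lim_null_comparison[rotated]) (use elim in auto)
    then have "(\<lambda>n. Yn n k c \<omega>) \<longlonglongrightarrow> V k c \<omega>" by (simp add: LIM_zero_iff)
    then show ?case unfolding eq by (rule limI)
  qed
qed

end

section \<open>Dynamic programming for controls\<close>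

text \<open>A state \<open>(c, \<beta>, r)\<close> consists of the executed impulses \<open>c\<close>, the ordered impulse \<open>\<beta>\<close> and the
  number \<open>r\<close> of steps until its execution; \<open>r = 0\<close> means that no order is outstanding (then \<open>\<beta>\<close>
  is irrelevant). The cost of an impulse is charged when it is ordered.\<close>

fun execute :: "'b \<times> 'b \<times> nat \<Rightarrow> 'b \<times> 'b \<times> nat" where
  "execute (c, \<beta>, 0) = (c + \<beta>, 0, 0)"
| "execute (c, \<beta>, Suc r) = (c, \<beta>, Suc r)"

text \<open>The counter set at time \<open>k\<close> is \<Delta> - 1 because it describes time
  \<open>k + 1\<close>. Each further step lowers it by one, and at 0 \<open>execute\<close> moves
  the impulse into the first component, so the shift first shows at time
  \<open>k + \<Delta>\<close>. An action during a pending order is ignored.\<close>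

fun step :: "'b \<times> 'b \<times> nat \<Rightarrow> 'b option \<Rightarrow> 'b \<times> 'b \<times> nat" where
  "step (c, \<beta>, Suc r) a = execute (c, \<beta>, r)"
| "step (c, \<beta>, 0) None = (c, \<beta>, 0)"
| "step (c, \<beta>, 0) (Some \<beta>') = execute (c, \<beta>', \<Delta> - 1)"

text \<open>The cost carries the discount factor of the execution time \<open>k + \<Delta>\<close>,
  so nothing about it has to be remembered in the state.\<close>

definition reward :: "nat \<Rightarrow> 'b \<times> 'b \<times> nat \<Rightarrow> 'b option \<Rightarrow> 'a \<Rightarrow> real" where
  "reward k s a \<omega> = G k (fst s) \<omega> - (case a of None \<Rightarrow> 0 | Some \<beta> \<Rightarrow> q ^ (k + \<Delta>) * \<Psi> \<beta>)"

definition actions :: "'b option set" where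
  "actions = insert None (Some ` U)"

definition admissible :: "'b \<times> 'b \<times> nat \<Rightarrow> 'b option \<Rightarrow> bool" where
  "admissible s a \<longleftrightarrow> snd (snd s) = 0 \<or> a = None"

primrec state :: "(nat \<Rightarrow> 'a \<Rightarrow> 'b option) \<Rightarrow> nat \<Rightarrow> 'a \<Rightarrow> 'b \<times> 'b \<times> nat" where
  "state \<alpha> 0 \<omega> = (0, 0, 0)"
| "state \<alpha> (Suc k) \<omega> = step (state \<alpha> k \<omega>) (\<alpha> k \<omega>)"

text \<open>A finite superset of the states possible at time \<open>k\<close>, over all actions
  whether or not admissible. It lets almost sure statements about single states be combined into one
  about the random state.\<close>

primrec reachable :: "nat \<Rightarrow> ('b \<times> 'b \<times> nat) set" where
  "reachable 0 = {(0, 0, 0)}"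
| "reachable (Suc k) = (\<lambda>(s, a). step s a) ` (reachable k \<times> actions)"

definition control :: "(nat \<Rightarrow> 'a \<Rightarrow> 'b option) \<Rightarrow> bool" where
  "control \<alpha> \<longleftrightarrow> (\<forall>k. (\<forall>\<omega>\<in>space M. \<alpha> k \<omega> \<in> actions) \<and> (\<forall>a. {\<omega>\<in>space M. \<alpha> k \<omega> = a} \<in> sets (F k)))"

definition total_reward :: "(nat \<Rightarrow> 'a \<Rightarrow> 'b option) \<Rightarrow> real" where
  "total_reward \<alpha> = (\<integral>\<omega>. (\<Sum>k. reward k (state \<alpha> k \<omega>) (\<alpha> k \<omega>) \<omega>) \<partial>M)"

lemma finite_actions: "finite actions"
  using U by (simp add: actions_def)

lemma finite_reachable: "finite (reachable k)"
  by (induction k) (auto intro: finite_actions)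

lemma state_reachable: "control \<alpha> \<Longrightarrow> \<omega> \<in> space M \<Longrightarrow> state \<alpha> k \<omega> \<in> reachable k"
proof (induction k)
  case (Suc k)
  then have "(state \<alpha> k \<omega>, \<alpha> k \<omega>) \<in> reachable k \<times> actions" by (auto simp: control_def)
  then show ?case by (auto simp: image_iff intro!: bexI)
qed simp

lemma action_events: "control \<alpha> \<Longrightarrow> {\<omega>\<in>space M. P (\<alpha> k \<omega>)} \<in> sets (F k)"
proof -
  assume "control \<alpha>"
  then have "{\<omega>\<in>space M. P (\<alpha> k \<omega>)} = (\<Union>a\<in>{a\<in>actions. P a}. {\<omega>\<in>space M. \<alpha> k \<omega> = a})"
    by (auto simp: control_def)
  also have "\<dots> \<in> sets (F k)"
    using \<open>control \<alpha>\<close> finite_actions by (intro sets.finite_UN) (auto simp: control_def)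
  finally show ?thesis .
qed

lemma state_action_events:
  assumes "control \<alpha>"
  shows "{\<omega>\<in>space M. state \<alpha> k \<omega> = s} \<in> sets (F k)"
    and "{\<omega>\<in>space M. (state \<alpha> k \<omega>, \<alpha> k \<omega>) = sa} \<in> sets (F k)"
proof -
  show state: "{\<omega>\<in>space M. state \<alpha> k \<omega> = s} \<in> sets (F k)" for s k
  proof (induction k arbitrary: s)
    case 0
    then show ?case using sets.top[of "F 0"] by (cases "s = (0, 0, 0)") (auto simp: space_F)
  next
    case (Suc k)
    have "{\<omega>\<in>space M. state \<alpha> (Suc k) \<omega> = s} =
        (\<Union>sa\<in>{sa\<in>reachable k \<times> actions. step (fst sa) (snd sa) = s}.
          {\<omega>\<in>space M. state \<alpha> k \<omega> = fst sa} \<inter> {\<omega>\<in>space M. \<alpha> k \<omega> = snd sa})" (is "?L = ?R")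
    proof (intro set_eqI iffI)
      fix \<omega> assume \<omega>: "\<omega> \<in> ?L"
      then have "(state \<alpha> k \<omega>, \<alpha> k \<omega>) \<in> {sa\<in>reachable k \<times> actions. step (fst sa) (snd sa) = s}"
        using state_reachable[OF assms, of \<omega> k] assms by (simp add: control_def)
      then show "\<omega> \<in> ?R" by (rule UN_I) (use \<omega> in simp)
    qed auto
    also have "\<dots> \<in> sets (F k)"
      using Suc finite_actions finite_reachable[of k] assms
      by (intro sets.finite_UN) (auto simp: control_def)
    finally show ?case using sets_F_mono[of k "Suc k"] by auto
  qed
  have "{\<omega>\<in>space M. (state \<alpha> k \<omega>, \<alpha> k \<omega>) = sa} =
      {\<omega>\<in>space M. state \<alpha> k \<omega> = fst sa} \<inter> {\<omega>\<in>space M. \<alpha> k \<omega> = snd sa}"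
    by auto
  also have "\<dots> \<in> sets (F k)" using state[of k "fst sa"] assms by (auto simp: control_def)
  finally show "{\<omega>\<in>space M. (state \<alpha> k \<omega>, \<alpha> k \<omega>) = sa} \<in> sets (F k)" .
qed

lemma reward_bound: "a \<in> actions \<Longrightarrow> \<bar>reward k s a \<omega>\<bar> \<le> (K + L) * q ^ k"
proof -
  assume a: "a \<in> actions"
  have "\<bar>case a of None \<Rightarrow> 0 | Some \<beta> \<Rightarrow> q ^ (k + \<Delta>) * \<Psi> \<beta>\<bar> \<le> L * q ^ k"
  proof (cases a)
    case (Some \<beta>)
    with a have "\<bar>\<Psi> \<beta>\<bar> \<le> L" by (auto simp: actions_def intro: \<Psi>)
    then have "\<bar>q ^ (k + \<Delta>) * \<Psi> \<beta>\<bar> \<le> q ^ (k + \<Delta>) * L"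
      using q by (simp add: abs_mult mult_left_mono)
    also have "\<dots> \<le> q ^ k * L"
      using q L_nonneg by (intro mult_right_mono power_decreasing) auto
    finally show ?thesis using Some by (simp add: mult.commute)
  qed (use q L_nonneg in simp)
  with G_bound[of k "fst s" \<omega>] show ?thesis
    unfolding reward_def distrib_right by linarith
qed

lemma reward_integrable: "integrable M (reward k s a)"
  unfolding reward_def[abs_def] using decaying_integrable[OF decaying_G] by simp

lemma select_state_action:
  assumes "control \<alpha>" "\<And>s a. integrable M (f s a)"
  shows "integrable M (\<lambda>\<omega>. f (state \<alpha> k \<omega>) (\<alpha> k \<omega>) \<omega>)"
    and "integrable M (\<lambda>\<omega>. E k (f (state \<alpha> k \<omega>) (\<alpha> k \<omega>)) \<omega>)"
    and "(\<integral>\<omega>. E k (f (state \<alpha> k \<omega>) (\<alpha> k \<omega>)) \<omega> \<partial>M) = (\<integral>\<omega>. f (state \<alpha> k \<omega>) (\<alpha> k \<omega>) \<omega> \<partial>M)"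
proof -
  note select = integral_select[where N="\<lambda>\<omega>. (state \<alpha> k \<omega>, \<alpha> k \<omega>)" and k=k and I="reachable k \<times> actions"
      and f="\<lambda>(s, a). f s a"]
  have "finite (reachable k \<times> actions)" using finite_reachable finite_actions by simp
  moreover have "(state \<alpha> k \<omega>, \<alpha> k \<omega>) \<in> reachable k \<times> actions" if "\<omega> \<in> space M" for \<omega>
    using state_reachable[OF assms(1) that] assms(1) that by (auto simp: control_def)
  moreover note state_action_events(2)[OF assms(1)]
  moreover have "integrable M (case sa of (s, a) \<Rightarrow> f s a)" for sa using assms(2) by (cases sa) simp
  ultimately show "integrable M (\<lambda>\<omega>. f (state \<alpha> k \<omega>) (\<alpha> k \<omega>) \<omega>)"
    "integrable M (\<lambda>\<omega>. E k (f (state \<alpha> k \<omega>) (\<alpha> k \<omega>)) \<omega>)"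
    "(\<integral>\<omega>. E k (f (state \<alpha> k \<omega>) (\<alpha> k \<omega>)) \<omega> \<partial>M) = (\<integral>\<omega>. f (state \<alpha> k \<omega>) (\<alpha> k \<omega>) \<omega> \<partial>M)"
    using select by (simp_all del: mem_Sigma_iff)
qed

text \<open>The uniform geometric bound on the rewards justifies exchanging expectation and
  series.\<close>

lemma total_reward_sums:
  assumes "control \<alpha>"
  shows "(\<lambda>k. \<integral>\<omega>. reward k (state \<alpha> k \<omega>) (\<alpha> k \<omega>) \<omega> \<partial>M) sums total_reward \<alpha>"
proof -
  let ?R = "\<lambda>k \<omega>. reward k (state \<alpha> k \<omega>) (\<alpha> k \<omega>) \<omega>"
  have int: "integrable M (?R k)" for k
    by (rule select_state_action(1)[OF assms reward_integrable])
  have bound: "\<bar>?R k \<omega>\<bar> \<le> (K + L) * q ^ k" if "\<omega> \<in> space M" for k \<omega>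
    using reward_bound assms that by (auto simp: control_def)
  have "summable (\<lambda>k. \<integral>\<omega>. \<bar>?R k \<omega>\<bar> \<partial>M)"
  proof (rule summable_abs_le_geometric[OF _ q])
    fix k
    have "(\<integral>\<omega>. \<bar>?R k \<omega>\<bar> \<partial>M) \<le> (\<integral>\<omega>. (K + L) * q ^ k \<partial>M)"
      using int[of k] bound by (intro integral_mono) auto
    then show "\<bar>\<integral>\<omega>. \<bar>?R k \<omega>\<bar> \<partial>M\<bar> \<le> (K + L) * q ^ k" by (simp add: prob_space)
  qed
  moreover have "summable (\<lambda>k. \<bar>?R k \<omega>\<bar>)" if "\<omega> \<in> space M" for \<omega>
    by (rule summable_abs_le_geometric[OF _ q, where B="K + L"]) (use bound[OF that] in simp)
  ultimately show ?thesis
    unfolding total_reward_def using int by (intro sums_integral) auto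
qed

section \<open>Values of states and verification\<close>

context
  fixes V :: "nat \<Rightarrow> 'b \<Rightarrow> 'a \<Rightarrow> real"
  assumes V: "decaying V"
    "\<And>k c. AE \<omega> in M. V k c \<omega> = G k c \<omega> + max (obstacle V k c \<omega>) (E k (V (Suc k) c) \<omega>)"
begin

text \<open>The value with \<open>r\<close> steps left: no decision is available before execution,
  so the gain at the old shift \<open>c\<close> is collected for \<open>r\<close> steps and the
  value restarts at \<open>c + \<beta>\<close>.\<close>

definition pending :: "nat \<Rightarrow> nat \<Rightarrow> 'b \<Rightarrow> 'b \<Rightarrow> 'a \<Rightarrow> real" where
  "pending r k c \<beta> = E k (\<lambda>\<omega>. (\<Sum>l\<in>{k..<k+r}. G l c \<omega>) + V (k + r) (c + \<beta>) \<omega>)"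

definition state_value :: "nat \<Rightarrow> 'b \<times> 'b \<times> nat \<Rightarrow> 'a \<Rightarrow> real" where
  "state_value k s = (case s of (c, \<beta>, r) \<Rightarrow> if r = 0 then V k c else pending r k c \<beta>)"

definition impulse_value :: "nat \<Rightarrow> 'b \<Rightarrow> 'b \<Rightarrow> 'a \<Rightarrow> real" where
  "impulse_value k c \<beta> \<omega> = E k (\<lambda>\<omega>'. \<Sum>l\<in>{k+1..<k+\<Delta>}. G l c \<omega>') \<omega> +
     E k (\<lambda>\<omega>'. - (q ^ (k + \<Delta>)) * \<Psi> \<beta> + V (k + \<Delta>) (c + \<beta>) \<omega>') \<omega>"

text \<open>The choice operator is applied to the set of maximizers, so the chosen impulse is a
  function of a subset of the finite set \<open>U\<close> alone. This makes the selection
  measurable.\<close>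

definition best_impulse :: "nat \<Rightarrow> 'b \<Rightarrow> 'a \<Rightarrow> 'b" where
  "best_impulse k c \<omega> = (SOME \<beta>. \<beta> \<in> {\<beta>\<in>U. impulse_value k c \<beta> \<omega> = obstacle V k c \<omega>})"

definition feedback :: "nat \<Rightarrow> 'b \<times> 'b \<times> nat \<Rightarrow> 'a \<Rightarrow> 'b option" where
  "feedback k s \<omega> = (if snd (snd s) = 0 \<and> E k (V (Suc k) (fst s)) \<omega> < obstacle V k (fst s) \<omega>
     then Some (best_impulse k (fst s) \<omega>) else None)"

lemma obstacle_eq_Max: "obstacle V k c \<omega> = Max ((\<lambda>\<beta>. impulse_value k c \<beta> \<omega>) ` U)"
proof -
  have "impulse_value k c \<beta> \<omega> = E k (\<lambda>\<omega>'. - (q ^ (k + \<Delta>)) * \<Psi> \<beta> + V (k + \<Delta>) (c + \<beta>) \<omega>') \<omega> +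
      E k (\<lambda>\<omega>'. \<Sum>l\<in>{k+1..<k+\<Delta>}. G l c \<omega>') \<omega>" for \<beta>
    by (simp add: impulse_value_def)
  then show ?thesis
    unfolding obstacle_def by (simp only: Max_add_commute[OF U])
qed

lemma impulse_value_le: "\<beta> \<in> U \<Longrightarrow> impulse_value k c \<beta> \<omega> \<le> obstacle V k c \<omega>"
  unfolding obstacle_eq_Max using U by simp

lemma best_impulse: "best_impulse k c \<omega> \<in> U" "impulse_value k c (best_impulse k c \<omega>) \<omega> = obstacle V k c \<omega>"
proof -
  have "Max ((\<lambda>\<beta>. impulse_value k c \<beta> \<omega>) ` U) \<in> (\<lambda>\<beta>. impulse_value k c \<beta> \<omega>) ` U"
    using U by (intro Max_in) auto
  then have "\<exists>\<beta>. \<beta> \<in> {\<beta>\<in>U. impulse_value k c \<beta> \<omega> = obstacle V k c \<omega>}"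
    unfolding obstacle_eq_Max by auto
  from someI_ex[OF this]
  show "best_impulse k c \<omega> \<in> U" "impulse_value k c (best_impulse k c \<omega>) \<omega> = obstacle V k c \<omega>"
    by (simp_all add: best_impulse_def)
qed

lemma feedback_in_actions: "feedback k s \<omega> \<in> actions"
  using best_impulse(1) by (simp add: feedback_def actions_def)

lemma feedback_admissible: "admissible s (feedback k s \<omega>)"
  by (simp add: feedback_def admissible_def)

text \<open>The set of maximizers takes finitely many values, each on an event of \<open>F k\<close>
  described by finitely many equalities, and the chosen impulse is constant on each of these
  events.\<close>

lemma feedback_events: "{\<omega>\<in>space M. feedback k s \<omega> = a} \<in> sets (F k)"
proof -
  have [measurable]: "impulse_value k c \<beta> \<in> borel_measurable (F k)" for c \<beta>
    unfolding impulse_value_def[abs_def] by measurable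
  note [measurable] = obstacle_adapted
  let ?S = "\<lambda>\<omega>. {\<beta>\<in>U. impulse_value k (fst s) \<beta> \<omega> = obstacle V k (fst s) \<omega>}"
  have S: "{\<omega>\<in>space M. ?S \<omega> = B} \<in> sets (F k)" if "B \<subseteq> U" for B
  proof -
    have "{\<omega>\<in>space M. ?S \<omega> = B} =
        {\<omega>\<in>space (F k). \<forall>\<beta>\<in>U. (impulse_value k (fst s) \<beta> \<omega> = obstacle V k (fst s) \<omega>) = (\<beta> \<in> B)}"
      using that by (auto simp: space_F)
    also have "\<dots> \<in> sets (F k)"
      using countable_finite[OF U(1)] by measurable
    finally show ?thesis .
  qed
  define pick where "pick B = (SOME \<beta>::'b. \<beta> \<in> B)" for B
  have "best_impulse k (fst s) \<omega> = pick (?S \<omega>)" for \<omega>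
    by (simp only: best_impulse_def pick_def)
  then have "{\<omega>\<in>space M. best_impulse k (fst s) \<omega> = \<beta>} =
      (\<Union>B\<in>{B\<in>Pow U. pick B = \<beta>}. {\<omega>\<in>space M. ?S \<omega> = B})" for \<beta>
    by auto
  also have "\<dots> \<beta> \<in> sets (F k)" for \<beta>
    using S U(1) by (intro sets.finite_UN) auto
  finally have best: "{\<omega>\<in>space M. best_impulse k (fst s) \<omega> = \<beta>} \<in> sets (F k)" for \<beta> .
  have cond: "{\<omega>\<in>space M. snd (snd s) = 0 \<and> E k (V (Suc k) (fst s)) \<omega> < obstacle V k (fst s) \<omega>} \<in> sets (F k)"
    unfolding space_F[of k, symmetric] by measurable
  show ?thesis
  proof (cases a)
    case None
    have "{\<omega>\<in>space M. feedback k s \<omega> = a} = space (F k) -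
      {\<omega>\<in>space M. snd (snd s) = 0 \<and> E k (V (Suc k) (fst s)) \<omega> < obstacle V k (fst s) \<omega>}"
      using None by (auto simp: feedback_def space_F)
    also have "\<dots> \<in> sets (F k)" by (intro sets.Diff sets.top cond)
    finally show ?thesis .
  next
    case (Some \<beta>)
    have "{\<omega>\<in>space M. feedback k s \<omega> = a} = {\<omega>\<in>space M. best_impulse k (fst s) \<omega> = \<beta>} \<inter>
      {\<omega>\<in>space M. snd (snd s) = 0 \<and> E k (V (Suc k) (fst s)) \<omega> < obstacle V k (fst s) \<omega>}"
      using Some by (auto simp: feedback_def)
    also have "\<dots> \<in> sets (F k)" by (intro sets.Int best cond)
    finally show ?thesis .
  qed
qed

lemma pending_integrand:
  shows "integrable M (\<lambda>\<omega>. \<Sum>l\<in>I. G l c \<omega>)"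
    and "integrable M (\<lambda>\<omega>. (\<Sum>l\<in>I. G l c \<omega>) + V k c' \<omega>)"
  using decaying_integrable[OF decaying_G] decaying_integrable[OF V(1)] by auto

lemma pending_0: "AE \<omega> in M. pending 0 k c \<beta> \<omega> = V k (c + \<beta>) \<omega>"
proof -
  interpret k: sigma_finite_subalgebra M "F k" by (rule sigma_finite_subalg)
  show ?thesis
    using k.real_cond_exp_F_meas[OF decaying_integrable[OF V(1)] decaying_adapted[OF V(1)], of "c + \<beta>"]
    by (simp add: pending_def)
qed

lemma cond_exp_pending:
  "AE \<omega> in M. E k (pending r (Suc k) c \<beta>) \<omega> =
     E k (\<lambda>\<omega>. (\<Sum>l\<in>{Suc k..<Suc k + r}. G l c \<omega>) + V (Suc k + r) (c + \<beta>) \<omega>) \<omega>"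
proof -
  interpret k: sigma_finite_subalgebra M "F k" by (rule sigma_finite_subalg)
  show ?thesis unfolding pending_def
    by (rule k.real_cond_exp_nested_subalg[OF subalg subalg_F pending_integrand(2)]) simp
qed

lemma pending_Suc: "AE \<omega> in M. pending (Suc r) k c \<beta> \<omega> = G k c \<omega> + E k (pending r (Suc k) c \<beta>) \<omega>"
proof -
  interpret k: sigma_finite_subalgebra M "F k" by (rule sigma_finite_subalg)
  have "(\<Sum>l\<in>{k..<k + Suc r}. G l c \<omega>) = G k c \<omega> + (\<Sum>l\<in>{Suc k..<Suc k + r}. G l c \<omega>)" for \<omega>
    by (subst sum.atLeast_Suc_lessThan) auto
  then have eq: "pending (Suc r) k c \<beta> = E k (\<lambda>\<omega>. G k c \<omega> +
      ((\<Sum>l\<in>{Suc k..<Suc k + r}. G l c \<omega>) + V (Suc k + r) (c + \<beta>) \<omega>))"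
    by (simp add: pending_def add.assoc)
  show ?thesis
    unfolding eq
    using k.real_cond_exp_add[OF decaying_integrable[OF decaying_G, of k c]
      pending_integrand(2)[where I="{Suc k..<Suc k + r}" and c=c and k="Suc k + r" and c'="c + \<beta>"]]
    k.real_cond_exp_F_meas[OF decaying_integrable[OF decaying_G] G_adapted, of c]
    cond_exp_pending[of k r c \<beta>]
    by eventually_elim (simp only:)
qed

text \<open>Ordering at time \<open>k\<close> means paying now and entering the pending state with
  \<Delta> - 1 steps left at time \<open>k + 1\<close>; linearity and the tower property merge the
  two conditional expectations of \<open>impulse_value\<close>.\<close>

lemma impulse_value_eq:
  "AE \<omega> in M. impulse_value k c \<beta> \<omega> = - (q ^ (k + \<Delta>)) * \<Psi> \<beta> + E k (pending (\<Delta> - 1) (Suc k) c \<beta>) \<omega>"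
proof -
  interpret k: sigma_finite_subalgebra M "F k" by (rule sigma_finite_subalg)
  have \<Delta>': "Suc k + (\<Delta> - 1) = k + \<Delta>" using \<Delta> by simp
  have const: "integrable M (\<lambda>\<omega>. - (q ^ (k + \<Delta>)) * \<Psi> \<beta>)" by simp
  have "AE \<omega> in M. E k (\<lambda>\<omega>. - (q ^ (k + \<Delta>)) * \<Psi> \<beta>) \<omega> = - (q ^ (k + \<Delta>)) * \<Psi> \<beta>"
    by (rule k.real_cond_exp_F_meas) auto
  with k.real_cond_exp_add[OF const decaying_integrable[OF V(1), of "k + \<Delta>" "c + \<beta>"]]
    k.real_cond_exp_add[OF pending_integrand(1)[where I="{k+1..<k+\<Delta>}" and c=c] decaying_integrable[OF V(1), of "k + \<Delta>" "c + \<beta>"]]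
    cond_exp_pending[of k "\<Delta> - 1" c \<beta>, unfolded \<Delta>']
  show ?thesis
    unfolding impulse_value_def by eventually_elim simp
qed

lemma state_value_integrable: "integrable M (state_value k s)"
proof -
  interpret k: sigma_finite_subalgebra M "F k" by (rule sigma_finite_subalg)
  show ?thesis
    using decaying_integrable[OF V(1)] k.real_cond_exp_int(1)[OF pending_integrand(2)]
    by (auto simp: state_value_def pending_def split: prod.split)
qed

text \<open>For positive \<open>r\<close> both sides are the same expression. At
  \<open>r = 0\<close> the state carries \<open>V (Suc k) (c + \<beta>)\<close>, whereas
  \<open>pending 0\<close> is its conditional expectation given \<open>F (Suc k)\<close>, equal to
  it only almost surely; hence the comparison under \<open>E k\<close>.\<close>

lemma cond_exp_execute:
  "AE \<omega> in M. E k (state_value (Suc k) (execute (c, \<beta>, r))) \<omega> = E k (pending r (Suc k) c \<beta>) \<omega>"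
proof (cases r)
  case 0
  interpret k: sigma_finite_subalgebra M "F k" by (rule sigma_finite_subalg)
  have "AE \<omega> in M. E k (V (Suc k) (c + \<beta>)) \<omega> = E k (pending 0 (Suc k) c \<beta>) \<omega>"
  proof (rule k.real_cond_exp_cong)
    show "AE \<omega> in M. V (Suc k) (c + \<beta>) \<omega> = pending 0 (Suc k) c \<beta> \<omega>"
      using pending_0[of "Suc k" c \<beta>] by eventually_elim simp
  qed (auto simp: decaying_measurable[OF V(1)] pending_def)
  with 0 show ?thesis by (simp add: state_value_def)
qed (simp add: state_value_def)

text \<open>With an order pending, waiting is the only admissible action and equality is the
  recursion for \<open>pending\<close>. Otherwise the Bellman equation weighs waiting against each
  impulse: every action stays below the maximum and \<open>feedback\<close> attains it. Finiteness
  of \<open>actions\<close> yields one null set for all of them.\<close>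

lemma bellman_step:
  shows "AE \<omega> in M. \<forall>a\<in>actions. admissible s a \<longrightarrow>
      reward k s a \<omega> + E k (state_value (Suc k) (step s a)) \<omega> \<le> state_value k s \<omega>" (is ?le)
    and "AE \<omega> in M. reward k s (feedback k s \<omega>) \<omega> +
      E k (state_value (Suc k) (step s (feedback k s \<omega>))) \<omega> = state_value k s \<omega>" (is ?eq)
proof -
  obtain c \<beta> r where s: "s = (c, \<beta>, r)" by (cases s)
  have "?le \<and> ?eq"
  proof (cases r)
    case (Suc r')
    have "AE \<omega> in M. reward k s None \<omega> + E k (state_value (Suc k) (step s None)) \<omega> = state_value k s \<omega>"
      using pending_Suc[of r' k c \<beta>] cond_exp_execute[of k c \<beta> r']
      by eventually_elim (simp add: s Suc reward_def state_value_def)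
    then have "?le" by eventually_elim (auto simp: admissible_def s Suc)
    moreover have "?eq" using \<open>AE \<omega> in M. reward k s None \<omega> + _ = _\<close>
      by eventually_elim (simp add: feedback_def s Suc)
    ultimately show ?thesis ..
  next
    case 0
    have "AE \<omega> in M. \<forall>\<beta>'\<in>U. reward k s (Some \<beta>') \<omega> + E k (state_value (Suc k) (step s (Some \<beta>'))) \<omega> =
        G k c \<omega> + impulse_value k c \<beta>' \<omega>"
    proof (rule AE_finite_allI[OF U(1)])
      fix \<beta>'
      show "AE \<omega> in M. reward k s (Some \<beta>') \<omega> + E k (state_value (Suc k) (step s (Some \<beta>'))) \<omega> =
        G k c \<omega> + impulse_value k c \<beta>' \<omega>"
        using impulse_value_eq[of k c \<beta>'] cond_exp_execute[of k c \<beta>' "\<Delta> - 1"]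
        by eventually_elim (simp add: s 0 reward_def)
    qed
    moreover have "reward k s None \<omega> + E k (state_value (Suc k) (step s None)) \<omega> = G k c \<omega> + E k (V (Suc k) c) \<omega>" for \<omega>
      by (simp add: s 0 reward_def state_value_def)
    moreover have "state_value k s = V k c" by (simp add: s 0 state_value_def)
    ultimately have *: "AE \<omega> in M. (\<forall>a\<in>actions. reward k s a \<omega> + E k (state_value (Suc k) (step s a)) \<omega> =
        G k c \<omega> + (case a of None \<Rightarrow> E k (V (Suc k) c) \<omega> | Some \<beta>' \<Rightarrow> impulse_value k c \<beta>' \<omega>)) \<and>
        state_value k s \<omega> = G k c \<omega> + max (obstacle V k c \<omega>) (E k (V (Suc k) c) \<omega>)"
      using V(2)[of k c] by (auto simp: actions_def)
    then have "?le"
    proof eventually_elim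
      case (elim \<omega>)
      have "(case a of None \<Rightarrow> E k (V (Suc k) c) \<omega> | Some \<beta>' \<Rightarrow> impulse_value k c \<beta>' \<omega>) \<le>
          max (obstacle V k c \<omega>) (E k (V (Suc k) c) \<omega>)" if "a \<in> actions" for a
        using that impulse_value_le[of _ k c \<omega>] by (auto simp: actions_def le_max_iff_disj)
      with elim show ?case by simp
    qed
    moreover from * have "?eq"
    proof eventually_elim
      case (elim \<omega>)
      have "(case feedback k s \<omega> of None \<Rightarrow> E k (V (Suc k) c) \<omega> | Some \<beta>' \<Rightarrow> impulse_value k c \<beta>' \<omega>) =
          max (obstacle V k c \<omega>) (E k (V (Suc k) c) \<omega>)"
        using best_impulse(2)[of k c \<omega>] by (auto simp: feedback_def s 0)
      with elim feedback_in_actions[of k s \<omega>] show ?case by simp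
    qed
    ultimately show ?thesis ..
  qed
  then show ?le ?eq by blast+
qed

text \<open>The gains collected during a delay are part of a geometric series, so the bound does not
  depend on the number of steps left.\<close>

lemma state_value_bound:
  obtains C where "\<And>k s. AE \<omega> in M. \<bar>state_value k s \<omega>\<bar> \<le> C * q ^ k"
proof -
  obtain C where C: "0 \<le> C" "\<And>k c. AE \<omega> in M. \<bar>V k c \<omega>\<bar> \<le> C * q ^ k"
    by (rule decaying_bound[OF V(1)]) auto
  have "AE \<omega> in M. \<bar>state_value k s \<omega>\<bar> \<le> (K / (1 - q) + C) * q ^ k" for k s
  proof -
    obtain c \<beta> r where s: "s = (c, \<beta>, r)" by (cases s)
    have CK: "C * q ^ (k + r) \<le> C * q ^ k" for r
      using C(1) q by (intro mult_left_mono power_decreasing) auto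
    have K: "0 \<le> K / (1 - q) * q ^ k" using K_nonneg q by simp
    have sum: "\<bar>\<Sum>l\<in>{k..<k+r}. G l c \<omega>\<bar> \<le> K / (1 - q) * q ^ k" for \<omega>
    proof -
      have "\<bar>\<Sum>l\<in>{k..<k+r}. G l c \<omega>\<bar> \<le> (\<Sum>l\<in>{k..<k+r}. K * q ^ l)"
        by (rule order_trans[OF sum_abs], rule sum_mono, rule G_bound)
      also have "\<dots> = K / (1 - q) * (q ^ k - q ^ (k + r))"
      proof (induction r)
        case (Suc r)
        have "(\<Sum>l\<in>{k..<k + Suc r}. K * q ^ l) = K / (1 - q) * (q ^ k - q ^ (k + r)) + K * q ^ (k + r)"
          using Suc by simp
        also have "\<dots> = K / (1 - q) * (q ^ k - q ^ (k + Suc r))" using q by (simp add: field_simps)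
        finally show ?case .
      qed simp
      also have "\<dots> \<le> K / (1 - q) * q ^ k"
        using q K_nonneg by (intro mult_left_mono) auto
      finally show ?thesis .
    qed
    have "AE \<omega> in M. \<bar>pending r k c \<beta> \<omega>\<bar> \<le> (K / (1 - q) + C) * q ^ k"
      unfolding pending_def
    proof (rule cond_exp_bound[OF borel_measurable_integrable[OF pending_integrand(2)]])
      show "AE \<omega> in M. \<bar>(\<Sum>l\<in>{k..<k+r}. G l c \<omega>) + V (k + r) (c + \<beta>) \<omega>\<bar> \<le> (K / (1 - q) + C) * q ^ k"
        using C(2)[of "k + r" "c + \<beta>"]
      proof eventually_elim
        case (elim \<omega>)
        with sum[of \<omega>] CK[of r] show ?case unfolding distrib_right by linarith
      qed
    qed
    moreover have "AE \<omega> in M. \<bar>V k c \<omega>\<bar> \<le> (K / (1 - q) + C) * q ^ k"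
      using C(2)[of k c] by eventually_elim (use K in \<open>simp add: distrib_right\<close>)
    ultimately show ?thesis by (simp add: s state_value_def)
  qed
  then show thesis by (rule that)
qed

text \<open>The expected value of the state at time \<open>n\<close> is of order
  \<open>q ^ n\<close>, so adding it leaves the limit of the partial sums unchanged. With it, the
  sequence is nonincreasing for admissible controls and constant under feedback.\<close>

lemma total_reward_limit:
  assumes \<alpha>: "control \<alpha>"
  shows "(\<lambda>n. (\<Sum>k<n. \<integral>\<omega>. reward k (state \<alpha> k \<omega>) (\<alpha> k \<omega>) \<omega> \<partial>M) +
    (\<integral>\<omega>. state_value n (state \<alpha> n \<omega>) \<omega> \<partial>M)) \<longlonglongrightarrow> total_reward \<alpha>"
proof -
  obtain C where C: "\<And>k s. AE \<omega> in M. \<bar>state_value k s \<omega>\<bar> \<le> C * q ^ k"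
    by (rule state_value_bound) blast
  have "\<bar>\<integral>\<omega>. state_value n (state \<alpha> n \<omega>) \<omega> \<partial>M\<bar> \<le> C * q ^ n" for n
  proof -
    have int: "integrable M (\<lambda>\<omega>. state_value n (state \<alpha> n \<omega>) \<omega>)"
      by (rule select_state_action(1)[OF \<alpha>, where f="\<lambda>s a. state_value n s"]) (rule state_value_integrable)
    \<comment> \<open>A bound for each fixed state becomes a bound at the random state, because one
      null set serves the whole finite set \<open>reachable n\<close>.\<close>
    have "AE \<omega> in M. \<forall>s\<in>reachable n. \<bar>state_value n s \<omega>\<bar> \<le> C * q ^ n"
      using C by (intro AE_finite_allI finite_reachable)
    then have "AE \<omega> in M. \<bar>state_value n (state \<alpha> n \<omega>) \<omega>\<bar> \<le> C * q ^ n"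
      using AE_space by eventually_elim (use state_reachable[OF \<alpha>] in blast)
    then have "(\<integral>\<omega>. \<bar>state_value n (state \<alpha> n \<omega>) \<omega>\<bar> \<partial>M) \<le> (\<integral>\<omega>. C * q ^ n \<partial>M)"
      using int by (intro integral_mono_AE) auto
    also have "\<dots> = C * q ^ n" by (simp add: prob_space)
    finally show ?thesis
      by (rule order_trans[OF integral_abs_bound])
  qed
  moreover have "(\<lambda>n. C * q ^ n) \<longlonglongrightarrow> 0"
    using q by (intro tendsto_mult_right_zero LIMSEQ_power_zero) auto
  ultimately have "(\<lambda>n. \<integral>\<omega>. state_value n (state \<alpha> n \<omega>) \<omega> \<partial>M) \<longlonglongrightarrow> 0"
    unfolding real_norm_def[symmetric] by (rule Lim_null_comparison[OF always_eventually[OF allI]])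
  from tendsto_add[OF total_reward_sums[OF \<alpha>, unfolded sums_def] this] show ?thesis by simp
qed

lemma value_step:
  assumes \<alpha>: "control \<alpha>" and adm: "AE \<omega> in M. admissible (state \<alpha> k \<omega>) (\<alpha> k \<omega>)"
  shows "(\<integral>\<omega>. reward k (state \<alpha> k \<omega>) (\<alpha> k \<omega>) \<omega> \<partial>M) + (\<integral>\<omega>. state_value (Suc k) (state \<alpha> (Suc k) \<omega>) \<omega> \<partial>M)
      \<le> (\<integral>\<omega>. state_value k (state \<alpha> k \<omega>) \<omega> \<partial>M)" (is ?le)
    and "(\<And>\<omega>. \<omega> \<in> space M \<Longrightarrow> \<alpha> k \<omega> = feedback k (state \<alpha> k \<omega>) \<omega>) \<Longrightarrow>
      (\<integral>\<omega>. reward k (state \<alpha> k \<omega>) (\<alpha> k \<omega>) \<omega> \<partial>M) + (\<integral>\<omega>. state_value (Suc k) (state \<alpha> (Suc k) \<omega>) \<omega> \<partial>M)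
      = (\<integral>\<omega>. state_value k (state \<alpha> k \<omega>) \<omega> \<partial>M)"
proof -
  let ?f = "\<lambda>\<omega>. reward k (state \<alpha> k \<omega>) (\<alpha> k \<omega>) \<omega> + E k (state_value (Suc k) (step (state \<alpha> k \<omega>) (\<alpha> k \<omega>))) \<omega>"
  have int_reward: "integrable M (\<lambda>\<omega>. reward k (state \<alpha> k \<omega>) (\<alpha> k \<omega>) \<omega>)"
    by (rule select_state_action(1)[OF \<alpha> reward_integrable])
  have int_value: "integrable M (\<lambda>\<omega>. state_value k (state \<alpha> k \<omega>) \<omega>)"
    by (rule select_state_action(1)[OF \<alpha>, where f="\<lambda>s a. state_value k s"]) (rule state_value_integrable)
  note select = select_state_action[OF \<alpha>, where f="\<lambda>s a. state_value (Suc k) (step s a)" and k=k,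
      OF state_value_integrable]
  have int_f: "integrable M ?f" using int_reward select(2) by simp
  have "(\<integral>\<omega>. ?f \<omega> \<partial>M) = (\<integral>\<omega>. reward k (state \<alpha> k \<omega>) (\<alpha> k \<omega>) \<omega> \<partial>M) +
      (\<integral>\<omega>. E k (state_value (Suc k) (step (state \<alpha> k \<omega>) (\<alpha> k \<omega>))) \<omega> \<partial>M)"
    using int_reward select(2) by (rule Bochner_Integration.integral_add)
  then have eq: "(\<integral>\<omega>. reward k (state \<alpha> k \<omega>) (\<alpha> k \<omega>) \<omega> \<partial>M) +
      (\<integral>\<omega>. state_value (Suc k) (state \<alpha> (Suc k) \<omega>) \<omega> \<partial>M) = (\<integral>\<omega>. ?f \<omega> \<partial>M)"
    using select(3) by simp
  have "AE \<omega> in M. \<forall>s\<in>reachable k. \<forall>a\<in>actions. admissible s a \<longrightarrow>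
      reward k s a \<omega> + E k (state_value (Suc k) (step s a)) \<omega> \<le> state_value k s \<omega>"
    by (intro AE_finite_allI finite_reachable bellman_step(1))
  then have "AE \<omega> in M. ?f \<omega> \<le> state_value k (state \<alpha> k \<omega>) \<omega>"
    using adm AE_space
  proof eventually_elim
    case (elim \<omega>)
    have "\<alpha> k \<omega> \<in> actions" using \<alpha> elim(3) by (simp add: control_def)
    with elim(1,2) state_reachable[OF \<alpha> elim(3), of k] show ?case by blast
  qed
  then show ?le unfolding eq by (rule integral_mono_AE[OF int_f int_value])
  assume fb: "\<And>\<omega>. \<omega> \<in> space M \<Longrightarrow> \<alpha> k \<omega> = feedback k (state \<alpha> k \<omega>) \<omega>"
  have "AE \<omega> in M. \<forall>s\<in>reachable k. reward k s (feedback k s \<omega>) \<omega> +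
      E k (state_value (Suc k) (step s (feedback k s \<omega>))) \<omega> = state_value k s \<omega>"
    by (intro AE_finite_allI finite_reachable bellman_step(2))
  then have "AE \<omega> in M. ?f \<omega> = state_value k (state \<alpha> k \<omega>) \<omega>"
    using AE_space
  proof eventually_elim
    case (elim \<omega>)
    from elim(1) state_reachable[OF \<alpha> elim(2), of k] show ?case unfolding fb[OF elim(2)] by blast
  qed
  then show "(\<integral>\<omega>. reward k (state \<alpha> k \<omega>) (\<alpha> k \<omega>) \<omega> \<partial>M) + (\<integral>\<omega>. state_value (Suc k) (state \<alpha> (Suc k) \<omega>) \<omega> \<partial>M)
      = (\<integral>\<omega>. state_value k (state \<alpha> k \<omega>) \<omega> \<partial>M)"
    unfolding eq using int_f int_value by (intro integral_cong_AE) auto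
qed

lemma verification:
  assumes \<alpha>: "control \<alpha>" and adm: "\<And>k. AE \<omega> in M. admissible (state \<alpha> k \<omega>) (\<alpha> k \<omega>)"
  shows "total_reward \<alpha> \<le> (\<integral>\<omega>. V 0 0 \<omega> \<partial>M)"
    and "(\<And>k \<omega>. \<omega> \<in> space M \<Longrightarrow> \<alpha> k \<omega> = feedback k (state \<alpha> k \<omega>) \<omega>) \<Longrightarrow>
      total_reward \<alpha> = (\<integral>\<omega>. V 0 0 \<omega> \<partial>M)"
proof -
  let ?W = "\<lambda>n. (\<Sum>k<n. \<integral>\<omega>. reward k (state \<alpha> k \<omega>) (\<alpha> k \<omega>) \<omega> \<partial>M) +
    (\<integral>\<omega>. state_value n (state \<alpha> n \<omega>) \<omega> \<partial>M)"
  have W0: "?W 0 = (\<integral>\<omega>. V 0 0 \<omega> \<partial>M)" by (simp add: state_value_def)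
  have "?W n \<le> ?W 0" for n
  proof (induction n)
    case (Suc n)
    with value_step(1)[OF \<alpha> adm, of n] show ?case unfolding sum.lessThan_Suc by linarith
  qed simp
  then show "total_reward \<alpha> \<le> (\<integral>\<omega>. V 0 0 \<omega> \<partial>M)"
    unfolding W0 by (intro LIMSEQ_le_const2[OF total_reward_limit[OF \<alpha>]]) blast
  assume fb: "\<And>k \<omega>. \<omega> \<in> space M \<Longrightarrow> \<alpha> k \<omega> = feedback k (state \<alpha> k \<omega>) \<omega>"
  have "?W n = (\<integral>\<omega>. V 0 0 \<omega> \<partial>M)" for n
  proof (induction n)
    case 0
    show ?case by (rule W0)
  next
    case (Suc n)
    with value_step(2)[OF \<alpha> adm fb, of n] show ?case unfolding sum.lessThan_Suc by linarith
  qed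
  then have "?W \<longlonglongrightarrow> (\<integral>\<omega>. V 0 0 \<omega> \<partial>M)" by (simp only: tendsto_const)
  with total_reward_limit[OF \<alpha>] show "total_reward \<alpha> = (\<integral>\<omega>. V 0 0 \<omega> \<partial>M)"
    by (rule LIMSEQ_unique)
qed

end

end

section \<open>Strategies and controls\<close>

text \<open>The impulse ordered at time \<open>k\<close>; the least index is only a choice on the null set where
  two impulse times coincide.\<close>

definition act :: "(nat \<Rightarrow> 'a \<Rightarrow> enat) \<Rightarrow> (nat \<Rightarrow> 'a \<Rightarrow> 'b) \<Rightarrow> nat \<Rightarrow> 'a \<Rightarrow> 'b option" where
  "act \<tau> \<zeta> k \<omega> = (if \<exists>p. \<tau> p \<omega> = enat k then Some (\<zeta> (LEAST p. \<tau> p \<omega> = enat k) \<omega>) else None)"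

context impulse_control
begin

lemma delayed_mono:
  assumes t: "\<And>p. t p + enat \<Delta> \<le> t (Suc p)" and "p < p'"
  shows "t p + enat \<Delta> \<le> t p'"
  using \<open>p < p'\<close>
proof (induction rule: less_Suc_induct)
  case (2 i j k)
  have "t j \<le> t j + enat \<Delta>" by simp
  with 2 show ?case by (meson order_trans)
qed (rule t)

lemma delayed_inj:
  assumes t: "\<And>p. t p + enat \<Delta> \<le> t (Suc p)" and "t p = enat k" "t p' = enat k"
  shows "p = p'"
proof (rule ccontr)
  assume "p \<noteq> p'"
  then consider "p < p'" | "p' < p" by linarith
  then show False
    using delayed_mono[of t, OF t, of p p'] delayed_mono[of t, OF t, of p' p] assms(2,3) \<Delta> by cases auto
qed

text \<open>Every gap is at least \<Delta>, hence at least 1. This makes the cost series over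
  impulse numbers converge geometrically and excludes infinitely many impulses before a given
  time.\<close>

lemma delayed_ge:
  assumes t: "\<And>p. t p + enat \<Delta> \<le> t (Suc p)"
  shows "enat p \<le> t p"
proof (induction p)
  case (Suc p)
  have "enat (Suc p) = enat p + enat 1" by simp
  also have "\<dots> \<le> t p + enat \<Delta>" using Suc \<Delta> by (intro add_mono) auto
  also have "\<dots> \<le> t (Suc p)" by (rule t)
  finally show ?case .
qed (simp add: enat_0)

lemma act_eq:
  assumes "\<And>p. \<tau> p \<omega> + enat \<Delta> \<le> \<tau> (Suc p) \<omega>" "\<tau> n \<omega> = enat k"
  shows "act \<tau> \<zeta> k \<omega> = Some (\<zeta> n \<omega>)"
proof -
  have "(LEAST p. \<tau> p \<omega> = enat k) = n"
  proof (rule Least_equality[where P="\<lambda>p. \<tau> p \<omega> = enat k", OF assms(2)])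
    fix p assume "\<tau> p \<omega> = enat k"
    then show "n \<le> p" using delayed_inj[of "\<lambda>p. \<tau> p \<omega>", OF assms(1,2)] by simp
  qed
  then show ?thesis using assms(2) by (auto simp: act_def)
qed

lemma act_None:
  assumes "\<And>p. \<tau> p \<omega> \<noteq> enat k"
  shows "act \<tau> \<zeta> k \<omega> = None"
  using assms by (simp add: act_def)

text \<open>At time \<open>k\<close> the first \<open>n\<close> impulses are executed; impulse number \<open>n\<close> is either not yet ordered
  or ordered and still delayed.\<close>

definition phase :: "(nat \<Rightarrow> 'a \<Rightarrow> enat) \<Rightarrow> (nat \<Rightarrow> 'a \<Rightarrow> 'b) \<Rightarrow> 'a \<Rightarrow> nat \<Rightarrow> nat \<Rightarrow> bool" where
  "phase \<tau> \<zeta> \<omega> k n \<longleftrightarrow> (\<forall>p<n. \<tau> p \<omega> + enat \<Delta> \<le> enat k) \<and>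
     (enat k \<le> \<tau> n \<omega> \<and> state (act \<tau> \<zeta>) k \<omega> = ((\<Sum>j<n. \<zeta> j \<omega>), 0, 0) \<or>
      (\<exists>m r. \<tau> n \<omega> = enat m \<and> m < k \<and> m + \<Delta> = k + Suc r \<and>
        state (act \<tau> \<zeta>) k \<omega> = ((\<Sum>j<n. \<zeta> j \<omega>), \<zeta> n \<omega>, Suc r)))"

text \<open>Impulse \<open>n\<close> is awaited, ordered and then pending; at its execution the
  spacing of the times puts the path into the waiting part of phase \<open>n + 1\<close>.
  Admissibility comes along, since another order during the delay of impulse \<open>n\<close> would
  violate the spacing.\<close>

lemma phase_exists:
  assumes \<tau>: "\<And>p. \<tau> p \<omega> + enat \<Delta> \<le> \<tau> (Suc p) \<omega>"
  shows "(\<exists>n. phase \<tau> \<zeta> \<omega> k n) \<and> admissible (state (act \<tau> \<zeta>) k \<omega>) (act \<tau> \<zeta> k \<omega>)"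
proof -
  note mono = delayed_mono[of "\<lambda>p. \<tau> p \<omega>", OF \<tau>]
  have less: "\<tau> p \<omega> < enat k" if "\<tau> p \<omega> + enat \<Delta> \<le> enat k" for p k
    using that \<Delta> by (cases "\<tau> p \<omega>") auto
  have wait_None: "act \<tau> \<zeta> k \<omega> = None"
    if before: "\<forall>p<n. \<tau> p \<omega> + enat \<Delta> \<le> enat k" and m: "\<tau> n \<omega> = enat m" "m < k" "k < m + \<Delta>" for n k m
  proof (rule act_None)
    fix p
    consider "p < n" | "p = n" | "n < p" by linarith
    then show "\<tau> p \<omega> \<noteq> enat k"
    proof cases
      case 1
      with before less[of p k] show ?thesis by auto
    next
      case 3
      with mono[of n p] m show ?thesis by (cases "\<tau> p \<omega>") auto
    qed (use m in auto)
  qed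
  have ex: "\<exists>n. phase \<tau> \<zeta> \<omega> k n" for k
  proof (induction k)
    case 0
    show ?case by (rule exI[of _ 0]) (simp add: phase_def enat_0)
  next
    case (Suc k)
    then obtain n where before: "\<forall>p<n. \<tau> p \<omega> + enat \<Delta> \<le> enat k" and
      cases: "enat k \<le> \<tau> n \<omega> \<and> state (act \<tau> \<zeta>) k \<omega> = ((\<Sum>j<n. \<zeta> j \<omega>), 0, 0) \<or>
      (\<exists>m r. \<tau> n \<omega> = enat m \<and> m < k \<and> m + \<Delta> = k + Suc r \<and>
        state (act \<tau> \<zeta>) k \<omega> = ((\<Sum>j<n. \<zeta> j \<omega>), \<zeta> n \<omega>, Suc r))"
      by (auto simp: phase_def)
    have before': "\<forall>p<n. \<tau> p \<omega> + enat \<Delta> \<le> enat (Suc k)"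
      using before by (auto intro: order_trans)
    \<comment> \<open>Covers an order placed at \<open>k\<close> (then \<open>m = k\<close> and
      \<open>r = \<Delta> - 1\<close>) and one already pending. \<open>r = 0\<close> means execution
      at \<open>Suc k\<close> and passage to \<open>Suc n\<close>; otherwise \<open>n\<close>
      stays.\<close>
    have next_phase: "\<exists>n. phase \<tau> \<zeta> \<omega> (Suc k) n"
      if m: "\<tau> n \<omega> = enat m" "m < Suc k" "m + \<Delta> = Suc k + r"
        and state: "state (act \<tau> \<zeta>) (Suc k) \<omega> = execute ((\<Sum>j<n. \<zeta> j \<omega>), \<zeta> n \<omega>, r)" for m r
    proof (cases r)
      case 0
      have "enat (Suc k) = \<tau> n \<omega> + enat \<Delta>" using m 0 by simp
      with \<tau>[of n] before' have "phase \<tau> \<zeta> \<omega> (Suc k) (Suc n)"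
        using state 0 by (auto simp: phase_def less_Suc_eq)
      then show ?thesis ..
    next
      case (Suc r')
      have "phase \<tau> \<zeta> \<omega> (Suc k) n"
        unfolding phase_def
        by (intro conjI before' disjI2 exI[of _ m] exI[of _ r']) (use m state Suc in auto)
      then show ?thesis ..
    qed
    from cases show ?case
    proof (elim disjE exE conjE)
      assume k: "enat k \<le> \<tau> n \<omega>" and state: "state (act \<tau> \<zeta>) k \<omega> = ((\<Sum>j<n. \<zeta> j \<omega>), 0, 0)"
      show ?thesis
      proof (cases "\<tau> n \<omega> = enat k")
        case True
        show ?thesis
          by (rule next_phase[of k "\<Delta> - 1"]) (use True \<Delta> state act_eq[of \<tau> \<omega> n k \<zeta>, OF \<tau> True] in auto)
      next
        case False
        with k have k': "enat k < \<tau> n \<omega>" by simp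
        have "act \<tau> \<zeta> k \<omega> = None"
        proof (rule act_None)
          fix p
          consider "p < n" | "p = n" | "n < p" by linarith
          then show "\<tau> p \<omega> \<noteq> enat k"
          proof cases
            case 1
            with before less[of p k] show ?thesis by auto
          next
            case 3
            have "\<tau> n \<omega> \<le> \<tau> p \<omega>" by (rule order_trans[OF _ mono[OF 3]]) simp
            with k' show ?thesis by auto
          qed (use k' in auto)
        qed
        with state k' before' have "phase \<tau> \<zeta> \<omega> (Suc k) n" by (auto simp: phase_def Suc_ile_eq)
        then show ?thesis ..
      qed
    next
      fix m r
      assume m: "\<tau> n \<omega> = enat m" "m < k" "m + \<Delta> = k + Suc r"
        and state: "state (act \<tau> \<zeta>) k \<omega> = ((\<Sum>j<n. \<zeta> j \<omega>), \<zeta> n \<omega>, Suc r)"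
      have "act \<tau> \<zeta> k \<omega> = None" by (rule wait_None[OF before m(1,2)]) (use m in simp)
      with state show ?thesis by (intro next_phase[of m r]) (use m in auto)
    qed
  qed
  moreover have "admissible (state (act \<tau> \<zeta>) k \<omega>) (act \<tau> \<zeta> k \<omega>)"
  proof -
    from ex[of k] obtain n where n: "phase \<tau> \<zeta> \<omega> k n" ..
    show ?thesis
    proof (cases "snd (snd (state (act \<tau> \<zeta>) k \<omega>)) = 0")
      case False
      with n obtain m r where "\<tau> n \<omega> = enat m" "m < k" "m + \<Delta> = k + Suc r" "\<forall>p<n. \<tau> p \<omega> + enat \<Delta> \<le> enat k"
        by (auto simp: phase_def)
      then have "act \<tau> \<zeta> k \<omega> = None" by (intro wait_None[of n k m]) auto
      then show ?thesis by (simp add: admissible_def)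
    qed (simp add: admissible_def)
  qed
  ultimately show ?thesis by blast
qed

text \<open>In phase \<open>n\<close> only the term of the last executed impulse, number
  \<open>n - 1\<close>, survives in the series; for \<open>n = 0\<close> only the uncontrolled term
  does.\<close>

lemma controlled_eq:
  assumes \<tau>: "\<And>p. \<tau> p \<omega> + enat \<Delta> \<le> \<tau> (Suc p) \<omega>"
  shows "controlled \<Delta> X (\<tau>, \<zeta>) k \<omega> = X k \<omega> + fst (state (act \<tau> \<zeta>) k \<omega>)"
proof -
  from phase_exists[of \<tau> \<omega>, OF \<tau>] obtain n where n: "phase \<tau> \<zeta> \<omega> k n" by blast
  then have before: "\<forall>p<n. \<tau> p \<omega> + enat \<Delta> \<le> enat k" and after: "enat k < \<tau> n \<omega> + enat \<Delta>"
    and fst: "fst (state (act \<tau> \<zeta>) k \<omega>) = (\<Sum>j<n. \<zeta> j \<omega>)"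
    using \<Delta> by (cases "\<tau> n \<omega>"; auto simp: phase_def)+
  have after': "enat k < \<tau> l \<omega> + enat \<Delta>" if "n \<le> l" for l
  proof (cases "l = n")
    case False
    with that have "\<tau> n \<omega> + enat \<Delta> \<le> \<tau> l \<omega>"
      using delayed_mono[of "\<lambda>p. \<tau> p \<omega>", OF \<tau>, of n l] by simp
    with after have "enat k < \<tau> l \<omega>" by (rule less_le_trans)
    also have "\<dots> \<le> \<tau> l \<omega> + enat \<Delta>" by simp
    finally show ?thesis .
  qed (use after in simp)
  let ?term = "\<lambda>l. of_bool (\<tau> l \<omega> + enat \<Delta> \<le> enat k \<and> enat k < \<tau> (Suc l) \<omega> + enat \<Delta>) *\<^sub>R
      (X k \<omega> + (\<Sum>j\<le>l. \<zeta> j \<omega>))"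
  have zero: "?term l = 0" if "Suc l \<noteq> n" for l
  proof (cases "Suc l < n")
    case True
    then have "\<not> enat k < \<tau> (Suc l) \<omega> + enat \<Delta>" using before by (simp add: not_less)
    then show ?thesis by simp
  next
    case False
    with that have "n \<le> l" by simp
    from after'[OF this] have "\<not> \<tau> l \<omega> + enat \<Delta> \<le> enat k" by (simp add: not_le)
    then show ?thesis by simp
  qed
  show ?thesis
  proof (cases n)
    case 0
    then have "?term l = 0" for l using zero by simp
    then have "(\<Sum>l. ?term l) = 0" by (simp only: suminf_zero)
    with 0 after fst show ?thesis by (simp add: controlled_def)
  next
    case (Suc n')
    have "(\<Sum>l. ?term l) = (\<Sum>l\<in>{n'}. ?term l)"
      by (rule suminf_finite) (use zero Suc in auto)
    moreover have "?term n' = X k \<omega> + (\<Sum>j\<le>n'. \<zeta> j \<omega>)" using before after Suc by simp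
    moreover have "\<not> enat k < \<tau> 0 \<omega> + enat \<Delta>" using before Suc by auto
    ultimately show ?thesis using fst Suc by (simp add: controlled_def lessThan_Suc_atMost)
  qed
qed

lemma discount_enat: "discount \<theta> (enat k) = q ^ k"
  by (simp add: discount_def exp_discount[symmetric])

text \<open>The running gains agree by \<open>controlled_eq\<close>. The costs are the same numbers,
  listed by order time on the left and by impulse number on the right, infinite times contributing
  zero.\<close>

lemma path_reward_eq:
  assumes \<tau>: "\<And>p. \<tau> p \<omega> + enat \<Delta> \<le> \<tau> (Suc p) \<omega>" and \<zeta>: "\<And>p. \<zeta> p \<omega> \<in> U"
  shows "(\<Sum>k. reward k (state (act \<tau> \<zeta>) k \<omega>) (act \<tau> \<zeta> k \<omega>) \<omega>) =
    (\<Sum>k. exp (- \<theta> * real k) * g (controlled \<Delta> X (\<tau>, \<zeta>) k \<omega>)) -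
    (\<Sum>l. discount \<theta> (\<tau> l \<omega> + enat \<Delta>) * \<Psi> (\<zeta> l \<omega>))"
proof -
  define f where "f k = (case act \<tau> \<zeta> k \<omega> of None \<Rightarrow> 0 | Some \<beta> \<Rightarrow> q ^ (k + \<Delta>) * \<Psi> \<beta>)" for k
  define h where "h l = discount \<theta> (\<tau> l \<omega> + enat \<Delta>) * \<Psi> (\<zeta> l \<omega>)" for l
  define B where "B = {l. \<tau> l \<omega> \<noteq> \<infinity>}"
  define T where "T l = the_enat (\<tau> l \<omega>)" for l
  have T: "\<tau> l \<omega> = enat (T l)" if "l \<in> B" for l using that by (auto simp: B_def T_def)
  have fT: "f (T l) = h l" if "l \<in> B" for l
    using act_eq[of \<tau> \<omega> l "T l" \<zeta>, OF \<tau> T[OF that]] by (simp add: f_def h_def T[OF that] discount_enat)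
  have Psi_bound: "\<bar>q ^ (k + \<Delta>) * \<Psi> \<beta>\<bar> \<le> L * q ^ k" if "\<beta> \<in> U" for k \<beta>
  proof -
    have "\<bar>q ^ (k + \<Delta>) * \<Psi> \<beta>\<bar> \<le> q ^ (k + \<Delta>) * L"
      using q \<Psi>[OF that] by (simp add: abs_mult mult_left_mono)
    also have "\<dots> \<le> q ^ k * L" using q L_nonneg by (intro mult_right_mono power_decreasing) auto
    finally show ?thesis by (simp add: mult.commute)
  qed
  have f_bound: "\<bar>f k\<bar> \<le> L * q ^ k" for k
    using Psi_bound \<zeta> q L_nonneg by (auto simp: f_def act_def)
  \<comment> \<open>The impulse numbered \<open>l\<close> is discounted at least by
    \<open>q ^ l\<close>, because its time is at least \<open>l\<close>.\<close>
  have h_bound: "\<bar>h l\<bar> \<le> L * q ^ l" for l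
  proof (cases "\<tau> l \<omega>")
    case (enat k)
    have "l \<le> k" using delayed_ge[of "\<lambda>p. \<tau> p \<omega>", OF \<tau>, of l] enat by simp
    then have "L * q ^ k \<le> L * q ^ l" using q L_nonneg by (intro mult_left_mono power_decreasing) auto
    with Psi_bound[OF \<zeta>[of l], of k] enat show ?thesis by (simp add: h_def discount_enat)
  qed (use q L_nonneg in \<open>simp add: h_def discount_def\<close>)
  have fh: "suminf f = suminf h"
  proof (rule suminf_reindex_partial[where T=T and B=B])
    show "inj_on T B"
      by (rule inj_onI) (metis T delayed_inj[of "\<lambda>p. \<tau> p \<omega>", OF \<tau>])
    show "f k = 0" if "k \<notin> T ` B" for k
    proof -
      have "\<tau> p \<omega> \<noteq> enat k" for p
      proof
        assume "\<tau> p \<omega> = enat k"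
        then have "p \<in> B" "k = T p" by (auto simp: B_def T_def)
        with that show False by blast
      qed
      then show ?thesis by (simp add: f_def act_None)
    qed
    show "h l = 0" if "l \<notin> B" for l using that by (simp add: h_def B_def discount_def)
    show "summable (\<lambda>k. \<bar>f k\<bar>)" "summable (\<lambda>l. \<bar>h l\<bar>)"
      using f_bound h_bound by (auto intro!: summable_abs_le_geometric[OF _ q, where B=L])
  qed (rule fT)
  have sG: "summable (\<lambda>k. G k (fst (state (act \<tau> \<zeta>) k \<omega>)) \<omega>)"
    by (rule summable_abs_le_geometric[OF G_bound q])
  have sf: "summable f" by (rule summable_abs_le_geometric[OF f_bound q])
  have "(\<Sum>k. reward k (state (act \<tau> \<zeta>) k \<omega>) (act \<tau> \<zeta> k \<omega>) \<omega>) =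
      (\<Sum>k. G k (fst (state (act \<tau> \<zeta>) k \<omega>)) \<omega>) - suminf h"
    unfolding reward_def f_def[symmetric] suminf_diff[OF sG sf, symmetric] fh ..
  then show ?thesis
    by (simp add: h_def[abs_def] G_def exp_discount[simplified] controlled_eq[of \<tau> \<omega>, OF \<tau>])
qed

context
  fixes \<tau> :: "nat \<Rightarrow> 'a \<Rightarrow> enat" and \<zeta> :: "nat \<Rightarrow> 'a \<Rightarrow> 'b"
  assumes strategy: "(\<tau>, \<zeta>) \<in> strategies M F \<Delta> U"
begin

lemma strategyD:
  shows "stopping_time (filt_ext F) (\<tau> p)" "AE \<omega> in M. \<tau> p \<omega> + enat \<Delta> \<le> \<tau> (Suc p) \<omega>"
    "\<zeta> p \<in> borel_measurable (filtration.pre_sigma (space M) (filt_ext F) (\<tau> p))"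
    "\<omega> \<in> space M \<Longrightarrow> \<zeta> p \<omega> \<in> U"
  using strategy by (auto simp: strategies_def)

lemma impulse_events:
  shows "{\<omega>\<in>space M. \<zeta> p \<omega> = \<beta> \<and> \<tau> p \<omega> \<le> t} \<in> sets (filt_ext F t)"
    and "{\<omega>\<in>space M. \<zeta> p \<omega> = \<beta> \<and> \<tau> p \<omega> = enat k} \<in> sets (F k)"
    and "{\<omega>\<in>space M. \<zeta> p \<omega> = \<beta>} \<in> sets M"
proof -
  interpret ext: filtration "space M" "filt_ext F" by (rule filtration_filt_ext)
  have "{\<omega>\<in>space M. \<zeta> p \<omega> = \<beta>} = \<zeta> p -` {\<beta>} \<inter> space (ext.pre_sigma (\<tau> p))"
    by (auto simp: ext.space_pre_sigma)
  also have "\<dots> \<in> sets (ext.pre_sigma (\<tau> p))"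
    by (rule measurable_sets[OF strategyD(3)]) simp
  finally have *: "{\<omega>\<in>space M. \<zeta> p \<omega> = \<beta>} \<in> sets (ext.pre_sigma (\<tau> p))" .
  show le: "{\<omega>\<in>space M. \<zeta> p \<omega> = \<beta> \<and> \<tau> p \<omega> \<le> t} \<in> sets (filt_ext F t)" for t
    using ext.sets_pre_sigmaD[OF strategyD(1) *, of t] by (simp add: conj_ac)
  show "{\<omega>\<in>space M. \<zeta> p \<omega> = \<beta>} \<in> sets M"
    using sets_filt_ext_M[OF le[of \<infinity>]] by simp
  have "{\<omega>\<in>space M. \<zeta> p \<omega> = \<beta> \<and> \<tau> p \<omega> = enat k} =
      {\<omega>\<in>space M. \<zeta> p \<omega> = \<beta> \<and> \<tau> p \<omega> \<le> enat k} \<inter> {\<omega>\<in>space (F k). \<tau> p \<omega> = enat k}"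
    by (auto simp: space_F)
  also have "\<dots> \<in> sets (F k)"
    using le[of "enat k"] stopping_time_events(2)[OF strategyD(1), of k k]
    by (intro sets.Int) (auto simp: pred_def)
  finally show "{\<omega>\<in>space M. \<zeta> p \<omega> = \<beta> \<and> \<tau> p \<omega> = enat k} \<in> sets (F k)" .
qed

lemma time_events: "{\<omega>\<in>space M. \<tau> p \<omega> = enat k} \<in> sets (F k)"
  using stopping_time_events(2)[OF strategyD(1), of k k] by (simp add: pred_def space_F)

text \<open>The least index with time \<open>k\<close> is isolated by removing the events where an
  earlier index has the same time; all of these events lie in \<open>F k\<close>.\<close>

lemma control_act: "control (act \<tau> \<zeta>)"
  unfolding control_def
proof (intro allI conjI ballI)
  fix k \<omega> assume "\<omega> \<in> space M"
  then show "act \<tau> \<zeta> k \<omega> \<in> actions" using strategyD(4) by (auto simp: act_def actions_def)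
next
  fix k a
  show "{\<omega>\<in>space M. act \<tau> \<zeta> k \<omega> = a} \<in> sets (F k)"
  proof (cases a)
    case None
    then have "{\<omega>\<in>space M. act \<tau> \<zeta> k \<omega> = a} = space (F k) - (\<Union>p. {\<omega>\<in>space M. \<tau> p \<omega> = enat k})"
      by (auto simp: act_def space_F)
    also have "\<dots> \<in> sets (F k)"
      by (intro sets.Diff sets.top sets.countable_UN image_subsetI time_events)
    finally show ?thesis .
  next
    case (Some \<beta>)
    have "{\<omega>\<in>space M. act \<tau> \<zeta> k \<omega> = a} =
        (\<Union>p. {\<omega>\<in>space M. \<zeta> p \<omega> = \<beta> \<and> \<tau> p \<omega> = enat k} - (\<Union>p'\<in>{..<p}. {\<omega>\<in>space M. \<tau> p' \<omega> = enat k}))"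
      (is "?L = ?R")
    proof (intro set_eqI iffI)
      fix \<omega> assume \<omega>: "\<omega> \<in> ?L"
      then have ex: "\<exists>p. \<tau> p \<omega> = enat k" and "\<zeta> (LEAST p. \<tau> p \<omega> = enat k) \<omega> = \<beta>"
        using Some by (auto simp: act_def split: if_splits)
      with \<omega> LeastI_ex[OF ex] show "\<omega> \<in> ?R"
        by (intro UN_I[of "LEAST p. \<tau> p \<omega> = enat k"]) (auto dest: not_less_Least)
    next
      fix \<omega> assume "\<omega> \<in> ?R"
      then obtain p where p: "\<omega> \<in> space M" "\<zeta> p \<omega> = \<beta>" "\<tau> p \<omega> = enat k" "\<And>p'. p' < p \<Longrightarrow> \<tau> p' \<omega> \<noteq> enat k"
        by blast
      then have "(LEAST p. \<tau> p \<omega> = enat k) = p"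
        by (intro Least_equality) (auto simp: not_less[symmetric])
      with p Some show "\<omega> \<in> ?L" by (auto simp: act_def)
    qed
    also have "\<dots> \<in> sets (F k)"
      by (intro sets.countable_UN image_subsetI sets.Diff impulse_events sets.finite_UN time_events) auto
    finally show ?thesis .
  qed
qed

text \<open>The path identity holds only where the spacing does, that is almost surely, so both
  integrands have to be measurable for their integrals to be compared. The cost of a random impulse
  is written as a finite sum over \<open>U\<close>, the discount at a random time as a series over
  that time.\<close>

lemma payoff_eq: "payoff M \<Delta> \<theta> X g \<Psi> (\<tau>, \<zeta>) = total_reward (act \<tau> \<zeta>)"
proof -
  have [measurable]: "Measurable.pred M (\<lambda>\<omega>. \<tau> p \<omega> = enat k)" for p k
    using sets_F_M[OF time_events] by (simp add: pred_def)
  have le[measurable]: "Measurable.pred M (\<lambda>\<omega>. \<tau> p \<omega> + enat \<Delta> \<le> enat k)" for p k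
  proof -
    have "\<tau> p \<omega> + enat \<Delta> \<le> enat k \<longleftrightarrow> (\<exists>j\<in>{j. j + \<Delta> \<le> k}. \<tau> p \<omega> = enat j)" for \<omega>
      by (cases "\<tau> p \<omega>") auto
    then show ?thesis by simp
  qed
  have [measurable]: "Measurable.pred M (\<lambda>\<omega>. enat k < \<tau> p \<omega> + enat \<Delta>)" for p k
    unfolding not_le[symmetric] by measurable
  have \<zeta>[measurable]: "\<zeta> p \<in> borel_measurable M" for p
  proof (rule measurableI)
    fix A assume "A \<in> sets (borel :: 'b measure)"
    have "\<zeta> p -` A \<inter> space M = (\<Union>\<beta>\<in>U \<inter> A. {\<omega>\<in>space M. \<zeta> p \<omega> = \<beta>})"
      using strategyD(4) by auto
    also have "\<dots> \<in> sets M" using U impulse_events(3) by (intro sets.finite_UN) auto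
    finally show "\<zeta> p -` A \<inter> space M \<in> sets M" .
  qed simp
  note [measurable] = measurable_F_M[OF X] g(1)
  have [measurable]: "(\<lambda>\<omega>. discount \<theta> (\<tau> l \<omega> + enat \<Delta>)) \<in> borel_measurable M" for l
  proof -
    have "discount \<theta> (\<tau> l \<omega> + enat \<Delta>) = (\<Sum>k. q ^ (k + \<Delta>) * of_bool (\<tau> l \<omega> = enat k))" for \<omega>
    proof (cases "\<tau> l \<omega>")
      case (enat j)
      have "(\<Sum>k. q ^ (k + \<Delta>) * of_bool (\<tau> l \<omega> = enat k)) = (\<Sum>k\<in>{j}. q ^ (k + \<Delta>) * of_bool (\<tau> l \<omega> = enat k))"
        by (rule suminf_finite) (auto simp: enat)
      with enat show ?thesis by (simp add: discount_enat)
    qed (simp add: discount_def)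
    then show ?thesis by simp
  qed
  have [measurable]: "(\<lambda>\<omega>. \<Psi> (\<zeta> l \<omega>)) \<in> borel_measurable M" for l
  proof -
    have "(\<lambda>\<omega>. \<Psi> (\<zeta> l \<omega>)) \<in> borel_measurable M \<longleftrightarrow>
        (\<lambda>\<omega>. \<Sum>\<beta>\<in>U. \<Psi> \<beta> * of_bool (\<zeta> l \<omega> = \<beta>)) \<in> borel_measurable M"
    proof (rule measurable_cong)
      fix \<omega> assume "\<omega> \<in> space M"
      then have "\<zeta> l \<omega> \<in> U" by (rule strategyD(4))
      then show "\<Psi> (\<zeta> l \<omega>) = (\<Sum>\<beta>\<in>U. \<Psi> \<beta> * of_bool (\<zeta> l \<omega> = \<beta>))"
        using U by (simp add: of_bool_def if_distrib cong: if_cong)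
    qed
    moreover have "(\<lambda>\<omega>. \<Sum>\<beta>\<in>U. \<Psi> \<beta> * of_bool (\<zeta> l \<omega> = \<beta>)) \<in> borel_measurable M" by measurable
    ultimately show ?thesis by simp
  qed
  have [measurable]: "(\<lambda>\<omega>. reward k (state (act \<tau> \<zeta>) k \<omega>) (act \<tau> \<zeta> k \<omega>) \<omega>) \<in> borel_measurable M" for k
    by (rule borel_measurable_integrable, rule select_state_action(1)[OF control_act reward_integrable])
  have [measurable]: "(\<lambda>\<omega>. controlled \<Delta> X (\<tau>, \<zeta>) k \<omega>) \<in> borel_measurable M" for k
    unfolding controlled_def case_prod_conv by measurable
  have "AE \<omega> in M. \<forall>p. \<tau> p \<omega> + enat \<Delta> \<le> \<tau> (Suc p) \<omega>"
    using strategyD(2) by (simp add: AE_all_countable)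
  then have "AE \<omega> in M. (\<Sum>k. exp (- \<theta> * real k) * g (controlled \<Delta> X (\<tau>, \<zeta>) k \<omega>)) -
      (\<Sum>l. discount \<theta> (\<tau> l \<omega> + enat \<Delta>) * \<Psi> (\<zeta> l \<omega>)) =
      (\<Sum>k. reward k (state (act \<tau> \<zeta>) k \<omega>) (act \<tau> \<zeta> k \<omega>) \<omega>)"
    using AE_space by eventually_elim (rule path_reward_eq[symmetric], blast, rule strategyD(4))
  then show ?thesis
    unfolding payoff_def total_reward_def fst_conv snd_conv by (intro integral_cong_AE) measurable
qed

lemma act_admissible: "AE \<omega> in M. admissible (state (act \<tau> \<zeta>) k \<omega>) (act \<tau> \<zeta> k \<omega>)"
proof -
  have "AE \<omega> in M. \<forall>p. \<tau> p \<omega> + enat \<Delta> \<le> \<tau> (Suc p) \<omega>"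
    using strategyD(2) by (simp add: AE_all_countable)
  then show ?thesis by eventually_elim (use phase_exists in blast)
qed

end

section \<open>From controls back to strategies\<close>

lemma admissible_control_spaced:
  assumes adm: "\<And>k. admissible (state \<alpha> k \<omega>) (\<alpha> k \<omega>)"
    and "\<alpha> k \<omega> \<noteq> None" "\<alpha> j \<omega> \<noteq> None" "k < j"
  shows "k + \<Delta> \<le> j"
proof (rule ccontr)
  assume "\<not> k + \<Delta> \<le> j"
  obtain \<beta> where \<beta>: "\<alpha> k \<omega> = Some \<beta>" using assms(2) by blast
  obtain c b where s: "state \<alpha> k \<omega> = (c, b, 0)"
    using adm[of k] assms(2) by (cases "state \<alpha> k \<omega>") (auto simp: admissible_def)
  \<comment> \<open>The counter started by the order at \<open>k\<close> is still positive at time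
    \<open>k + Suc i\<close> as long as \<open>Suc i < \<Delta>\<close>, so admissibility rules out
    an action there.\<close>
  have "\<exists>c b. state \<alpha> (k + Suc i) \<omega> = (c, b, \<Delta> - Suc i)" if "Suc i < \<Delta>" for i
    using that
  proof (induction i)
    case 0
    then obtain d where "\<Delta> - 1 = Suc d" by (cases "\<Delta> - 1") auto
    with 0 s \<beta> show ?case by simp
  next
    case (Suc i)
    then obtain c b where IH: "state \<alpha> (k + Suc i) \<omega> = (c, b, \<Delta> - Suc i)" by auto
    moreover obtain d where d: "\<Delta> - Suc (Suc i) = Suc d" using Suc.prems by (cases "\<Delta> - Suc (Suc i)") auto
    then have "\<Delta> - Suc i = Suc (Suc d)" by simp
    ultimately show ?case using d by simp
  qed
  moreover have "Suc (j - Suc k) < \<Delta>" using \<open>\<not> k + \<Delta> \<le> j\<close> \<open>k < j\<close> by linarith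
  ultimately obtain c b where "state \<alpha> (k + Suc (j - Suc k)) \<omega> = (c, b, \<Delta> - Suc (j - Suc k))" by blast
  with \<open>k < j\<close> have "state \<alpha> j \<omega> = (c, b, \<Delta> - (j - k))" by (simp add: Suc_diff_Suc)
  moreover have "0 < \<Delta> - (j - k)" using \<open>\<not> k + \<Delta> \<le> j\<close> \<open>k < j\<close> by linarith
  ultimately show False using adm[of j] assms(3) by (simp add: admissible_def)
qed

primrec impulse_time :: "(nat \<Rightarrow> 'a \<Rightarrow> 'b option) \<Rightarrow> nat \<Rightarrow> 'a \<Rightarrow> enat" where
  "impulse_time \<alpha> 0 \<omega> = Inf {i. \<exists>k. i = enat k \<and> \<alpha> k \<omega> \<noteq> None}"
| "impulse_time \<alpha> (Suc p) \<omega> = Inf {i. \<exists>k. i = enat k \<and> \<alpha> k \<omega> \<noteq> None \<and> impulse_time \<alpha> p \<omega> < enat k}"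

text \<open>Strategies must be \<open>U\<close>-valued at every point of the space, also where the
  impulse time is infinite; hence a default element of \<open>U\<close>.\<close>

definition impulse_size :: "(nat \<Rightarrow> 'a \<Rightarrow> 'b option) \<Rightarrow> nat \<Rightarrow> 'a \<Rightarrow> 'b" where
  "impulse_size \<alpha> p \<omega> = (case impulse_time \<alpha> p \<omega> of
     enat k \<Rightarrow> (case \<alpha> k \<omega> of Some \<beta> \<Rightarrow> \<beta> | None \<Rightarrow> SOME u. u \<in> U) | \<infinity> \<Rightarrow> SOME u. u \<in> U)"

lemma impulse_time_action: "impulse_time \<alpha> p \<omega> = enat k \<Longrightarrow> \<alpha> k \<omega> \<noteq> None"
  by (cases p) (auto dest: Inf_enat_in)

lemma impulse_time_Suc_less: "impulse_time \<alpha> (Suc p) \<omega> = enat k \<Longrightarrow> impulse_time \<alpha> p \<omega> < enat k"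
  by (auto dest: Inf_enat_in)

lemma impulse_time_0_le: "\<alpha> k \<omega> \<noteq> None \<Longrightarrow> impulse_time \<alpha> 0 \<omega> \<le> enat k"
  by (auto intro!: Inf_lower)

lemma impulse_time_Suc_le:
  "\<alpha> k \<omega> \<noteq> None \<Longrightarrow> impulse_time \<alpha> p \<omega> < enat k \<Longrightarrow> impulse_time \<alpha> (Suc p) \<omega> \<le> enat k"
  by (auto intro!: Inf_lower)

context
  fixes \<alpha> :: "nat \<Rightarrow> 'a \<Rightarrow> 'b option"
  assumes \<alpha>: "control \<alpha>"
    and adm: "\<And>k \<omega>. \<omega> \<in> space M \<Longrightarrow> admissible (state \<alpha> k \<omega>) (\<alpha> k \<omega>)"
begin

lemma impulse_time_delayed:
  assumes "\<omega> \<in> space M"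
  shows "impulse_time \<alpha> p \<omega> + enat \<Delta> \<le> impulse_time \<alpha> (Suc p) \<omega>"
proof (cases "impulse_time \<alpha> (Suc p) \<omega>")
  case (enat j)
  then have less: "impulse_time \<alpha> p \<omega> < enat j" by (rule impulse_time_Suc_less)
  then obtain k where k: "impulse_time \<alpha> p \<omega> = enat k" by (cases "impulse_time \<alpha> p \<omega>") auto
  have "k + \<Delta> \<le> j"
    by (rule admissible_control_spaced[where \<alpha>=\<alpha> and \<omega>=\<omega>])
      (use adm[OF assms] impulse_time_action[OF k] impulse_time_action[OF enat] less k in auto)
  with k enat show ?thesis by simp
qed simp

text \<open>If the action at \<open>k\<close> were missed, every impulse time would stay below
  \<open>k\<close>, but the one numbered \<open>k\<close> is at least \<open>k\<close>.\<close>

lemma impulse_time_hits: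
  assumes "\<omega> \<in> space M" and k: "\<alpha> k \<omega> \<noteq> None"
  shows "\<exists>p. impulse_time \<alpha> p \<omega> = enat k"
proof (rule ccontr)
  assume no: "\<nexists>p. impulse_time \<alpha> p \<omega> = enat k"
  have "impulse_time \<alpha> p \<omega> < enat k" for p
  proof (induction p)
    case 0
    with impulse_time_0_le[of \<alpha> k \<omega>, OF k] no show ?case using order.not_eq_order_implies_strict by blast
  next
    case (Suc p)
    with impulse_time_Suc_le[of \<alpha> k \<omega> p, OF k Suc.IH] no show ?case using order.not_eq_order_implies_strict by blast
  qed
  from this[of k] delayed_ge[of "\<lambda>p. impulse_time \<alpha> p \<omega>" k, OF impulse_time_delayed[OF assms(1)]]
  show False by simp
qed

lemma act_impulse:
  assumes "\<omega> \<in> space M"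
  shows "act (impulse_time \<alpha>) (impulse_size \<alpha>) k \<omega> = \<alpha> k \<omega>"
proof (cases "\<alpha> k \<omega>")
  case None
  then have "impulse_time \<alpha> p \<omega> \<noteq> enat k" for p using impulse_time_action[of \<alpha> p \<omega> k] by auto
  with None show ?thesis by (simp add: act_None)
next
  case (Some \<beta>)
  then obtain p where p: "impulse_time \<alpha> p \<omega> = enat k" using impulse_time_hits[OF assms, of k] by auto
  from act_eq[of "impulse_time \<alpha>" \<omega> p k "impulse_size \<alpha>", OF impulse_time_delayed[OF assms] p]
  show ?thesis using p Some by (simp add: impulse_size_def)
qed

lemma action_pred: "Measurable.pred (F k) (\<lambda>\<omega>. \<alpha> k \<omega> \<noteq> None)"
  using action_events[OF \<alpha>, of "\<lambda>a. a \<noteq> None" k] by (simp add: pred_def space_F)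

lemma stopping_time_impulse_time: "stopping_time (filt_ext F) (impulse_time \<alpha> p)"
proof (induction p)
  case 0
  have "Measurable.pred (filt_ext F i) (\<lambda>\<omega>. \<exists>k. i = enat k \<and> \<alpha> k \<omega> \<noteq> None)" for i
    using action_pred by (cases i) auto
  then show ?case
    unfolding impulse_time.simps[abs_def] by (rule stopping_time_Inf_enat[OF filtration_filt_ext])
next
  case (Suc p)
  have "Measurable.pred (F j) (\<lambda>\<omega>. \<alpha> j \<omega> \<noteq> None \<and> impulse_time \<alpha> p \<omega> < enat j)" for j
  proof -
    note [measurable] = stopping_time_events(3)[OF Suc order_refl, of j] action_pred
    show ?thesis unfolding not_le[symmetric] by measurable
  qed
  then have "Measurable.pred (filt_ext F i)
      (\<lambda>\<omega>. \<exists>k. i = enat k \<and> \<alpha> k \<omega> \<noteq> None \<and> impulse_time \<alpha> p \<omega> < enat k)" for i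
    by (cases i) auto
  then show ?case
    unfolding impulse_time.simps[abs_def] by (rule stopping_time_Inf_enat[OF filtration_filt_ext])
qed

lemma impulse_size_in: "\<omega> \<in> space M \<Longrightarrow> impulse_size \<alpha> p \<omega> \<in> U"
proof -
  assume \<omega>: "\<omega> \<in> space M"
  have u: "(SOME u. u \<in> U) \<in> U" using U by (simp add: some_in_eq)
  have "\<beta> \<in> U" if "\<alpha> k \<omega> = Some \<beta>" for k \<beta>
  proof -
    have "\<alpha> k \<omega> \<in> actions" using \<alpha> \<omega> by (simp add: control_def)
    with that show ?thesis by (auto simp: actions_def)
  qed
  with u show ?thesis by (auto simp: impulse_size_def split: enat.split option.split)
qed

text \<open>On the event that the impulse time is \<open>k\<close>, the size is read off from
  \<open>\<alpha> k\<close> and is known at time \<open>k\<close>. Where the time is infinite the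
  size is the default, which enters only at the index \<open>\<infinity>\<close>.\<close>

lemma impulse_size_measurable:
  "impulse_size \<alpha> p \<in> borel_measurable (filtration.pre_sigma (space M) (filt_ext F) (impulse_time \<alpha> p))"
proof -
  interpret ext: filtration "space M" "filt_ext F" by (rule filtration_filt_ext)
  note stop = stopping_time_impulse_time[of p]
  have time: "{\<omega>\<in>space M. impulse_time \<alpha> p \<omega> = enat k} \<in> sets (F k)" for k
    using stopping_time_events(2)[OF stop, of k k] by (simp add: pred_def space_F)
  have fin: "{\<omega>\<in>space M. impulse_size \<alpha> p \<omega> = \<beta> \<and> impulse_time \<alpha> p \<omega> = enat k} \<in> sets (F k)" for k \<beta>
  proof -
    have "{\<omega>\<in>space M. impulse_size \<alpha> p \<omega> = \<beta> \<and> impulse_time \<alpha> p \<omega> = enat k} =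
        {\<omega>\<in>space M. \<alpha> k \<omega> = Some \<beta>} \<inter> {\<omega>\<in>space M. impulse_time \<alpha> p \<omega> = enat k}"
      using impulse_time_action[of \<alpha> p _ k] by (auto simp: impulse_size_def split: option.splits)
    also have "\<dots> \<in> sets (F k)" using \<alpha> time by (intro sets.Int) (auto simp: control_def)
    finally show ?thesis .
  qed
  have F_ext: "A \<in> sets (filt_ext F t)" if "A \<in> sets (F k)" "enat k \<le> t" for A k t
    using ext.sets_F_mono[OF that(2)] that(1) by auto
  have "{\<omega>\<in>space M. impulse_size \<alpha> p \<omega> = \<beta>} \<in> sets (ext.pre_sigma (impulse_time \<alpha> p))" for \<beta>
  proof (rule ext.sets_pre_sigmaI[OF stop])
    fix t
    let ?I = "{\<omega>\<in>space M. impulse_time \<alpha> p \<omega> = \<infinity>}"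
    have inf: "?I \<in> sets (filt_ext F \<infinity>)"
    proof -
      have "?I = space (filt_ext F \<infinity>) - (\<Union>k. {\<omega>\<in>space M. impulse_time \<alpha> p \<omega> = enat k})"
        by (auto simp: ext.space_F)
      also have "\<dots> \<in> sets (filt_ext F \<infinity>)"
        by (intro sets.Diff sets.top sets.countable_UN image_subsetI F_ext[OF time]) simp
      finally show ?thesis .
    qed
    have "{\<omega>\<in>{\<omega>\<in>space M. impulse_size \<alpha> p \<omega> = \<beta>}. impulse_time \<alpha> p \<omega> \<le> t} =
        (\<Union>k\<in>{k. enat k \<le> t}. {\<omega>\<in>space M. impulse_size \<alpha> p \<omega> = \<beta> \<and> impulse_time \<alpha> p \<omega> = enat k}) \<union>
        (if t = \<infinity> \<and> (SOME u. u \<in> U) = \<beta> then ?I else {})" (is "?L = ?R")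
    proof (intro set_eqI)
      fix \<omega>
      show "\<omega> \<in> ?L \<longleftrightarrow> \<omega> \<in> ?R"
        by (cases "impulse_time \<alpha> p \<omega>") (auto simp: impulse_size_def)
    qed
    also have "\<dots> \<in> sets (filt_ext F t)"
      using inf by (intro sets.Un sets.countable_UN') (auto intro: F_ext[OF fin])
    finally show "{\<omega>\<in>{\<omega>\<in>space M. impulse_size \<alpha> p \<omega> = \<beta>}. impulse_time \<alpha> p \<omega> \<le> t} \<in> sets (filt_ext F t)" .
  qed
  then show ?thesis
  proof (intro measurableI)
    fix A assume "A \<in> sets (borel :: 'b measure)"
      and *: "\<And>\<beta>. {\<omega>\<in>space M. impulse_size \<alpha> p \<omega> = \<beta>} \<in> sets (ext.pre_sigma (impulse_time \<alpha> p))"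
    have "impulse_size \<alpha> p -` A \<inter> space (ext.pre_sigma (impulse_time \<alpha> p)) =
        (\<Union>\<beta>\<in>U \<inter> A. {\<omega>\<in>space M. impulse_size \<alpha> p \<omega> = \<beta>})"
      using impulse_size_in by (auto simp: ext.space_pre_sigma)
    also have "\<dots> \<in> sets (ext.pre_sigma (impulse_time \<alpha> p))"
      using U * by (intro sets.finite_UN) auto
    finally show "impulse_size \<alpha> p -` A \<inter> space (ext.pre_sigma (impulse_time \<alpha> p)) \<in> sets (ext.pre_sigma (impulse_time \<alpha> p))" .
  qed simp
qed

lemma impulse_strategy: "(impulse_time \<alpha>, impulse_size \<alpha>) \<in> strategies M F \<Delta> U"
  unfolding strategies_def
  using stopping_time_impulse_time impulse_time_delayed impulse_size_measurable impulse_size_in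
  by (auto simp del: impulse_time.simps)

end

section \<open>The feedback strategy and its optimality\<close>

context
  fixes V :: "nat \<Rightarrow> 'b \<Rightarrow> 'a \<Rightarrow> real"
  assumes V: "decaying V"
    "\<And>k c. AE \<omega> in M. V k c \<omega> = G k c \<omega> + max (obstacle V k c \<omega>) (E k (V (Suc k) c) \<omega>)"
begin

text \<open>A feedback rule needs the state, and the state of a control needs its past actions.
  Generating the states first breaks this circle; the control is then read off from them.\<close>

primrec closed_loop :: "nat \<Rightarrow> 'a \<Rightarrow> 'b \<times> 'b \<times> nat" where
  "closed_loop 0 \<omega> = (0, 0, 0)"
| "closed_loop (Suc k) \<omega> = step (closed_loop k \<omega>) (feedback V k (closed_loop k \<omega>) \<omega>)"

lemma closed_loop_reachable: "closed_loop k \<omega> \<in> reachable k"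
proof (induction k)
  case (Suc k)
  then have "(closed_loop k \<omega>, feedback V k (closed_loop k \<omega>) \<omega>) \<in> reachable k \<times> actions"
    using feedback_in_actions[OF V] by simp
  from imageI[OF this, of "\<lambda>(s, a). step s a"] show ?case by simp
qed simp

lemma closed_loop_events: "{\<omega>\<in>space M. closed_loop k \<omega> = s} \<in> sets (F k)"
proof (induction k arbitrary: s)
  case 0
  then show ?case using sets.top[of "F 0"] by (cases "s = (0, 0, 0)") (auto simp: space_F)
next
  case (Suc k)
  have "{\<omega>\<in>space M. closed_loop (Suc k) \<omega> = s} =
      (\<Union>sa\<in>{sa\<in>reachable k \<times> actions. step (fst sa) (snd sa) = s}.
        {\<omega>\<in>space M. closed_loop k \<omega> = fst sa} \<inter> {\<omega>\<in>space M. feedback V k (fst sa) \<omega> = snd sa})" (is "?L = ?R")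
  proof (intro set_eqI iffI)
    fix \<omega> assume \<omega>: "\<omega> \<in> ?L"
    then have "(closed_loop k \<omega>, feedback V k (closed_loop k \<omega>) \<omega>) \<in>
        {sa\<in>reachable k \<times> actions. step (fst sa) (snd sa) = s}"
      using closed_loop_reachable feedback_in_actions[OF V] by simp
    then show "\<omega> \<in> ?R" by (rule UN_I) (use \<omega> in simp)
  qed auto
  also have "\<dots> \<in> sets (F k)"
    using Suc finite_actions finite_reachable[of k] feedback_events[OF V]
    by (intro sets.finite_UN) auto
  finally show ?case using sets_F_mono[of k "Suc k"] by auto
qed

definition optimal_control :: "nat \<Rightarrow> 'a \<Rightarrow> 'b option" where
  "optimal_control k \<omega> = feedback V k (closed_loop k \<omega>) \<omega>"

lemma state_optimal_control: "state optimal_control k \<omega> = closed_loop k \<omega>"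
  by (induction k) (simp_all add: optimal_control_def)

lemma control_optimal_control: "control optimal_control"
  unfolding control_def
proof (intro allI conjI ballI)
  fix k \<omega> a
  show "optimal_control k \<omega> \<in> actions"
    unfolding optimal_control_def by (rule feedback_in_actions[OF V])
  have "{\<omega>\<in>space M. optimal_control k \<omega> = a} =
      (\<Union>s\<in>reachable k. {\<omega>\<in>space M. closed_loop k \<omega> = s} \<inter> {\<omega>\<in>space M. feedback V k s \<omega> = a})"
    using closed_loop_reachable by (auto simp: optimal_control_def)
  also have "\<dots> \<in> sets (F k)"
    using closed_loop_events feedback_events[OF V] by (intro sets.finite_UN finite_reachable) auto
  finally show "{\<omega>\<in>space M. optimal_control k \<omega> = a} \<in> sets (F k)" .
qed

lemma payoff_le_value:
  assumes "\<delta> \<in> strategies M F \<Delta> U"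
  shows "payoff M \<Delta> \<theta> X g \<Psi> \<delta> \<le> (\<integral>\<omega>. V 0 0 \<omega> \<partial>M)"
proof -
  obtain \<tau> \<zeta> where \<delta>: "\<delta> = (\<tau>, \<zeta>)" by (cases \<delta>)
  with assms have s: "(\<tau>, \<zeta>) \<in> strategies M F \<Delta> U" by simp
  show ?thesis
    unfolding \<delta> payoff_eq[OF s] by (rule verification(1)[OF V control_act[OF s] act_admissible[OF s]])
qed

text \<open>Turning the feedback control into a strategy and back returns the same actions on
  \<open>space M\<close>. The induced control is therefore the feedback of its own state, and the
  equality case of the verification applies.\<close>

lemma optimal_strategy_exists: "\<exists>\<delta>\<in>strategies M F \<Delta> U. payoff M \<Delta> \<theta> X g \<Psi> \<delta> = (\<integral>\<omega>. V 0 0 \<omega> \<partial>M)"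
proof -
  have adm: "admissible (state optimal_control k \<omega>) (optimal_control k \<omega>)" for k \<omega>
    unfolding state_optimal_control by (simp add: optimal_control_def feedback_admissible[OF V])
  note s = impulse_strategy[OF control_optimal_control adm]
  let ?\<alpha> = "act (impulse_time optimal_control) (impulse_size optimal_control)"
  have act: "?\<alpha> k \<omega> = optimal_control k \<omega>" if "\<omega> \<in> space M" for k \<omega>
    by (rule act_impulse[OF control_optimal_control adm that])
  have state: "state ?\<alpha> k \<omega> = closed_loop k \<omega>" if "\<omega> \<in> space M" for k \<omega>
    unfolding state_optimal_control[symmetric] by (induction k) (simp_all add: act[OF that])
  have "total_reward ?\<alpha> = (\<integral>\<omega>. V 0 0 \<omega> \<partial>M)"
  proof (rule verification(2)[OF V control_act[OF s] act_admissible[OF s]])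
    show "?\<alpha> k \<omega> = feedback V k (state ?\<alpha> k \<omega>) \<omega>" if "\<omega> \<in> space M" for k \<omega>
      unfolding act[OF that] state[OF that] by (rule optimal_control_def)
  qed
  with payoff_eq[OF s] s show ?thesis by metis
qed

end

text \<open>The event that \<open>h\<close> exceeds its mean cannot have probability one, since
  integrating would put the mean strictly above itself; by the zero-one hypothesis it is null.
  Applying this to \<open>f\<close> and to \<open>- f\<close> gives equality.\<close>

lemma AE_eq_integral_of_trivial:
  fixes f :: "'a \<Rightarrow> real"
  assumes f: "integrable M f" "f \<in> borel_measurable (F k)"
    and trivial: "\<forall>A\<in>sets (F k). measure M A = 0 \<or> measure M A = 1"
  shows "AE \<omega> in M. f \<omega> = (\<integral>\<omega>. f \<omega> \<partial>M)"
proof -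
  have le: "AE \<omega> in M. h \<omega> \<le> (\<integral>\<omega>. h \<omega> \<partial>M)" if h: "integrable M h" "h \<in> borel_measurable (F k)" for h :: "'a \<Rightarrow> real"
  proof -
    let ?A = "{\<omega>\<in>space (F k). (\<integral>\<omega>. h \<omega> \<partial>M) < h \<omega>}"
    have A: "?A \<in> sets (F k)" using h(2) by measurable
    have "measure M ?A \<noteq> 1"
    proof
      assume "measure M ?A = 1"
      then have "AE \<omega> in M. \<omega> \<in> ?A" using prob_eq_1[OF sets_F_M[OF A]] by simp
      then have "AE \<omega> in M. (\<integral>\<omega>. h \<omega> \<partial>M) < h \<omega>" by eventually_elim simp
      then have "(\<integral>\<omega>. (\<integral>\<omega>. h \<omega> \<partial>M) \<partial>M) < (\<integral>\<omega>. h \<omega> \<partial>M)"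
        by (intro integral_less_AE_space h(1)) (auto simp: emeasure_space_1)
      then show False by (simp add: prob_space)
    qed
    with trivial A have "measure M ?A = 0" by blast
    then have "AE \<omega> in M. \<omega> \<notin> ?A" using prob_eq_0[OF sets_F_M[OF A]] by simp
    then show ?thesis using AE_space by eventually_elim (auto simp: space_F not_less)
  qed
  from le[OF f] le[of "\<lambda>\<omega>. - f \<omega>"] f show ?thesis by auto
qed

end

text \<open>The limit process at time 0 is a random variable in general, while the supremum is a
  number. The identity is therefore stated in mean, and almost surely when every event of
  \<open>F 0\<close> has probability 0 or 1. In \<open>ereal\<close> the supremum needs no prior
  bound on the payoffs.\<close>

theorem theorem3p10:
  fixes M :: "'a measure"
    and F :: "nat \<Rightarrow> 'a measure"
    and \<Delta> :: nat
    and \<theta> :: real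
    and U :: "(real ^ 'd) set"
    and X :: "nat \<Rightarrow> 'a \<Rightarrow> real ^ 'd"
    and g \<Psi> :: "real ^ 'd \<Rightarrow> real"
  assumes "prob_space M"
    and "filtration (space M) F"
    and "\<And>n. subalgebra M (F n)"
    and "\<Delta> > 0"
    and "\<theta> > 0"
    and "finite U" and "U \<noteq> {}"
    and "\<And>n. X n \<in> borel_measurable (F n)"
    and "g \<in> borel_measurable borel" and "bounded (range g)"
    and "\<Psi> \<in> borel_measurable (restrict_space borel U)" and "bounded (\<Psi> ` U)"
  shows "\<exists>\<delta>opt \<in> strategies M F \<Delta> U.
      ereal (payoff M \<Delta> \<theta> X g \<Psi> \<delta>opt) =
        (SUP \<delta>\<in>strategies M F \<Delta> U. ereal (payoff M \<Delta> \<theta> X g \<Psi> \<delta>))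
    \<and> ereal (LINT \<omega>|M. Y_lim M F \<Delta> \<theta> U X g \<Psi> (\<lambda>_. 0) (\<lambda>_. 0) 0 \<omega>) =
        (SUP \<delta>\<in>strategies M F \<Delta> U. ereal (payoff M \<Delta> \<theta> X g \<Psi> \<delta>))
    \<and> ((\<forall>A\<in>sets (F 0). measure M A = 0 \<or> measure M A = 1) \<longrightarrow>
        (AE \<omega> in M. ereal (Y_lim M F \<Delta> \<theta> U X g \<Psi> (\<lambda>_. 0) (\<lambda>_. 0) 0 \<omega>) =
          (SUP \<delta>\<in>strategies M F \<Delta> U. ereal (payoff M \<Delta> \<theta> X g \<Psi> \<delta>))))"
proof -
  from assms(10) obtain K where K: "\<And>x. \<bar>g x\<bar> \<le> K"
    by (auto simp: bounded_iff)
  from assms(12) obtain L where L: "\<And>\<beta>. \<beta> \<in> U \<Longrightarrow> \<bar>\<Psi> \<beta>\<bar> \<le> L"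
    by (auto simp: bounded_iff)
  interpret prob_space M by (rule assms(1))
  interpret filtration "space M" F by (rule assms(2))
  interpret impulse_control M F "exp (- \<theta>)" \<Delta> \<theta> U X g \<Psi> K L
    by unfold_locales (use assms K L in auto)
  obtain V where V: "decaying V"
    "\<And>k c. AE \<omega> in M. V k c \<omega> = G k c \<omega> + max (obstacle V k c \<omega>) (E k (V (Suc k) c) \<omega>)"
    by (rule value_exists) blast
  let ?J = "payoff M \<Delta> \<theta> X g \<Psi>" and ?Y = "Y_lim M F \<Delta> \<theta> U X g \<Psi> (\<lambda>_. 0) (\<lambda>_. 0) 0"
  obtain \<delta>opt where opt: "\<delta>opt \<in> strategies M F \<Delta> U" "?J \<delta>opt = (\<integral>\<omega>. V 0 0 \<omega> \<partial>M)"
    using optimal_strategy_exists[OF V] by blast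
  have sup: "(SUP \<delta>\<in>strategies M F \<Delta> U. ereal (?J \<delta>)) = ereal (\<integral>\<omega>. V 0 0 \<omega> \<partial>M)"
  proof (rule antisym)
    show "(SUP \<delta>\<in>strategies M F \<Delta> U. ereal (?J \<delta>)) \<le> ereal (\<integral>\<omega>. V 0 0 \<omega> \<partial>M)"
      using payoff_le_value[OF V] by (intro SUP_least) simp
    show "ereal (\<integral>\<omega>. V 0 0 \<omega> \<partial>M) \<le> (SUP \<delta>\<in>strategies M F \<Delta> U. ereal (?J \<delta>))"
      using opt by (intro SUP_upper2[of \<delta>opt]) auto
  qed
  have Y: "AE \<omega> in M. ?Y \<omega> = V 0 0 \<omega>" "?Y \<in> borel_measurable M"
    using Y_lim_eq[OF V, where c=0 and k=0] by (simp_all add: enat_0)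
  have int: "(LINT \<omega>|M. ?Y \<omega>) = (\<integral>\<omega>. V 0 0 \<omega> \<partial>M)"
    by (intro integral_cong_AE Y decaying_measurable[OF V(1)])
  have "AE \<omega> in M. ereal (?Y \<omega>) = ereal (\<integral>\<omega>. V 0 0 \<omega> \<partial>M)"
    if "\<forall>A\<in>sets (F 0). measure M A = 0 \<or> measure M A = 1"
    using AE_eq_integral_of_trivial[OF decaying_integrable[OF V(1)] decaying_adapted[OF V(1)] that] Y(1)
    by eventually_elim simp
  with opt int show ?thesis unfolding sup by auto
qed

end
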